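(* For each $p\in(1,\infty]$ there is a constant $C_p>0$ such that for all $f\in L^p(\Omega_0)$ $$\|M^*f\|_{L^p}\le C_p\,\|f\|_{L^p},$$ where $M^*f=\sup_{n,m\in\mathbb Z}|f_{n,m}|$ and $f_{n,m}=\mathbb E[f\mid\mathcal F_{n,m}]$, $\mathcal F_{n,m}=\mathcal F_{n\lambda_1+m\lambda_2}$.
   Context: Coxeter complex. Let $\mathfrak a=\{x\in\mathbb R^3:x_1+x_2+x_3=0\}$, $\alpha_1=e_2-e_1$, $\alpha_2=e_3-e_2$, $\alpha_0=e_3-e_1$. Let $\{\lambda_1,\lambda_2\}\subset\mathfrak a$ be the basis dual to $\{\alpha_1,\alpha_2\}$ and $P=\mathbb Z\lambda_1+\mathbb Z\lambda_2$. Let $\Sigma$ be the $\tilde A_2$ Coxeter complex, i.e. the triangulation of $\mathfrak a$ cut out by the lines $\{\langle x,\alpha_j\rangle=k\}$, $j\in\{0,1,2\}$, $k\in\mathbb Z$; its maximal simplexes are called chambers and its vertex set is $P$. The three types of vertices are the orbits of the vertices under the affine Weyl group generated by the orthogonal reflections in these lines. Put $\mathcal S_0=\{x\in\mathfrak a:\langle x,\alpha_1\rangle>0,\langle x,\alpha_2\rangle>0\}$. A sector in $\Sigma$ with base vertex $\lambda\in P$ is a set $\lambda+w\mathcal S_0$, with $w$ in the finite group $W_0$ generated by the reflections in $\{\langle x,\alpha_1\rangle=0\}$ and $\{\langle x,\alpha_2\rangle=0\}$. Building. $\mathscr X$ is a triangle building ($\tilde A_2$ building): a simplicial complex whose vertices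 each carry one of the three types, with a family of subcomplexes (apartments) such that each apartment is type-isomorphic to $\Sigma$; any two simplexes lie in a common apartment; and for any two apartments with a common chamber there is a type-preserving isomorphism between them fixing their intersection pointwise. The system of apartments is complete (every subcomplex type-isomorphic to $\Sigma$ is an apartment), and every edge lies in exactly $q+1$ chambers, where $2\le q<\infty$ is a fixed integer. A sector of $\mathscr X$ is a sector in some apartment; two sectors are equivalent if they contain a common subsector; $\Omega$ is the set of equivalence classes. For a vertex $x$ and $\omega\in\Omega$, $[x,\omega]$ is the unique sector with base vertex $x$ representing $\omega$. Any $\omega,\omega'\in\Omega$ are represented by sectors in a common apartment; they are opposite if that apartment is unique, and it is then denoted $[\omega,\omega']$. Filtration and measure. Fix a vertex $O$ of $\mathscr X$ of the same type as $0\in\Sigma$ and a point $\omega_0\in\Omega$; let $\mathscr S_0=[O,\omega_0]$, and let $\Omega_0\subset\Omega$ be the set of $\omega$ opposite to $\omega_0$. Let $\mathscr A_0$ be an apartment containing $\mathscr S_0$, $\psi:\mathscr A_0\to\Sigma$ the type-preserving isomorphism with $\psi(\mathscr S_0)=-\mathcal S_0$, $\rho_0:\mathscr X\to\mathscr A_0$ the retraction centred at $\omega_0$ (on any apartment containing a subsector of $\mathscr S_0$ it is the isomorphism onto $\mathscr A_0$ fixing the intersection pointwise), and $\rho=\psi\circ\rho_0$. For a vertex $x$ let $E_x=\{\omega\in\Omega_0: x\in[\omega,\omega_0]\}$. For $\lambda\in P$, $\mathcal F_\lambda$ is the $\sigma$-field generated by the (countably many, mutually disjoint) sets $E_x$ with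 $\rho(x)=\lambda$. Let $\mathcal F=\sigma(\bigcup_{\lambda\in P}\mathcal F_\lambda)$ and let $\pi$ be the unique measure on $(\Omega_0,\mathcal F)$ with $\pi(E_x)=q^{-2\langle\lambda,\alpha_0\rangle}$ whenever $\rho(x)=\lambda$. All $\sigma$-fields are extended by the $\pi$-null sets. $L^p(\Omega_0)=L^p(\Omega_0,\mathcal F,\pi)$. *)

theory Defs
  imports "HOL-Probability.Probability" "HOL-Probability.Essential_Supremum"
begin

section \<open>The Coxeter complex of type \<open>\<tilde>A\<^sub>2\<close>\<close>

definition plane_a :: "(real^3) set" where
  "plane_a = {x. x $ 1 + x $ 2 + x $ 3 = 0}"

definition alpha0 :: "real^3" where "alpha0 = axis 3 1 - axis 1 1"
definition alpha1 :: "real^3" where "alpha1 = axis 2 1 - axis 1 1"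
definition alpha2 :: "real^3" where "alpha2 = axis 3 1 - axis 2 1"

definition lambda1 :: "real^3" where "lambda1 = vector [- 2 / 3, 1 / 3, 1 / 3]"
definition lambda2 :: "real^3" where "lambda2 = vector [- 1 / 3, - 1 / 3, 2 / 3]"

lemma inner_alpha:
  "x \<bullet> alpha0 = x $ 3 - x $ 1" "x \<bullet> alpha1 = x $ 2 - x $ 1" "x \<bullet> alpha2 = x $ 3 - x $ 2"
  by (simp_all add: alpha0_def alpha1_def alpha2_def inner_diff_right inner_axis)

lemma dual_basis:
  "lambda1 \<in> plane_a" "lambda2 \<in> plane_a"
  "lambda1 \<bullet> alpha1 = 1" "lambda1 \<bullet> alpha2 = 0"
  "lambda2 \<bullet> alpha1 = 0" "lambda2 \<bullet> alpha2 = 1"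
  by (simp_all add: inner_alpha plane_a_def lambda1_def lambda2_def)

lemma dual_basis_expansion:
  assumes "x \<in> plane_a"
  shows "x = (x \<bullet> alpha1) *\<^sub>R lambda1 + (x \<bullet> alpha2) *\<^sub>R lambda2"
  using assms
  by (simp add: vec_eq_iff forall_3 inner_alpha plane_a_def lambda1_def lambda2_def field_simps)

definition weight :: "int \<Rightarrow> int \<Rightarrow> real^3" where
  "weight n m = of_int n *\<^sub>R lambda1 + of_int m *\<^sub>R lambda2"

definition weight_lattice :: "(real^3) set" where
  "weight_lattice = {weight n m | n m. True}"

definition wall :: "real^3 \<Rightarrow> int \<Rightarrow> (real^3) set" where
  "wall a k = {x \<in> plane_a. x \<bullet> a = of_int k}"

definition wall_reflection :: "real^3 \<Rightarrow> int \<Rightarrow> real^3 \<Rightarrow> real^3" where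
  "wall_reflection a k x = x - (2 * (x \<bullet> a - of_int k) / (a \<bullet> a)) *\<^sub>R a"

text \<open>The group generated by a set \<open>R\<close> of involutions; no closure under inverses is needed.\<close>

inductive_set reflection_group :: "('a \<Rightarrow> 'a) set \<Rightarrow> ('a \<Rightarrow> 'a) set"
  for R :: "('a \<Rightarrow> 'a) set" where
  id: "id \<in> reflection_group R"
| step: "r \<in> R \<Longrightarrow> w \<in> reflection_group R \<Longrightarrow> r \<circ> w \<in> reflection_group R"

definition affine_weyl_group :: "(real^3 \<Rightarrow> real^3) set" where
  "affine_weyl_group =
     reflection_group {wall_reflection a k | a k. a \<in> {alpha0, alpha1, alpha2}}"

definition finite_weyl_group :: "(real^3 \<Rightarrow> real^3) set" where
  "finite_weyl_group = reflection_group {wall_reflection alpha1 0, wall_reflection alpha2 0}"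

text \<open>
  Simplexes are nonempty finite sets of vertices, so a complex \<open>K\<close> has vertex set \<open>\<Union>K\<close>.  The chambers
  of the Coxeter complex are the triangles that the walls cut out; each is recorded by its vertices.
\<close>

definition cox_chambers :: "(real^3) set set" where
  "cox_chambers = {closure C \<inter> weight_lattice | C.
     C \<in> components (plane_a - (\<Union>a\<in>{alpha0, alpha1, alpha2}. \<Union>k. wall a k))}"

definition cox_complex :: "(real^3) set set" where
  "cox_complex = {s. s \<noteq> {} \<and> (\<exists>C\<in>cox_chambers. s \<subseteq> C)}"

text \<open>The type of a vertex is its orbit under the affine Weyl group.\<close>

definition cox_type :: "real^3 \<Rightarrow> (real^3) set" where
  "cox_type x = {w x | w. w \<in> affine_weyl_group}"

definition cox_types :: "(real^3) set set" where
  "cox_types = cox_type ` weight_lattice"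

definition base_sector :: "(real^3) set" where
  "base_sector = {x \<in> plane_a. x \<bullet> alpha1 > 0 \<and> x \<bullet> alpha2 > 0}"

definition cox_sector :: "real^3 \<Rightarrow> (real^3 \<Rightarrow> real^3) \<Rightarrow> (real^3) set" where
  "cox_sector l w = (\<lambda>y. l + w y) ` base_sector"


section \<open>Triangle buildings\<close>

definition chambers :: "'v set set \<Rightarrow> 'v set set" where
  "chambers X = {C \<in> X. \<forall>D\<in>X. C \<subseteq> D \<longrightarrow> D = C}"

text \<open>\<open>type_iso t t' A B \<phi>\<close>: the vertex map \<open>\<phi>\<close> is a type-preserving simplicial isomorphism from \<open>A\<close>
  onto \<open>B\<close>, where \<open>t\<close> and \<open>t'\<close> give the types of the vertices.\<close>

definition type_iso ::
  "('v \<Rightarrow> 't) \<Rightarrow> ('w \<Rightarrow> 't) \<Rightarrow> 'v set set \<Rightarrow> 'w set set \<Rightarrow> ('v \<Rightarrow> 'w) \<Rightarrow> bool" where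
  "type_iso t t' A B \<phi> \<longleftrightarrow>
     bij_betw \<phi> (\<Union>A) (\<Union>B) \<and> (\<lambda>s. \<phi> ` s) ` A = B \<and> (\<forall>v\<in>\<Union>A. t' (\<phi> v) = t v)"

abbreviation chart :: "('v \<Rightarrow> (real^3) set) \<Rightarrow> 'v set set \<Rightarrow> ('v \<Rightarrow> real^3) \<Rightarrow> bool" where
  "chart t A \<phi> \<equiv> type_iso t cox_type A cox_complex \<phi>"

locale triangle_building =
  fixes X :: "'v set set" and t :: "'v \<Rightarrow> (real^3) set" and Apts :: "'v set set set" and q :: nat
  assumes simplex: "s \<in> X \<Longrightarrow> finite s \<and> s \<noteq> {}"
    and face: "s \<in> X \<Longrightarrow> r \<subseteq> s \<Longrightarrow> r \<noteq> {} \<Longrightarrow> r \<in> X"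
    and types: "v \<in> \<Union>X \<Longrightarrow> t v \<in> cox_types"
    and apartment_subcomplex: "A \<in> Apts \<Longrightarrow> A \<subseteq> X"
    and apartment_chart: "A \<in> Apts \<Longrightarrow> \<exists>\<phi>. chart t A \<phi>"
    and common_apartment: "r \<in> X \<Longrightarrow> s \<in> X \<Longrightarrow> \<exists>A\<in>Apts. r \<in> A \<and> s \<in> A"
    and apartment_iso: "A \<in> Apts \<Longrightarrow> B \<in> Apts \<Longrightarrow> C \<in> chambers X \<Longrightarrow> C \<in> A \<Longrightarrow> C \<in> B \<Longrightarrow>
           \<exists>\<phi>. type_iso t t A B \<phi> \<and> (\<forall>v\<in>\<Union>A \<inter> \<Union>B. \<phi> v = v)"
    and complete: "A \<subseteq> X \<Longrightarrow> \<exists>\<phi>. chart t A \<phi> \<Longrightarrow> A \<in> Apts"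
    and thickness: "2 \<le> q"
    and regular: "e \<in> X \<Longrightarrow> card e = 2 \<Longrightarrow> card {C \<in> chambers X. e \<subseteq> C} = q + 1"

text \<open>
  Sectors are sets of points, not of vertices.  A point of a complex is given by its barycentric
  coordinates, and a vertex map \<open>\<phi>\<close> into Euclidean space extends affinely to the points.
\<close>

type_synonym 'v point = "'v \<Rightarrow> real"

definition realization :: "'v set set \<Rightarrow> 'v point set" where
  "realization A =
     {b. \<exists>s\<in>A. (\<forall>v\<in>s. b v > 0) \<and> (\<forall>v. v \<notin> s \<longrightarrow> b v = 0) \<and> (\<Sum>v\<in>s. b v) = 1}"

definition extend_affine :: "('v \<Rightarrow> real^3) \<Rightarrow> 'v point \<Rightarrow> real^3" where
  "extend_affine \<phi> b = (\<Sum>v | b v \<noteq> 0. b v *\<^sub>R \<phi> v)"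

definition sector_in :: "('v \<Rightarrow> (real^3) set) \<Rightarrow> 'v set set \<Rightarrow> 'v \<Rightarrow> 'v point set \<Rightarrow> bool" where
  "sector_in t A x S \<longleftrightarrow> x \<in> \<Union>A \<and> (\<exists>\<phi> w. chart t A \<phi> \<and> w \<in> finite_weyl_group \<and>
     S = {b \<in> realization A. extend_affine \<phi> b \<in> cox_sector (\<phi> x) w})"

definition sectors :: "('v \<Rightarrow> (real^3) set) \<Rightarrow> 'v set set set \<Rightarrow> 'v point set set" where
  "sectors t Apts = {S. \<exists>A\<in>Apts. \<exists>x. sector_in t A x S}"

definition sector_equiv ::
  "('v \<Rightarrow> (real^3) set) \<Rightarrow> 'v set set set \<Rightarrow> ('v point set \<times> 'v point set) set" where
  "sector_equiv t Apts = {(S, T). S \<in> sectors t Apts \<and> T \<in> sectors t Apts \<and>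
     (\<exists>U\<in>sectors t Apts. U \<subseteq> S \<and> U \<subseteq> T)}"

type_synonym 'v boundary_point = "'v point set set"

definition boundary :: "('v \<Rightarrow> (real^3) set) \<Rightarrow> 'v set set set \<Rightarrow> 'v boundary_point set" where
  "boundary t Apts = sectors t Apts // sector_equiv t Apts"

definition joins ::
  "('v \<Rightarrow> (real^3) set) \<Rightarrow> 'v set set \<Rightarrow> 'v boundary_point \<Rightarrow> 'v boundary_point \<Rightarrow> bool" where
  "joins t A \<omega> \<omega>' \<longleftrightarrow> (\<exists>S\<in>\<omega>. \<exists>x. sector_in t A x S) \<and> (\<exists>S\<in>\<omega>'. \<exists>x. sector_in t A x S)"

definition opposite ::
  "('v \<Rightarrow> (real^3) set) \<Rightarrow> 'v set set set \<Rightarrow> 'v boundary_point \<Rightarrow> 'v boundary_point \<Rightarrow> bool" where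
  "opposite t Apts \<omega> \<omega>' \<longleftrightarrow> (\<exists>!A. A \<in> Apts \<and> joins t A \<omega> \<omega>')"

definition apartment_between ::
  "('v \<Rightarrow> (real^3) set) \<Rightarrow> 'v set set set \<Rightarrow> 'v boundary_point \<Rightarrow> 'v boundary_point \<Rightarrow> 'v set set"
  where
  "apartment_between t Apts \<omega> \<omega>' = (THE A. A \<in> Apts \<and> joins t A \<omega> \<omega>')"

definition retraction_from_sector ::
  "('v \<Rightarrow> (real^3) set) \<Rightarrow> 'v set set set \<Rightarrow> 'v point set \<Rightarrow> 'v set set \<Rightarrow> ('v \<Rightarrow> 'v) \<Rightarrow> bool" where
  "retraction_from_sector t Apts S A0 \<rho>0 \<longleftrightarrow>
     (\<forall>A\<in>Apts. (\<exists>U\<in>sectors t Apts. U \<subseteq> S \<and> U \<subseteq> realization A) \<longrightarrow>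
        type_iso t t A A0 \<rho>0 \<and> (\<forall>v\<in>\<Union>A \<inter> \<Union>A0. \<rho>0 v = v))"


section \<open>The filtration on the set of points opposite to \<open>\<omega>0\<close>\<close>

definition opposite_set ::
  "('v \<Rightarrow> (real^3) set) \<Rightarrow> 'v set set set \<Rightarrow> 'v boundary_point \<Rightarrow> 'v boundary_point set" where
  "opposite_set t Apts \<omega>0 = {\<omega> \<in> boundary t Apts. opposite t Apts \<omega> \<omega>0}"

definition atom ::
  "('v \<Rightarrow> (real^3) set) \<Rightarrow> 'v set set set \<Rightarrow> 'v boundary_point \<Rightarrow> 'v \<Rightarrow> 'v boundary_point set" where
  "atom t Apts \<omega>0 x = {\<omega> \<in> opposite_set t Apts \<omega>0. x \<in> \<Union>(apartment_between t Apts \<omega> \<omega>0)}"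

definition atoms ::
  "'v set set \<Rightarrow> ('v \<Rightarrow> (real^3) set) \<Rightarrow> 'v set set set \<Rightarrow> 'v boundary_point \<Rightarrow> ('v \<Rightarrow> real^3) \<Rightarrow>
     real^3 \<Rightarrow> 'v boundary_point set set" where
  "atoms X t Apts \<omega>0 \<rho> l = {atom t Apts \<omega>0 x | x. x \<in> \<Union>X \<and> \<rho> x = l}"

definition boundary_measure ::
  "'v set set \<Rightarrow> ('v \<Rightarrow> (real^3) set) \<Rightarrow> 'v set set set \<Rightarrow> nat \<Rightarrow> 'v boundary_point \<Rightarrow>
     ('v \<Rightarrow> real^3) \<Rightarrow> 'v boundary_point measure \<Rightarrow> bool" where
  "boundary_measure X t Apts q \<omega>0 \<rho> M \<longleftrightarrow>
     space M = opposite_set t Apts \<omega>0 \<and>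
     sets M = sigma_sets (opposite_set t Apts \<omega>0) (\<Union>l\<in>weight_lattice.
       sigma_sets (opposite_set t Apts \<omega>0) (atoms X t Apts \<omega>0 \<rho> l)) \<and>
     (\<forall>x\<in>\<Union>X. emeasure M (atom t Apts \<omega>0 x) = ennreal (real q powr (- 2 * (\<rho> x \<bullet> alpha0))))"

text \<open>The null sets adjoined are those of the completed measure.\<close>

definition boundary_filtration ::
  "'v set set \<Rightarrow> ('v \<Rightarrow> (real^3) set) \<Rightarrow> 'v set set set \<Rightarrow> 'v boundary_point \<Rightarrow> ('v \<Rightarrow> real^3) \<Rightarrow>
     'v boundary_point measure \<Rightarrow> real^3 \<Rightarrow> 'v boundary_point measure" where
  "boundary_filtration X t Apts \<omega>0 \<rho> M l =
     sigma (opposite_set t Apts \<omega>0) (atoms X t Apts \<omega>0 \<rho> l \<union> null_sets (completion M))"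


section \<open>Lebesgue spaces and the maximal function\<close>

definition ennreal_powr :: "ennreal \<Rightarrow> real \<Rightarrow> ennreal" where
  "ennreal_powr x a = (if x = \<infinity> then \<infinity> else ennreal (enn2real x powr a))"

definition Lp_norm :: "ennreal \<Rightarrow> 'a measure \<Rightarrow> ('a \<Rightarrow> ennreal) \<Rightarrow> ennreal" where
  "Lp_norm p M g =
     (if p = \<infinity> then esssup M g
      else ennreal_powr (\<integral>\<^sup>+ x. ennreal_powr (g x) (enn2real p) \<partial>M) (1 / enn2real p))"

definition Lp_space :: "ennreal \<Rightarrow> 'a measure \<Rightarrow> ('a \<Rightarrow> complex) set" where
  "Lp_space p M = {f \<in> borel_measurable M. Lp_norm p M (\<lambda>x. ennreal (cmod (f x))) < \<infinity>}"

definition complex_cond_exp :: "'a measure \<Rightarrow> 'a measure \<Rightarrow> ('a \<Rightarrow> complex) \<Rightarrow> 'a \<Rightarrow> complex" where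
  "complex_cond_exp M F f x =
     Complex (real_cond_exp M F (\<lambda>y. Re (f y)) x) (real_cond_exp M F (\<lambda>y. Im (f y)) x)"

definition maximal_function ::
  "'a measure \<Rightarrow> (real^3 \<Rightarrow> 'a measure) \<Rightarrow> ('a \<Rightarrow> complex) \<Rightarrow> 'a \<Rightarrow> ennreal" where
  "maximal_function M F f x =
     (SUP (n, m) \<in> UNIV. ennreal (cmod (complex_cond_exp M (F (weight n m)) f x)))"

end

theory Submission
  imports Defs
begin

text \<open>
  Every \<open>\<omega>\<close> opposite to \<open>\<omega>0\<close> is recorded by the vertices \<open>vtx n m
  \<omega>\<close> over \<open>weight n m\<close> of the apartment \<open>[\<omega>, \<omega>0]\<close>, and
  conditioning on the \<open>(n, m)\<close>-th field of the filtration is averaging over the classes of \<open>vtx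
  n m\<close>. Apartments that share \<open>vtx n m\<close> also share the sector towards \<open>\<omega>0\<close>,
  so the partitions are nested in \<open>n\<close> and in \<open>m\<close> separately. Although the averages do not
  commute, for \<open>n \<le> N\<close>, \<open>m < T\<close> and \<open>f \<ge> 0\<close> one has \<open>A n m f
  \<le> q / (q - 1) * A n T (A N m (A n T (A N m f)))\<close>: two rays that leave a vertex in directions
  \<open>120\<close> degrees apart span a common sector, hence three alternate averages charge all pairs in general
  position uniformly, and the fourth one fills in the exceptional pairs. For fixed \<open>T\<close> and
  \<open>N\<close> both families of averages are one-parameter martingales, and Doob's inequality is applied four
  times. The cardinalities in the links that this needs follow from the regularity of the building together with
  the prescribed measures.
\<close>

section \<open>The triangular lattice\<close>

text \<open>The geometry supplies only upper bounds and uniqueness: at most \<open>q\<close>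
  continuations across an edge, no 4-cycles in links, unique completion of certain corners.
  Equalities come back from the masses: a set of known mass cut into at most \<open>q\<close>
  pieces, none above the \<open>q\<close>-th part, has exactly \<open>q\<close> equal pieces. Thus
  no apartment through prescribed vertices is constructed; where one is wanted, an intersection of
  blocks is shown to have positive mass.

  Two members of a block over \<open>(n, m)\<close> are exceptional when they also agree over
  \<open>(n - 1, m + 1)\<close>: their points in the link are then already joined by that vertex, so
  by girth different points have no second joining line over \<open>(n + 1, m)\<close>. For a fixed
  partner this concerns the share \<open>1 / q\<close> of every smaller block over
  \<open>(N, m)\<close>, whatever \<open>N\<close>, and \<open>q / (q - 1)\<close> is the reciprocal
  of what remains.

  The estimate is uniform in \<open>T\<close> and \<open>N\<close>. For indices between
  \<open>-K\<close> and \<open>K\<close> the one choice \<open>T = N = K + 1\<close> is enough, and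
  monotone convergence removes the box.\<close>

definition hex :: "(int \<times> int) set" where
  "hex = {(1, 0), (0, 1), (-1, 1), (-1, 0), (0, -1), (1, -1)}"

definition up :: "int \<Rightarrow> int \<Rightarrow> (int \<times> int) set" where
  "up n m = {(n, m), (n + 1, m), (n, m + 1)}"

definition down :: "int \<Rightarrow> int \<Rightarrow> (int \<times> int) set" where
  "down n m = {(n + 1, m), (n, m + 1), (n + 1, m + 1)}"

definition triangles :: "(int \<times> int) set set" where
  "triangles = {T. \<exists>n m. T = up n m \<or> T = down n m}"

definition tri_complex :: "(int \<times> int) set set" where
  "tri_complex = {s. s \<noteq> {} \<and> (\<exists>T\<in>triangles. s \<subseteq> T)}"

lemma up_triangle [simp]: "up n m \<in> triangles" and down_triangle [simp]: "down n m \<in> triangles"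
  by (auto simp: triangles_def)

lemma triangle_in_complex: "T \<in> triangles \<Longrightarrow> T \<in> tri_complex"
  by (auto simp: tri_complex_def triangles_def up_def down_def)

lemma hex_cases:
  assumes "(c - a, d - b) \<in> hex"
  obtains "c = a + 1" "d = b" | "c = a" "d = b + 1" | "c = a - 1" "d = b + 1"
    | "c = a - 1" "d = b" | "c = a" "d = b - 1" | "c = a + 1" "d = b - 1"
  using assms unfolding hex_def insert_iff empty_iff prod.inject by (elim disjE conjE) (simp_all add: diff_eq_eq)

lemma edge_iff: "{u, v} \<in> tri_complex \<and> u \<noteq> v \<longleftrightarrow> v - u \<in> hex"
proof
  assume "{u, v} \<in> tri_complex \<and> u \<noteq> v"
  then obtain n m where "{u, v} \<subseteq> up n m \<or> {u, v} \<subseteq> down n m" "u \<noteq> v"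
    by (auto simp: tri_complex_def triangles_def)
  then show "v - u \<in> hex"
    unfolding up_def down_def insert_subset insert_iff empty_iff
    by (elim disjE conjE) (simp_all add: hex_def)
next
  obtain a b c d where uv: "u = (a, b)" "v = (c, d)" by fastforce
  assume "v - u \<in> hex"
  then have "(c - a, d - b) \<in> hex" by (simp add: uv)
  then have "{u, v} \<subseteq> up a b \<or> {u, v} \<subseteq> down (a - 1) b \<or> {u, v} \<subseteq> up (a - 1) b \<or>
      {u, v} \<subseteq> up a (b - 1) \<or> {u, v} \<subseteq> down a (b - 1)"
    unfolding uv by (cases rule: hex_cases) (simp_all add: up_def down_def)
  moreover have "u \<noteq> v"
    using \<open>v - u \<in> hex\<close> by (auto simp: hex_def zero_prod_def)
  ultimately show "{u, v} \<in> tri_complex \<and> u \<noteq> v"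
    by (auto simp: tri_complex_def intro: up_triangle down_triangle)
qed

lemma card_triangle: "T \<in> triangles \<Longrightarrow> card T = 3"
  by (auto simp: triangles_def up_def down_def)

lemma simplex_card_le:
  assumes "s \<in> tri_complex"
  shows "finite s \<and> card s \<le> 3"
proof -
  obtain T where T: "T \<in> triangles" "s \<subseteq> T" using assms by (auto simp: tri_complex_def)
  then have "finite T" by (auto simp: triangles_def up_def down_def)
  with T card_mono[of T s] card_triangle[of T] show ?thesis
    by (auto intro: finite_subset)
qed

lemma triangle_iff: "s \<in> tri_complex \<and> card s = 3 \<longleftrightarrow> s \<in> triangles"
proof
  assume "s \<in> tri_complex \<and> card s = 3"
  then obtain T where T: "T \<in> triangles" "s \<subseteq> T" "card s = 3"
    by (auto simp: tri_complex_def)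
  then have "s = T"
    using card_subset_eq[of T s] card_triangle[of T] card.infinite[of T] by fastforce
  with T show "s \<in> triangles" by simp
qed (auto simp: triangle_in_complex card_triangle)

text \<open>The two solutions are the rotations of \<open>(a, b)\<close> by 60 degrees in either
  sense; in the basis \<open>lambda1\<close>, \<open>lambda2\<close> these have integral
  matrices.\<close>

lemma common_neighbours:
  assumes "(a, b) \<in> hex" "(c, d) \<in> hex" "(c - a, d - b) \<in> hex"
  shows "(c, d) = (- b, a + b) \<or> (c, d) = (a + b, - a)"
  using assms unfolding hex_def insert_iff empty_iff by (elim disjE) simp_all

lemma triangle_completion:
  assumes "v - u \<in> hex" "w - u \<in> hex" "w - v \<in> hex"
  shows "{u, v, w} \<in> triangles"
proof -
  obtain a b c d e f where uv: "u = (a, b)" "v = (c, d)" "w = (e, f)" by (metis surj_pair)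
  have vu: "(c - a, d - b) \<in> hex" using assms by (simp add: uv)
  have "(e - a, f - b) = (- (d - b), c - a + (d - b)) \<or> (e - a, f - b) = (c - a + (d - b), - (c - a))"
    using assms by (intro common_neighbours) (simp_all add: uv)
  then have w: "w = (a + b - d, c - a + d) \<or> w = (c + d - b, a + b - c)"
    unfolding uv by auto
  have "{u, v, w} = up a b \<or> {u, v, w} = down (a - 1) b \<or> {u, v, w} = up (a - 1) b
    \<or> {u, v, w} = down (a - 1) (b - 1) \<or> {u, v, w} = up a (b - 1) \<or> {u, v, w} = down a (b - 1)"
    using vu w unfolding uv(1,2)
    by (cases rule: hex_cases; elim disjE) (simp_all add: up_def down_def insert_commute add.commute)
  then show ?thesis by (auto simp: triangles_def)
qed

text \<open>The two triangles on an edge form a rhombus, whose diagonals bisect each other. This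
  lets three known vertices determine a fourth.\<close>

lemma opposite_vertices:
  assumes "v - u \<in> hex" "w - u \<in> hex" "w - v \<in> hex" "w' - u \<in> hex" "w' - v \<in> hex" "w \<noteq> w'"
  shows "w + w' = u + v"
proof -
  obtain a b where v: "v - u = (a, b)" by fastforce
  have *: "z - u = (- b, a + b) \<or> z - u = (a + b, - a)" if "z - u \<in> hex" "z - v \<in> hex" for z
  proof -
    obtain c d where z: "z - u = (c, d)" by fastforce
    have "z - v = (c - a, d - b)" using v z by (metis diff_Pair diff_diff_eq2 diff_add_cancel)
    then show ?thesis using common_neighbours[of a b c d] that v z assms(1) by metis
  qed
  have "w - u \<noteq> w' - u" using assms(6) by simp
  then have "(w - u) + (w' - u) = v - u"
    using *[OF assms(2,3)] *[OF assms(4,5)] v by (elim disjE) simp_all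
  then show ?thesis by (simp add: algebra_simps)
qed

text \<open>The link of a lattice point is a hexagon. In a 4-cycle with \<open>p\<close> and
  \<open>p'\<close> different, these would be the two apexes both over the edge from
  \<open>x\<close> to \<open>l\<close> and over the edge from \<open>x\<close> to \<open>l'\<close>;
  the rhombus rule then gives \<open>l = l'\<close>.\<close>

lemma no_four_cycle:
  assumes "p - x \<in> hex" "p' - x \<in> hex" "l - x \<in> hex" "l' - x \<in> hex"
    and "p - l \<in> hex" "p - l' \<in> hex" "p' - l \<in> hex" "p' - l' \<in> hex"
  shows "p = p' \<or> l = l'"
proof (cases "p = p'")
  case False
  then have "p + p' = x + l" "p + p' = x + l'"
    using assms by (auto intro!: opposite_vertices)
  then show ?thesis by simp
qed simp

section \<open>Automorphisms of the triangular lattice\<close>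

definition affine_map :: "int \<times> int \<Rightarrow> int \<times> int \<Rightarrow> int \<times> int \<Rightarrow> int \<times> int \<Rightarrow> int \<times> int" where
  "affine_map p \<mu> \<nu> z = (fst p + fst z * fst \<mu> + snd z * fst \<nu>, snd p + fst z * snd \<mu> + snd z * snd \<nu>)"

text \<open>Two unit vectors at 60 degrees, in either orientation: the possible bases of a
  sector.\<close>

definition hex_pair :: "int \<times> int \<Rightarrow> int \<times> int \<Rightarrow> bool" where
  "hex_pair \<mu> \<nu> \<longleftrightarrow> \<mu> \<in> hex \<and> \<nu> \<in> hex \<and> \<nu> - \<mu> \<in> hex"

definition tri_auto :: "(int \<times> int \<Rightarrow> int \<times> int) \<Rightarrow> bool" where
  "tri_auto g \<longleftrightarrow> inj g \<and> (\<forall>s\<in>tri_complex. g ` s \<in> tri_complex)"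

text \<open>Neighbours go to neighbours and injectivity keeps the two apexes over an edge apart, so
  the rhombus rule holds for the images. Once \<open>g\<close> is affine on one triangle, it is
  forced on each adjacent triangle, and so everywhere.\<close>

theorem tri_auto_affine:
  assumes "tri_auto g"
  obtains p \<mu> \<nu> where "hex_pair \<mu> \<nu>" "\<And>z. g z = affine_map p \<mu> \<nu> z"
proof -
  have adj: "g v - g u \<in> hex" if "v - u \<in> hex" for u v
  proof -
    have "{u, v} \<in> tri_complex" "u \<noteq> v" using that edge_iff by blast+
    then have "{g u, g v} \<in> tri_complex" "g u \<noteq> g v"
      using assms by (auto simp: tri_auto_def inj_eq)
    then show ?thesis using edge_iff by blast
  qed
  have par: "g w' = g u + g v - g w"
    if "v - u \<in> hex" "w - u \<in> hex" "w - v \<in> hex" "w' - u \<in> hex" "w' - v \<in> hex" "w \<noteq> w'" for u v w w'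
  proof -
    have "g w \<noteq> g w'" using that(6) assms by (simp add: tri_auto_def inj_eq)
    then have "g w + g w' = g u + g v" by (intro opposite_vertices adj that)
    then show ?thesis by (simp add: algebra_simps)
  qed
  define p \<mu> \<nu> where "p = g (0, 0)" and "\<mu> = g (1, 0) - p" and "\<nu> = g (0, 1) - p"
  have pair: "hex_pair \<mu> \<nu>"
    using adj[of "(1,0)" "(0,0)"] adj[of "(0,1)" "(0,0)"] adj[of "(0,1)" "(1,0)"]
    by (simp add: hex_pair_def \<mu>_def \<nu>_def p_def) (simp add: hex_def)
  let ?h = "affine_map p \<mu> \<nu>"
  \<comment> \<open>Agreement with the affine map on \<open>up n m\<close>. The rules
    \<open>s1\<close> to \<open>s4\<close> move this triangle by one step in each direction, by two
    rhombi each.\<close>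
  define P where "P n m \<longleftrightarrow> g (n, m) = ?h (n, m) \<and> g (n + 1, m) = ?h (n + 1, m) \<and> g (n, m + 1) = ?h (n, m + 1)"
    for n m
  have P0: "P 0 0"
    by (simp add: P_def affine_map_def \<mu>_def \<nu>_def p_def)
  have corner: "g (n + 1, m + 1) = ?h (n + 1, m + 1)" if "P n m" for n m
    using that par[of "(n, m + 1)" "(n + 1, m)" "(n, m)" "(n + 1, m + 1)"]
    by (simp add: P_def affine_map_def hex_def algebra_simps)
  have s1: "P (n + 1) m" if "P n m" for n m
    using that corner[OF that] par[of "(n + 1, m + 1)" "(n + 1, m)" "(n, m + 1)" "(n + 1 + 1, m)"]
    by (simp add: P_def affine_map_def hex_def algebra_simps)
  have s2: "P n (m + 1)" if "P n m" for n m
    using that corner[OF that] par[of "(n + 1, m + 1)" "(n, m + 1)" "(n + 1, m)" "(n, m + 1 + 1)"]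
    by (simp add: P_def affine_map_def hex_def algebra_simps)
  have s3: "P (n - 1) m" if "P n m" for n m
  proof -
    have 1: "g (n - 1, m + 1) = ?h (n - 1, m + 1)"
      using that par[of "(n, m + 1)" "(n, m)" "(n + 1, m)" "(n - 1, m + 1)"]
      by (simp add: P_def affine_map_def hex_def algebra_simps)
    have "g (n - 1, m) = ?h (n - 1, m)"
      using that 1 par[of "(n - 1, m + 1)" "(n, m)" "(n, m + 1)" "(n - 1, m)"]
      by (simp add: P_def affine_map_def hex_def algebra_simps)
    with 1 that show ?thesis by (simp add: P_def)
  qed
  have s4: "P n (m - 1)" if "P n m" for n m
  proof -
    have 1: "g (n + 1, m - 1) = ?h (n + 1, m - 1)"
      using that par[of "(n + 1, m)" "(n, m)" "(n, m + 1)" "(n + 1, m - 1)"]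
      by (simp add: P_def affine_map_def hex_def algebra_simps)
    have "g (n, m - 1) = ?h (n, m - 1)"
      using that 1 par[of "(n + 1, m - 1)" "(n, m)" "(n + 1, m)" "(n, m - 1)"]
      by (simp add: P_def affine_map_def hex_def algebra_simps)
    with 1 that show ?thesis by (simp add: P_def)
  qed
  have "P n 0" for n
    by (induction n rule: int_induct[where k = 0]) (auto intro: P0 s1 s3)
  then have "P n m" for n m
    by (induction m rule: int_induct[where k = 0]) (auto intro: s2 s4)
  then have "g z = ?h z" for z by (cases z) (simp add: P_def)
  with pair that show thesis by blast
qed

lemma affine_map_eq:
  assumes "T \<in> triangles" "\<And>z. z \<in> T \<Longrightarrow> affine_map p \<mu> \<nu> z = affine_map p' \<mu>' \<nu>' z"
  shows "affine_map p \<mu> \<nu> z = affine_map p' \<mu>' \<nu>' z"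
proof -
  obtain n m where "T = up n m \<or> T = down n m" using assms(1) by (auto simp: triangles_def)
  then have "\<mu> = \<mu>' \<and> \<nu> = \<nu>' \<and> p = p'"
  proof
    assume "T = up n m"
    then show ?thesis
      using assms(2)[of "(n, m)"] assms(2)[of "(n + 1, m)"] assms(2)[of "(n, m + 1)"]
      by (simp add: up_def affine_map_def prod_eq_iff algebra_simps)
  next
    assume "T = down n m"
    then show ?thesis
      using assms(2)[of "(n + 1, m + 1)"] assms(2)[of "(n + 1, m)"] assms(2)[of "(n, m + 1)"]
      by (simp add: down_def affine_map_def prod_eq_iff algebra_simps)
  qed
  then show ?thesis by simp
qed

lemma tri_auto_unique:
  assumes "tri_auto g" "tri_auto g'" "T \<in> triangles" "\<And>z. z \<in> T \<Longrightarrow> g z = g' z"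
  shows "g z = g' z"
proof -
  obtain p \<mu> \<nu> where g: "\<And>z. g z = affine_map p \<mu> \<nu> z" using tri_auto_affine[OF assms(1)] by metis
  obtain p' \<mu>' \<nu>' where g': "\<And>z. g' z = affine_map p' \<mu>' \<nu>' z" using tri_auto_affine[OF assms(2)] by metis
  show ?thesis unfolding g g'
    by (rule affine_map_eq[OF assms(3)]) (metis assms(4) g g')
qed

text \<open>Normalised so that crossing any edge changes the height by exactly one.\<close>

definition tri_height :: "(int \<times> int) set \<Rightarrow> int" where
  "tri_height T = (2 * (\<Sum>z\<in>T. fst z + snd z)) div 3"

lemma height_up [simp]: "tri_height (up n m) = 2 * (n + m) + 1"
  and height_down [simp]: "tri_height (down n m) = 2 * (n + m) + 2"
  by (simp_all add: tri_height_def up_def down_def)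

text \<open>If the heights differ by more than one, the values of \<open>fst z + snd z\<close> on
  the two triangles overlap in at most one number, and one of the triangles takes it at a single
  vertex. So there is no room for a common edge.\<close>

lemma height_adjacent:
  assumes "T \<in> triangles" "T' \<in> triangles" "u \<in> T" "u \<in> T'" "v \<in> T" "v \<in> T'" "u \<noteq> v"
  shows "tri_height T' \<le> tri_height T + 1"
proof (rule ccontr)
  assume *: "\<not> ?thesis"
  obtain n m where T: "T = up n m \<or> T = down n m" using assms(1) by (auto simp: triangles_def)
  obtain n' m' where T': "T' = up n' m' \<or> T' = down n' m'" using assms(2) by (auto simp: triangles_def)
  have "\<exists>y. \<forall>z. z \<in> T \<longrightarrow> z \<in> T' \<longrightarrow> z = y"
    using T T'
  proof (elim disjE)
    assume TT: "T = up n m" "T' = up n' m'"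
    have "n + m < n' + m'" using * TT by simp
    then have "z = (n', m')" if "z \<in> T" "z \<in> T'" for z
      using that unfolding TT up_def insert_iff empty_iff prod_eq_iff fst_conv snd_conv by smt
    then show ?thesis by blast
  next
    assume TT: "T = up n m" "T' = down n' m'"
    have "n + m < n' + m' + 1" using * TT by simp
    then have "z \<noteq> z" if "z \<in> T" "z \<in> T'" for z
      using * that unfolding TT up_def down_def insert_iff empty_iff prod_eq_iff fst_conv snd_conv
        height_up[unfolded up_def] height_down[unfolded down_def] by smt
    then show ?thesis by blast
  next
    assume TT: "T = down n m" "T' = up n' m'"
    have "n + m + 1 < n' + m'" using * TT by simp
    then have "z = (n', m')" if "z \<in> T" "z \<in> T'" for z
      using that unfolding TT up_def down_def insert_iff empty_iff prod_eq_iff fst_conv snd_conv by smt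
    then show ?thesis by blast
  next
    assume TT: "T = down n m" "T' = down n' m'"
    have "n + m < n' + m'" using * TT by simp
    then have "z = (n + 1, m + 1)" if "z \<in> T" "z \<in> T'" for z
      using that unfolding TT down_def insert_iff empty_iff prod_eq_iff fst_conv snd_conv by smt
    then show ?thesis by blast
  qed
  with assms(3-7) show False by metis
qed

text \<open>Of the six triangles around \<open>(n, m)\<close>, the one pointing in the direction of
  \<open>\<omega>0\<close> is the lowest. This bounds from below the end of a folded
  gallery.\<close>

lemma height_star: "T \<in> triangles \<Longrightarrow> (n, m) \<in> T \<Longrightarrow> tri_height (down (n - 1) (m - 1)) \<le> tri_height T"
  by (auto simp: triangles_def) (auto simp: up_def down_def)

text \<open>A chamber map of the lattice, which may fold; a retraction onto one apartment, read on
  another apartment, is of this kind.\<close>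

definition tri_fold :: "(int \<times> int \<Rightarrow> int \<times> int) \<Rightarrow> bool" where
  "tri_fold g \<longleftrightarrow> (\<forall>T\<in>triangles. inj_on g T \<and> g ` T \<in> triangles)"

lemma tri_fold_adjacent:
  assumes "tri_fold g" "T \<in> triangles" "T' \<in> triangles" "u \<in> T" "u \<in> T'" "v \<in> T" "v \<in> T'" "u \<noteq> v"
  shows "tri_height (g ` T') \<le> tri_height (g ` T) + 1"
  using assms by (intro height_adjacent[of _ _ "g u" "g v"]) (auto simp: tri_fold_def inj_on_def)

text \<open>A gallery of alternating \<open>up\<close> and \<open>down\<close> triangles with
  growing coordinates rises by one at each crossing, and its image under a fold can rise no
  faster.\<close>

lemma tri_fold_height:
  assumes g: "tri_fold g" and "i \<le> n" "j \<le> m"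
  shows "tri_height (g ` down n m) \<le> tri_height (g ` down i j) + (2 * (n + m) - 2 * (i + j))"
    "tri_height (g ` down n m) \<le> tri_height (g ` up i j) + (2 * (n + m) - 2 * (i + j) + 1)"
proof -
  have ud: "tri_height (g ` down i j) \<le> tri_height (g ` up i j) + 1" for i j
    by (rule tri_fold_adjacent[OF g, of _ _ "(i + 1, j)" "(i, j + 1)"]) (rule up_triangle down_triangle | simp add: up_def down_def)+
  have du1: "tri_height (g ` up (i + 1) j) \<le> tri_height (g ` down i j) + 1" for i j
    by (rule tri_fold_adjacent[OF g, of _ _ "(i + 1, j)" "(i + 1, j + 1)"]) (rule up_triangle down_triangle | simp add: up_def down_def)+
  have du2: "tri_height (g ` up i (j + 1)) \<le> tri_height (g ` down i j) + 1" for i j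
    by (rule tri_fold_adjacent[OF g, of _ _ "(i, j + 1)" "(i + 1, j + 1)"]) (rule up_triangle down_triangle | simp add: up_def down_def)+
  have 1: "tri_height (g ` down n m) \<le> tri_height (g ` down n j) + (2 * (m - j))" for n
    using \<open>j \<le> m\<close>
  proof (induction m rule: int_ge_induct)
    case (step m)
    then show ?case using du2[of n m] ud[of n "m + 1"] by simp
  qed simp
  have 2: "tri_height (g ` down n j) \<le> tri_height (g ` down i j) + (2 * (n - i))"
    using \<open>i \<le> n\<close>
  proof (induction n rule: int_ge_induct)
    case (step n)
    then show ?case using du1[of n j] ud[of "n + 1" j] by simp
  qed simp
  show "tri_height (g ` down n m) \<le> tri_height (g ` down i j) + (2 * (n + m) - 2 * (i + j))"
    using 1 2 by smt
  then show "tri_height (g ` down n m) \<le> tri_height (g ` up i j) + (2 * (n + m) - 2 * (i + j) + 1)"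
    using ud[of i j] by linarith
qed

text \<open>Sectors are open cones, so their lattice points have both coordinates at least
  1.\<close>

definition zsector :: "int \<times> int \<Rightarrow> int \<times> int \<Rightarrow> int \<times> int \<Rightarrow> (int \<times> int) set" where
  "zsector p \<mu> \<nu> = affine_map p \<mu> \<nu> ` {(i, j). 1 \<le> i \<and> 1 \<le> j}"

section \<open>Coordinates on the Coxeter complex\<close>

lemma weight_inner [simp]:
  "weight n m \<bullet> alpha1 = of_int n" "weight n m \<bullet> alpha2 = of_int m" "weight n m \<bullet> alpha0 = of_int (n + m)"
  by (simp_all add: weight_def inner_alpha lambda1_def lambda2_def field_simps)

lemma weight_in_plane [simp]: "weight n m \<in> plane_a"
  by (simp add: weight_def plane_a_def lambda1_def lambda2_def)

lemma alpha0_sum: "x \<bullet> alpha0 = x \<bullet> alpha1 + x \<bullet> alpha2"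
  by (simp add: inner_alpha)

text \<open>The floor only serves to obtain integers; at lattice points nothing is rounded.\<close>

definition coord :: "real^3 \<Rightarrow> int \<times> int" where
  "coord x = (\<lfloor>x \<bullet> alpha1\<rfloor>, \<lfloor>x \<bullet> alpha2\<rfloor>)"

definition wt :: "int \<times> int \<Rightarrow> real^3" where
  "wt z = weight (fst z) (snd z)"

lemma coord_wt [simp]: "coord (wt z) = z"
  by (simp add: coord_def wt_def)

lemma coord_weight [simp]: "coord (weight n m) = (n, m)"
  by (simp add: coord_def)

lemma range_wt: "range wt = weight_lattice"
  by (auto simp: wt_def weight_lattice_def image_iff) (metis fst_conv snd_conv)

lemma wt_coord: "x \<in> weight_lattice \<Longrightarrow> wt (coord x) = x"
  by (metis range_wt coord_wt imageE)

text \<open>One unit strip for each wall direction. As \<open>alpha0\<close> is the sum of the other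
  two roots, a nonempty cell has \<open>l = j + k\<close> or \<open>l = j + k + 1\<close>: the two
  halves of a unit parallelogram.\<close>

definition cell :: "int \<Rightarrow> int \<Rightarrow> int \<Rightarrow> (real^3) set" where
  "cell j k l = {x \<in> plane_a. of_int j < x \<bullet> alpha1 \<and> x \<bullet> alpha1 < of_int j + 1 \<and>
     of_int k < x \<bullet> alpha2 \<and> x \<bullet> alpha2 < of_int k + 1 \<and> of_int l < x \<bullet> alpha0 \<and> x \<bullet> alpha0 < of_int l + 1}"

definition off_walls :: "(real^3) set" where
  "off_walls = plane_a - (\<Union>a\<in>{alpha0, alpha1, alpha2}. \<Union>k. wall a k)"

lemma off_walls_iff:
  "x \<in> off_walls \<longleftrightarrow> x \<in> plane_a \<and> (\<forall>a\<in>{alpha0, alpha1, alpha2}. \<forall>k. x \<bullet> a \<noteq> of_int k)"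
  by (auto simp: off_walls_def wall_def)

lemma plane_combination:
  assumes "x \<in> plane_a" "y \<in> plane_a"
  shows "a *\<^sub>R x + b *\<^sub>R y \<in> plane_a"
proof -
  have "a * (x $ 1 + x $ 2 + x $ 3) + b * (y $ 1 + y $ 2 + y $ 3) = 0"
    using assms by (simp add: plane_a_def)
  then show ?thesis by (simp add: plane_a_def algebra_simps)
qed

lemma convex_plane: "convex plane_a"
  unfolding convex_alt by (simp add: plane_combination)

lemma convex_cell: "convex (cell j k l)"
proof -
  have "cell j k l = plane_a \<inter> {x. alpha1 \<bullet> x > of_int j} \<inter> {x. alpha1 \<bullet> x < of_int j + 1}
    \<inter> {x. alpha2 \<bullet> x > of_int k} \<inter> {x. alpha2 \<bullet> x < of_int k + 1}
    \<inter> {x. alpha0 \<bullet> x > of_int l} \<inter> {x. alpha0 \<bullet> x < of_int l + 1}"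
    by (auto simp: cell_def inner_commute)
  then show ?thesis
    by (auto intro!: convex_Int convex_plane convex_halfspace_lt convex_halfspace_gt)
qed

lemma floor_avoid: "of_int k < (y::real) \<Longrightarrow> y < of_int k + 1 \<Longrightarrow> y \<noteq> of_int j"
  by (metis floor_of_int floor_unique less_le not_less of_int_less_iff)

lemma cell_off_walls: "cell j k l \<subseteq> off_walls"
  by (rule subsetI, unfold cell_def off_walls_iff) (use floor_avoid in blast)

lemma off_walls_cell:
  assumes "x \<in> off_walls"
  shows "x \<in> cell \<lfloor>x \<bullet> alpha1\<rfloor> \<lfloor>x \<bullet> alpha2\<rfloor> \<lfloor>x \<bullet> alpha0\<rfloor>"
proof -
  have "of_int \<lfloor>x \<bullet> a\<rfloor> < x \<bullet> a \<and> x \<bullet> a < of_int \<lfloor>x \<bullet> a\<rfloor> + 1" if "a \<in> {alpha0, alpha1, alpha2}" for a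
    using assms that unfolding off_walls_iff
    by (metis floor_correct less_le of_int_add of_int_1)
  then show ?thesis using assms by (auto simp: cell_def off_walls_iff)
qed

text \<open>On a connected set that avoids the walls, the pairing with each root takes an interval
  of values without integers, so the set stays in one strip. Conversely a cell is convex, hence
  connected.\<close>

lemma components_off_walls:
  "C \<in> components off_walls \<longleftrightarrow> (\<exists>j k l. C = cell j k l \<and> C \<noteq> {})"
proof -
  have comp: "connected_component_set off_walls x = cell j k l" if x: "x \<in> cell j k l" for x j k l
  proof
    show "cell j k l \<subseteq> connected_component_set off_walls x"
      by (intro connected_component_maximal x convex_connected convex_cell cell_off_walls)
    show "connected_component_set off_walls x \<subseteq> cell j k l"
    proof
      fix y assume "y \<in> connected_component_set off_walls x"
      then obtain T where T: "connected T" "T \<subseteq> off_walls" "x \<in> T" "y \<in> T"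
        by (auto simp: connected_component_def)
      have same: "of_int i < y \<bullet> a \<and> y \<bullet> a < of_int i + 1"
        if a: "a \<in> {alpha0, alpha1, alpha2}" and "of_int i < x \<bullet> a" "x \<bullet> a < of_int i + 1" for a i
      proof -
        have conn: "connected ((\<lambda>z. z \<bullet> a) ` T)"
          by (intro connected_continuous_image T continuous_intros)
        have avoid: "of_int r \<notin> (\<lambda>z. z \<bullet> a) ` T" for r
          using T(2) a unfolding off_walls_iff subset_iff image_iff by metis
        have "\<not> y \<bullet> a \<le> of_int i"
          using connectedD_interval[OF conn, of "y \<bullet> a" "x \<bullet> a" "of_int i"] T(3,4) avoid that by force
        moreover have "\<not> of_int i + 1 \<le> y \<bullet> a"
          using connectedD_interval[OF conn, of "x \<bullet> a" "y \<bullet> a" "of_int (i + 1)"] T(3,4) avoid[of "i + 1"] that by force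
        ultimately show ?thesis by simp
      qed
      have "y \<in> plane_a" using T by (auto simp: off_walls_iff)
      then show "y \<in> cell j k l"
        using x same[of alpha0 l] same[of alpha1 j] same[of alpha2 k] by (simp add: cell_def)
    qed
  qed
  show ?thesis
    unfolding components_def image_iff
    by (metis (no_types, lifting) all_not_in_conv comp cell_off_walls off_walls_cell subsetD)
qed

text \<open>A point with the weak inequalities is a limit of points on the open segment to the
  interior point \<open>x\<close>, and these satisfy the strict ones.\<close>

lemma closure_cell_vertices:
  assumes "x \<in> cell j k l" "v \<in> plane_a"
  shows "v \<in> closure (cell j k l) \<longleftrightarrow> of_int j \<le> v \<bullet> alpha1 \<and> v \<bullet> alpha1 \<le> of_int j + 1 \<and>
    of_int k \<le> v \<bullet> alpha2 \<and> v \<bullet> alpha2 \<le> of_int k + 1 \<and> of_int l \<le> v \<bullet> alpha0 \<and> v \<bullet> alpha0 \<le> of_int l + 1"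
    (is "_ \<longleftrightarrow> ?R v")
proof
  have "closed {v. ?R v}"
    by (intro closed_Collect_conj closed_Collect_le continuous_intros)
  moreover have "cell j k l \<subseteq> {v. ?R v}" by (auto simp: cell_def)
  ultimately show "v \<in> closure (cell j k l) \<Longrightarrow> ?R v"
    using closure_minimal by blast
next
  assume R: "?R v"
  have "open_segment v x \<subseteq> cell j k l"
  proof
    fix y assume "y \<in> open_segment v x"
    then obtain u where u: "0 < u" "u < 1" and y: "y = (1 - u) *\<^sub>R v + u *\<^sub>R x"
      by (auto simp: in_segment)
    have mix: "c < (1 - u) * a + u * b \<and> (1 - u) * a + u * b < c + 1"
      if "c \<le> a" "a \<le> c + 1" "c < b" "b < c + 1" for a b c :: real
    proof -
      have "(1 - u) * c \<le> (1 - u) * a" "(1 - u) * a \<le> (1 - u) * (c + 1)" "u * c < u * b" "u * b < u * (c + 1)"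
        using u that by (auto intro!: mult_left_mono)
      then show ?thesis by (simp add: algebra_simps)
    qed
    have "y \<in> plane_a" using convex_plane assms u unfolding y convex_alt by (auto simp: cell_def)
    moreover have "y \<bullet> a = (1 - u) * (v \<bullet> a) + u * (x \<bullet> a)" for a
      by (simp add: y inner_add_left)
    ultimately show "y \<in> cell j k l"
      using R assms(1) mix[of "of_int j" "v \<bullet> alpha1" "x \<bullet> alpha1"] mix[of "of_int k" "v \<bullet> alpha2" "x \<bullet> alpha2"]
        mix[of "of_int l" "v \<bullet> alpha0" "x \<bullet> alpha0"]
      by (auto simp: cell_def)
  qed
  then show "v \<in> closure (cell j k l)"
    using closure_mono[of "open_segment v x" "cell j k l"] assms(1)
    by (cases "v = x") (auto simp: closure_open_segment closure_subset[THEN subsetD])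
qed

lemma cell_vertices:
  assumes "cell j k l \<noteq> {}"
  shows "closure (cell j k l) \<inter> weight_lattice = wt ` (if l = j + k then up j k else down j k)"
proof -
  obtain x where x: "x \<in> cell j k l" using assms by blast
  then have "of_int l < (of_int (j + k + 2) :: real)" "of_int (j + k) < (of_int (l + 1) :: real)"
    by (auto simp: cell_def alpha0_sum)
  then have l: "l = j + k \<or> l = j + k + 1"
    unfolding of_int_less_iff by linarith
  have "wt z \<in> closure (cell j k l) \<longleftrightarrow> z \<in> (if l = j + k then up j k else down j k)" for z
  proof -
    have "wt z \<in> closure (cell j k l) \<longleftrightarrow> j \<le> fst z \<and> fst z \<le> j + 1 \<and> k \<le> snd z \<and> snd z \<le> k + 1 \<and>
      l \<le> fst z + snd z \<and> fst z + snd z \<le> l + 1"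
      unfolding closure_cell_vertices[OF x weight_in_plane[of "fst z" "snd z"], folded wt_def]
      by (simp add: wt_def) (metis (mono_tags, opaque_lifting) of_int_1 of_int_add of_int_le_iff)
    also have "\<dots> \<longleftrightarrow> z \<in> (if l = j + k then up j k else down j k)"
      using l by (cases z) (auto simp: up_def down_def)
    finally show ?thesis .
  qed
  then show ?thesis
    unfolding range_wt[symmetric] by auto
qed

lemma cell_nonempty: "cell j k (j + k) \<noteq> {}" "cell j k (j + k + 1) \<noteq> {}"
proof -
  have p: "weight j k + a *\<^sub>R weight 1 1 \<in> plane_a" for a
    using plane_combination[of "weight j k" "weight 1 1" 1 a] by simp
  \<comment> \<open>The centroids of \<open>up j k\<close> and \<open>down j k\<close>.\<close>
  have "weight j k + (1/3) *\<^sub>R weight 1 1 \<in> cell j k (j + k)"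
    "weight j k + (2/3) *\<^sub>R weight 1 1 \<in> cell j k (j + k + 1)"
    using p by (simp_all add: cell_def inner_add_left)
  then show "cell j k (j + k) \<noteq> {}" "cell j k (j + k + 1) \<noteq> {}" by blast+
qed

lemma cox_chambers_eq: "cox_chambers = (\<lambda>T. wt ` T) ` triangles"
proof (rule set_eqI)
  fix c
  have "c \<in> cox_chambers \<longleftrightarrow> (\<exists>j k l. cell j k l \<noteq> {} \<and> c = closure (cell j k l) \<inter> weight_lattice)"
    unfolding cox_chambers_def off_walls_def[symmetric] components_off_walls by blast
  also have "\<dots> \<longleftrightarrow> (\<exists>j k l. cell j k l \<noteq> {} \<and> c = wt ` (if l = j + k then up j k else down j k))"
    using cell_vertices by (intro ex_cong1 conj_cong refl) simp
  also have "\<dots> \<longleftrightarrow> (\<exists>j k. c = wt ` up j k \<or> c = wt ` down j k)"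
  proof (intro iffI; elim exE)
    fix j k l assume "cell j k l \<noteq> {} \<and> c = wt ` (if l = j + k then up j k else down j k)"
    then show "\<exists>j k. c = wt ` up j k \<or> c = wt ` down j k" by metis
  next
    fix j k assume "c = wt ` up j k \<or> c = wt ` down j k"
    then show "\<exists>j k l. cell j k l \<noteq> {} \<and> c = wt ` (if l = j + k then up j k else down j k)"
    proof
      assume "c = wt ` up j k"
      then show ?thesis using cell_nonempty(1)[of j k] by (intro exI[of _ j] exI[of _ k] exI[of _ "j + k"]) simp
    next
      assume "c = wt ` down j k"
      then show ?thesis using cell_nonempty(2)[of j k] by (intro exI[of _ j] exI[of _ k] exI[of _ "j + k + 1"]) simp
    qed
  qed
  also have "\<dots> \<longleftrightarrow> c \<in> (\<lambda>T. wt ` T) ` triangles"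
    unfolding triangles_def by blast
  finally show "c \<in> cox_chambers \<longleftrightarrow> c \<in> (\<lambda>T. wt ` T) ` triangles" .
qed

lemma cox_complex_eq: "cox_complex = (\<lambda>s. wt ` s) ` tri_complex"
proof (rule set_eqI)
  fix s
  have "s \<in> cox_complex \<longleftrightarrow> s \<noteq> {} \<and> (\<exists>T\<in>triangles. s \<subseteq> wt ` T)"
    unfolding cox_complex_def cox_chambers_eq by simp
  also have "\<dots> \<longleftrightarrow> (\<exists>r. r \<noteq> {} \<and> s = wt ` r \<and> (\<exists>T\<in>triangles. r \<subseteq> T))"
    unfolding subset_image_iff by blast
  also have "\<dots> \<longleftrightarrow> s \<in> (\<lambda>s. wt ` s) ` tri_complex"
    unfolding tri_complex_def by blast
  finally show "s \<in> cox_complex \<longleftrightarrow> s \<in> (\<lambda>s. wt ` s) ` tri_complex" .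
qed

lemma Union_tri_complex: "\<Union>tri_complex = UNIV"
proof -
  have "(n, m) \<in> \<Union>tri_complex" for n m
    using triangle_in_complex[OF up_triangle[of n m]] by (auto simp: up_def)
  then show ?thesis by auto
qed

lemma Union_cox_complex: "\<Union>cox_complex = weight_lattice"
  unfolding cox_complex_eq using Union_tri_complex
  by (metis (no_types, lifting) image_Union range_wt)

text \<open>A chart in integer coordinates with the types forgotten: the incidence arguments below
  do not see them.\<close>

definition zchart :: "'v set set \<Rightarrow> ('v \<Rightarrow> int \<times> int) \<Rightarrow> bool" where
  "zchart A z \<longleftrightarrow> bij_betw z (\<Union>A) UNIV \<and> (\<lambda>s. z ` s) ` A = tri_complex"

lemma chart_zchart:
  assumes "chart t A \<phi>"
  shows "zchart A (coord \<circ> \<phi>)"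
proof -
  have b: "bij_betw \<phi> (\<Union>A) weight_lattice" and im: "(\<lambda>s. \<phi> ` s) ` A = cox_complex"
    using assms by (auto simp: type_iso_def Union_cox_complex)
  have "bij_betw coord weight_lattice UNIV"
    by (rule bij_betwI[where g = wt]) (auto simp: wt_coord simp flip: range_wt)
  with b have "bij_betw (coord \<circ> \<phi>) (\<Union>A) UNIV" by (rule bij_betw_trans)
  moreover have "(\<lambda>s. (coord \<circ> \<phi>) ` s) ` A = (\<lambda>s. coord ` s) ` cox_complex"
    unfolding im[symmetric] by (simp add: image_image image_comp)
  moreover have "\<dots> = tri_complex"
    unfolding cox_complex_eq by (simp add: image_image)
  ultimately show ?thesis by (simp add: zchart_def)
qed

section \<open>Sectors in coordinates\<close>

text \<open>Unit vectors satisfy \<open>a * a + a * b + b * b = 1\<close>. The second vector is the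
  first one rotated by 60 degrees, so the determinant is this norm up to sign.\<close>

lemma hex_pair_det:
  assumes "hex_pair (a, b) (c, d)"
  shows "(a * d - b * c) * (a * d - b * c) = 1"
proof -
  have ab: "(a, b) \<in> hex" and cd: "(c, d) = (- b, a + b) \<or> (c, d) = (a + b, - a)"
    using assms common_neighbours[of a b c d] by (simp_all add: hex_pair_def)
  have "a * (a + b) + b * b = 1"
    using ab unfolding hex_def insert_iff empty_iff by (elim disjE) simp_all
  moreover from cd have "a * d - b * c = a * (a + b) + b * b \<or> a * d - b * c = - (a * (a + b) + b * b)"
    by (elim disjE) (simp_all add: algebra_simps)
  ultimately show ?thesis by auto
qed

text \<open>Cramer's rule; the determinant \<open>D\<close> of a \<open>hex_pair\<close> is 1 or -1,
  so dividing by it is multiplying by it.\<close>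

definition pair_coords :: "int \<times> int \<Rightarrow> int \<times> int \<Rightarrow> int \<times> int \<Rightarrow> int \<times> int" where
  "pair_coords \<mu> \<nu> z = (let D = fst \<mu> * snd \<nu> - snd \<mu> * fst \<nu> in
     (D * (fst z * snd \<nu> - snd z * fst \<nu>), D * (fst \<mu> * snd z - snd \<mu> * fst z)))"

lemma pair_coords_affine_map:
  assumes "hex_pair \<mu> \<nu>"
  shows "pair_coords \<mu> \<nu> (affine_map p \<mu> \<nu> z - p) = z"
proof -
  obtain a b c d where m: "\<mu> = (a, b)" "\<nu> = (c, d)" by fastforce
  have D: "(a * d - b * c) * (a * d - b * c) = 1" using hex_pair_det assms m by simp
  obtain x y where z: "z = (x, y)" by fastforce
  have "pair_coords \<mu> \<nu> (affine_map p \<mu> \<nu> z - p) =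
    ((a * d - b * c) * (a * d - b * c) * x, (a * d - b * c) * (a * d - b * c) * y)"
    by (simp add: pair_coords_def affine_map_def Let_def m z algebra_simps)
  then show ?thesis unfolding D z by simp
qed

lemma affine_map_pair_coords:
  assumes "hex_pair \<mu> \<nu>"
  shows "affine_map p \<mu> \<nu> (pair_coords \<mu> \<nu> (z - p)) = z"
proof -
  obtain a b c d where m: "\<mu> = (a, b)" "\<nu> = (c, d)" by fastforce
  have D: "(a * d - b * c) * (a * d - b * c) = 1" using hex_pair_det assms m by simp
  obtain x y where z: "z - p = (x, y)" by fastforce
  have "affine_map p \<mu> \<nu> (pair_coords \<mu> \<nu> (z - p)) =
    (fst p + (a * d - b * c) * (a * d - b * c) * x, snd p + (a * d - b * c) * (a * d - b * c) * y)"
    by (simp add: pair_coords_def affine_map_def Let_def m z algebra_simps)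
  then show ?thesis unfolding D using arg_cong[OF z, of fst] arg_cong[OF z, of snd] by (simp add: prod_eq_iff)
qed

lemma pair_coords_add: "pair_coords \<mu> \<nu> (y + z) = pair_coords \<mu> \<nu> y + pair_coords \<mu> \<nu> z"
  by (simp add: pair_coords_def Let_def algebra_simps)

lemma pair_coords_hex:
  assumes "hex_pair \<mu> \<nu>" "z \<in> hex"
  shows "pair_coords \<mu> \<nu> z \<in> hex"
proof -
  obtain a b c d where m: "\<mu> = (a, b)" "\<nu> = (c, d)" by fastforce
  have cd: "(c, d) = (- b, a + b) \<or> (c, d) = (a + b, - a)"
    using assms common_neighbours[of a b c d] by (simp add: m hex_pair_def)
  have "(a, b) \<in> hex" using assms by (simp add: m hex_pair_def)
  then show ?thesis
    using assms(2) cd unfolding hex_def insert_iff empty_iff prod.inject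
    by (elim disjE conjE) (simp_all add: pair_coords_def m)
qed

lemma zsector_iff:
  assumes "hex_pair \<mu> \<nu>"
  shows "z \<in> zsector p \<mu> \<nu> \<longleftrightarrow> 1 \<le> fst (pair_coords \<mu> \<nu> (z - p)) \<and> 1 \<le> snd (pair_coords \<mu> \<nu> (z - p))"
proof
  assume "z \<in> zsector p \<mu> \<nu>"
  then show "1 \<le> fst (pair_coords \<mu> \<nu> (z - p)) \<and> 1 \<le> snd (pair_coords \<mu> \<nu> (z - p))"
    unfolding zsector_def by (auto simp: pair_coords_affine_map[OF assms])
next
  assume "1 \<le> fst (pair_coords \<mu> \<nu> (z - p)) \<and> 1 \<le> snd (pair_coords \<mu> \<nu> (z - p))"
  then show "z \<in> zsector p \<mu> \<nu>"
    unfolding zsector_def using affine_map_pair_coords[OF assms, of p z]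
    by (intro image_eqI[of _ _ "pair_coords \<mu> \<nu> (z - p)"]) (auto simp: mem_Times_iff case_prod_beta)
qed

lemma zsector_swap: "zsector p \<nu> \<mu> = zsector p \<mu> \<nu>"
proof -
  have "zsector p \<nu> \<mu> \<subseteq> zsector p \<mu> \<nu>" for \<mu> \<nu>
  proof
    fix z assume "z \<in> zsector p \<nu> \<mu>"
    then obtain i j where "1 \<le> i" "1 \<le> j" "z = affine_map p \<nu> \<mu> (i, j)" by (auto simp: zsector_def)
    then show "z \<in> zsector p \<mu> \<nu>"
      by (auto simp: zsector_def affine_map_def intro!: image_eqI[of _ _ "(j, i)"])
  qed
  then show ?thesis by blast
qed

lemma int_unbounded: "(\<And>i. 1 \<le> i \<Longrightarrow> (1::int) \<le> c + i * d) \<Longrightarrow> 0 \<le> d"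
proof (rule ccontr)
  assume *: "\<And>i. 1 \<le> i \<Longrightarrow> (1::int) \<le> c + i * d" and "\<not> 0 \<le> d"
  have "(\<bar>c\<bar> + 1) * d \<le> (\<bar>c\<bar> + 1) * (- 1)"
    using \<open>\<not> 0 \<le> d\<close> by (intro mult_left_mono) auto
  with *[of "\<bar>c\<bar> + 1"] show False by simp
qed

text \<open>Going to infinity inside the smaller sector shows that \<open>\<mu>\<close> and
  \<open>\<nu>\<close> have nonnegative coordinates with respect to \<open>\<mu>'\<close> and
  \<open>\<nu>'\<close>; the only unit vectors with this property are \<open>\<mu>'\<close> and
  \<open>\<nu>'\<close> themselves. Directions do not depend on base points, hence the arbitrary
  \<open>r\<close>.\<close>

lemma zsector_subset_direction:
  assumes "hex_pair \<mu> \<nu>" "hex_pair \<mu>' \<nu>'" "zsector p \<mu> \<nu> \<subseteq> zsector p' \<mu>' \<nu>'"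
  shows "zsector r \<mu> \<nu> = zsector r \<mu>' \<nu>'"
proof -
  let ?c = "pair_coords \<mu>' \<nu>'"
  have eq: "affine_map p \<mu> \<nu> (i, j) - p' = (p - p') + affine_map 0 \<mu> \<nu> (i, j)" for i j
    by (simp add: affine_map_def prod_eq_iff)
  have lin: "?c (affine_map 0 \<mu> \<nu> (i, j)) = affine_map 0 (?c \<mu>) (?c \<nu>) (i, j)" for i j
    by (simp add: affine_map_def pair_coords_def Let_def algebra_simps)
  have ge: "1 \<le> fst (?c (p - p')) + (i * fst (?c \<mu>) + j * fst (?c \<nu>)) \<and>
      1 \<le> snd (?c (p - p')) + (i * snd (?c \<mu>) + j * snd (?c \<nu>))" if "1 \<le> i" "1 \<le> j" for i j
  proof -
    have "affine_map p \<mu> \<nu> (i, j) \<in> zsector p' \<mu>' \<nu>'"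
      using that assms(3) by (auto simp: zsector_def)
    then show ?thesis
      unfolding zsector_iff[OF assms(2)] eq pair_coords_add lin by (simp add: affine_map_def)
  qed
  have nonneg: "0 \<le> fst (?c \<mu>)" "0 \<le> snd (?c \<mu>)" "0 \<le> fst (?c \<nu>)" "0 \<le> snd (?c \<nu>)"
  proof -
    have "1 \<le> (fst (?c (p - p')) + fst (?c \<nu>)) + i * fst (?c \<mu>)" if "1 \<le> i" for i
      using ge[OF that, of 1] by linarith
    then show "0 \<le> fst (?c \<mu>)" by (rule int_unbounded)
    have "1 \<le> (snd (?c (p - p')) + snd (?c \<nu>)) + i * snd (?c \<mu>)" if "1 \<le> i" for i
      using ge[OF that, of 1] by linarith
    then show "0 \<le> snd (?c \<mu>)" by (rule int_unbounded)
    have "1 \<le> (fst (?c (p - p')) + fst (?c \<mu>)) + j * fst (?c \<nu>)" if "1 \<le> j" for j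
      using ge[OF _ that, of 1] by linarith
    then show "0 \<le> fst (?c \<nu>)" by (rule int_unbounded)
    have "1 \<le> (snd (?c (p - p')) + snd (?c \<mu>)) + j * snd (?c \<nu>)" if "1 \<le> j" for j
      using ge[OF _ that, of 1] by linarith
    then show "0 \<le> snd (?c \<nu>)" by (rule int_unbounded)
  qed
  have h: "?c \<mu> \<in> hex" "?c \<nu> \<in> hex"
    using assms(1) pair_coords_hex[OF assms(2)] by (auto simp: hex_pair_def)
  have inj: "y = y'" if "?c y = ?c y'" for y y'
  proof -
    have "affine_map 0 \<mu>' \<nu>' (?c x) = x" for x
      using affine_map_pair_coords[OF assms(2), of 0 x] by simp
    with that show ?thesis by metis
  qed
  have unit_coords: "?c \<mu>' = (1, 0)" "?c \<nu>' = (0, 1)"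
    using pair_coords_affine_map[OF assms(2), of 0 "(1, 0)"] pair_coords_affine_map[OF assms(2), of 0 "(0, 1)"]
    by (simp_all add: affine_map_def)
  have *: "y = \<mu>' \<or> y = \<nu>'" if "?c y \<in> hex" "0 \<le> fst (?c y)" "0 \<le> snd (?c y)" for y
  proof -
    have "?c y = (1, 0) \<or> ?c y = (0, 1)"
      using that unfolding hex_def insert_iff empty_iff by (elim disjE) simp_all
    then show ?thesis using inj[of y \<mu>'] inj[of y \<nu>'] unit_coords by argo
  qed
  have "0 \<notin> hex" by (simp add: hex_def zero_prod_def)
  then have "\<mu> \<noteq> \<nu>" using assms(1) by (auto simp: hex_pair_def)
  with *[OF h(1)] *[OF h(2)] nonneg have "\<mu> = \<mu>' \<and> \<nu> = \<nu>' \<or> \<mu> = \<nu>' \<and> \<nu> = \<mu>'" by blast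
  then show ?thesis using zsector_swap by blast
qed

lemma hex_uminus: "(a, b) \<in> hex \<Longrightarrow> (- a, - b) \<in> hex"
  unfolding hex_def insert_iff empty_iff by (elim disjE) simp_all

lemma hex_pair_image:
  assumes "hex_pair \<alpha> \<beta>" "d \<in> hex"
  shows "affine_map 0 \<alpha> \<beta> d \<in> hex"
proof -
  obtain a b c e where m: "\<alpha> = (a, b)" "\<beta> = (c, e)" by fastforce
  have "(a, b) \<in> hex" "(c, e) \<in> hex" "(c - a, e - b) \<in> hex"
    using assms(1) by (simp_all add: hex_pair_def m)
  moreover from this have "(- a, - b) \<in> hex" "(- c, - e) \<in> hex" "(a - c, b - e) \<in> hex"
    using hex_uminus[of a b] hex_uminus[of c e] hex_uminus[of "c - a" "e - b"] by simp_all
  ultimately show ?thesis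
    using assms(2) unfolding m hex_def[THEN arg_cong[of _ _ "\<lambda>S. d \<in> S"]] insert_iff empty_iff
    by (elim disjE) (simp_all add: affine_map_def)
qed

lemma affine_map_comp:
  "affine_map q \<alpha> \<beta> (affine_map p \<mu> \<nu> z) =
     affine_map (affine_map q \<alpha> \<beta> p) (affine_map 0 \<alpha> \<beta> \<mu>) (affine_map 0 \<alpha> \<beta> \<nu>) z"
  by (simp add: affine_map_def algebra_simps)

lemma affine_map_zsector:
  "affine_map q \<alpha> \<beta> ` zsector p \<mu> \<nu> =
     zsector (affine_map q \<alpha> \<beta> p) (affine_map 0 \<alpha> \<beta> \<mu>) (affine_map 0 \<alpha> \<beta> \<nu>)"
  unfolding zsector_def image_image affine_map_comp ..

lemma hex_pair_comp:
  assumes "hex_pair \<alpha> \<beta>" "hex_pair \<mu> \<nu>"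
  shows "hex_pair (affine_map 0 \<alpha> \<beta> \<mu>) (affine_map 0 \<alpha> \<beta> \<nu>)"
proof -
  have "affine_map 0 \<alpha> \<beta> \<nu> - affine_map 0 \<alpha> \<beta> \<mu> = affine_map 0 \<alpha> \<beta> (\<nu> - \<mu>)"
    by (simp add: affine_map_def prod_eq_iff algebra_simps)
  then show ?thesis using assms hex_pair_image by (auto simp: hex_pair_def)
qed

lemma zsector_deeper:
  assumes "hex_pair \<mu> \<nu>"
  obtains k where "0 \<le> k" "zsector (affine_map p \<mu> \<nu> (k, k)) \<mu> \<nu> \<subseteq> zsector p' \<mu> \<nu>"
proof -
  let ?c = "pair_coords \<mu> \<nu>"
  \<comment> \<open>Large enough to outweigh the offset between the two base points in both
    coordinates.\<close>
  define k where "k = \<bar>fst (?c (p - p'))\<bar> + \<bar>snd (?c (p - p'))\<bar>"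
  have "zsector (affine_map p \<mu> \<nu> (k, k)) \<mu> \<nu> \<subseteq> zsector p' \<mu> \<nu>"
  proof
    fix z assume z: "z \<in> zsector (affine_map p \<mu> \<nu> (k, k)) \<mu> \<nu>"
    have "?c (z - p') = ?c (z - affine_map p \<mu> \<nu> (k, k)) + ?c (affine_map p \<mu> \<nu> (k, k) - p) + ?c (p - p')"
      unfolding pair_coords_add[symmetric] by simp
    also have "?c (affine_map p \<mu> \<nu> (k, k) - p) = (k, k)" by (rule pair_coords_affine_map[OF assms])
    finally have "fst (?c (z - p')) = fst (?c (z - affine_map p \<mu> \<nu> (k, k))) + k + fst (?c (p - p'))"
      "snd (?c (z - p')) = snd (?c (z - affine_map p \<mu> \<nu> (k, k))) + k + snd (?c (p - p'))"
      by simp_all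
    moreover have "0 \<le> k + fst (?c (p - p'))" "0 \<le> k + snd (?c (p - p'))" by (simp_all add: k_def)
    ultimately show "z \<in> zsector p' \<mu> \<nu>"
      using z unfolding zsector_iff[OF assms] by linarith
  qed
  then show thesis using that[of k] by (simp add: k_def)
qed

lemma zsector_mono:
  assumes "hex_pair \<mu> \<nu>" "0 \<le> k"
  shows "zsector (affine_map p \<mu> \<nu> (k, k)) \<mu> \<nu> \<subseteq> zsector p \<mu> \<nu>"
proof
  let ?c = "pair_coords \<mu> \<nu>"
  fix z assume z: "z \<in> zsector (affine_map p \<mu> \<nu> (k, k)) \<mu> \<nu>"
  have "?c (z - p) = ?c (z - affine_map p \<mu> \<nu> (k, k)) + ?c (affine_map p \<mu> \<nu> (k, k) - p)"
    unfolding pair_coords_add[symmetric] by simp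
  also have "?c (affine_map p \<mu> \<nu> (k, k) - p) = (k, k)" by (rule pair_coords_affine_map[OF assms(1)])
  finally have "fst (?c (z - p)) = fst (?c (z - affine_map p \<mu> \<nu> (k, k))) + k"
    "snd (?c (z - p)) = snd (?c (z - affine_map p \<mu> \<nu> (k, k))) + k"
    by simp_all
  then show "z \<in> zsector p \<mu> \<nu>"
    using z \<open>0 \<le> k\<close> unfolding zsector_iff[OF assms(1)] by linarith
qed

section \<open>The finite Weyl group in lattice coordinates\<close>

definition weyl_dir :: "(real^3 \<Rightarrow> real^3) \<Rightarrow> int \<times> int \<Rightarrow> int \<times> int \<Rightarrow> bool" where
  "weyl_dir w \<mu> \<nu> \<longleftrightarrow> linear w \<and> hex_pair \<mu> \<nu> \<and> w lambda1 = wt \<mu> \<and> w lambda2 = wt \<nu>"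

lemma wall_reflection_linear: "linear (wall_reflection a 0)"
  unfolding wall_reflection_def
  by (intro linearI) (simp_all add: inner_add_left algebra_simps add_divide_distrib)

lemma wall_reflection_wt:
  "wall_reflection alpha1 0 (wt z) = wt (- fst z, fst z + snd z)"
  "wall_reflection alpha2 0 (wt z) = wt (fst z + snd z, - snd z)"
proof -
  have a: "alpha1 \<bullet> alpha1 = 2" "alpha2 \<bullet> alpha2 = 2"
    by (simp_all only: inner_alpha) (simp_all add: alpha1_def alpha2_def axis_def)
  show "wall_reflection alpha1 0 (wt z) = wt (- fst z, fst z + snd z)"
    "wall_reflection alpha2 0 (wt z) = wt (fst z + snd z, - snd z)"
    by (simp_all add: wall_reflection_def a wt_def)
      (simp_all add: weight_def lambda1_def lambda2_def alpha1_def alpha2_def vec_eq_iff forall_3 axis_def field_simps)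
qed

lemma finite_weyl_dir: "w \<in> finite_weyl_group \<Longrightarrow> \<exists>\<mu> \<nu>. weyl_dir w \<mu> \<nu>"
  unfolding finite_weyl_group_def
proof (induction rule: reflection_group.induct)
  case id
  have "lambda1 = wt (1, 0)" "lambda2 = wt (0, 1)" by (simp_all add: wt_def weight_def)
  then have "weyl_dir id (1, 0) (0, 1)"
    by (auto simp: weyl_dir_def hex_pair_def hex_def linear_id)
  then show ?case by blast
next
  case (step r w)
  then obtain \<mu> \<nu> where w: "weyl_dir w \<mu> \<nu>" by blast
  obtain a b c d where m: "\<mu> = (a, b)" "\<nu> = (c, d)" by fastforce
  have hp: "hex_pair (- a, a + b) (- c, c + d)" "hex_pair (a + b, - b) (c + d, - d)"
  proof -
    have s: "(- i, i + j) \<in> hex" "(i + j, - j) \<in> hex" if "(i, j) \<in> hex" for i j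
      using that by (auto simp: hex_def)
    have "(a, b) \<in> hex" "(c, d) \<in> hex" "(c - a, d - b) \<in> hex"
      using w by (auto simp: weyl_dir_def hex_pair_def m)
    then show "hex_pair (- a, a + b) (- c, c + d)" "hex_pair (a + b, - b) (c + d, - d)"
      using s[of a b] s[of c d] s[of "c - a" "d - b"] by (simp_all add: hex_pair_def algebra_simps)
  qed
  have lin: "linear (r \<circ> w)"
    using step.hyps w by (auto simp: weyl_dir_def intro!: linear_compose wall_reflection_linear)
  consider "r = wall_reflection alpha1 0" | "r = wall_reflection alpha2 0" using step.hyps by blast
  then show ?case
  proof cases
    case 1
    then have "weyl_dir (r \<circ> w) (- a, a + b) (- c, c + d)"
      using w lin hp by (simp add: weyl_dir_def wall_reflection_wt m)
    then show ?thesis by blast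
  next
    case 2
    then have "weyl_dir (r \<circ> w) (a + b, - b) (c + d, - d)"
      using w lin hp by (simp add: weyl_dir_def wall_reflection_wt m)
    then show ?thesis by blast
  qed
qed

lemma wt_affine_map: "wt (affine_map p \<mu> \<nu> z) = wt p + of_int (fst z) *\<^sub>R wt \<mu> + of_int (snd z) *\<^sub>R wt \<nu>"
  by (simp add: wt_def weight_def affine_map_def algebra_simps)

lemma base_sector_eq: "base_sector = {r *\<^sub>R lambda1 + s *\<^sub>R lambda2 | r s. 0 < r \<and> 0 < s}"
proof -
  have "x = (x \<bullet> alpha1) *\<^sub>R lambda1 + (x \<bullet> alpha2) *\<^sub>R lambda2" if "x \<in> base_sector" for x
    using that dual_basis_expansion by (auto simp: base_sector_def)
  moreover have "r *\<^sub>R lambda1 + s *\<^sub>R lambda2 \<in> base_sector" if "0 < r" "0 < s" for r s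
    using that plane_combination[OF dual_basis(1,2)] by (simp add: base_sector_def inner_add_left dual_basis)
  ultimately show ?thesis by (force simp: base_sector_def)
qed

lemma weyl_sector_iff:
  assumes "weyl_dir w \<mu> \<nu>"
  shows "wt p + i *\<^sub>R wt \<mu> + j *\<^sub>R wt \<nu> \<in> cox_sector (wt p) w \<longleftrightarrow> 0 < i \<and> 0 < j"
proof -
  obtain a b c d where m: "\<mu> = (a, b)" "\<nu> = (c, d)" by fastforce
  have D: "(a * d - b * c) * (a * d - b * c) = 1"
    using hex_pair_det assms m by (simp add: weyl_dir_def)
  have Dr: "of_int (a * d - b * c) * of_int (a * d - b * c) = (1::real)"
    using D by (metis of_int_1 of_int_mult)
  have w: "w (r *\<^sub>R lambda1 + s *\<^sub>R lambda2) = r *\<^sub>R wt \<mu> + s *\<^sub>R wt \<nu>" for r s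
    using assms by (simp add: weyl_dir_def linear_add linear_scale)
  have inj: "i = r \<and> j = s" if "i *\<^sub>R wt \<mu> + j *\<^sub>R wt \<nu> = r *\<^sub>R wt \<mu> + s *\<^sub>R wt \<nu>" for r s
  proof -
    have 1: "(i - r) * of_int a + (j - s) * of_int c = 0" "(i - r) * of_int b + (j - s) * of_int d = 0"
      using arg_cong[OF that, of "\<lambda>x. x \<bullet> alpha1"] arg_cong[OF that, of "\<lambda>x. x \<bullet> alpha2"]
      by (simp_all add: wt_def m inner_add_left algebra_simps)
    have "(i - r) * of_int (a * d - b * c) = 0" "(j - s) * of_int (a * d - b * c) = 0"
      using 1 by (simp_all, algebra+)
    then show ?thesis using Dr by auto
  qed
  show ?thesis
  proof
    assume "wt p + i *\<^sub>R wt \<mu> + j *\<^sub>R wt \<nu> \<in> cox_sector (wt p) w"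
    then obtain r s where "0 < r" "0 < s" and eq: "i *\<^sub>R wt \<mu> + j *\<^sub>R wt \<nu> = w (r *\<^sub>R lambda1 + s *\<^sub>R lambda2)"
      unfolding cox_sector_def base_sector_eq by (auto simp: add.assoc)
    then show "0 < i \<and> 0 < j" using inj[of r s] by (simp add: w)
  next
    assume "0 < i \<and> 0 < j"
    then have "i *\<^sub>R lambda1 + j *\<^sub>R lambda2 \<in> base_sector" unfolding base_sector_eq by blast
    then show "wt p + i *\<^sub>R wt \<mu> + j *\<^sub>R wt \<nu> \<in> cox_sector (wt p) w"
      unfolding cox_sector_def by (rule rev_image_eqI) (simp add: w add.assoc)
  qed
qed

lemma weyl_sector_wt:
  assumes "weyl_dir w \<mu> \<nu>"
  shows "wt z \<in> cox_sector (wt p) w \<longleftrightarrow> z \<in> zsector p \<mu> \<nu>"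
proof -
  have hp: "hex_pair \<mu> \<nu>" using assms by (simp add: weyl_dir_def)
  obtain i j where ij: "pair_coords \<mu> \<nu> (z - p) = (i, j)" by fastforce
  then have "z = affine_map p \<mu> \<nu> (i, j)" using affine_map_pair_coords[OF hp, of p z] by simp
  then have "wt z = wt p + of_int i *\<^sub>R wt \<mu> + of_int j *\<^sub>R wt \<nu>" by (simp add: wt_affine_map)
  then have "wt z \<in> cox_sector (wt p) w \<longleftrightarrow> 0 < i \<and> 0 < j"
    using weyl_sector_iff[OF assms, of p "of_int i" "of_int j"] by simp
  then show ?thesis unfolding zsector_iff[OF hp] ij by auto
qed

lemma convex_cox_sector:
  assumes "weyl_dir w \<mu> \<nu>"
  shows "convex (cox_sector l w)"
proof -
  have eq: "base_sector = plane_a \<inter> {x. alpha1 \<bullet> x > 0} \<inter> {x. alpha2 \<bullet> x > 0}"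
    by (auto simp: base_sector_def inner_commute)
  have "convex base_sector"
    unfolding eq by (intro convex_Int convex_plane convex_halfspace_gt)
  then have "convex (w ` base_sector)"
    using assms by (intro convex_linear_image) (simp_all add: weyl_dir_def)
  then have "convex ((\<lambda>y. l + y) ` w ` base_sector)" by (rule convex_translation)
  then show ?thesis by (simp add: cox_sector_def image_image)
qed

lemma complexI: "T \<in> triangles \<Longrightarrow> s \<subseteq> T \<Longrightarrow> s \<noteq> {} \<Longrightarrow> s \<in> tri_complex"
  by (auto simp: tri_complex_def)

text \<open>Any two different apexes over the edge \<open>{u, v}\<close> add up to
  \<open>u + v\<close>, so three different ones cannot coexist.\<close>

lemma edge_two_triangles:
  assumes "T \<in> triangles" "T' \<in> triangles" "T'' \<in> triangles" "u \<noteq> v"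
    and "{u, v} \<subseteq> T" "{u, v} \<subseteq> T'" "{u, v} \<subseteq> T''" "T \<noteq> T'"
  shows "T'' = T \<or> T'' = T'"
proof -
  have ex: "\<exists>w. T = {u, v, w} \<and> w - u \<in> hex \<and> w - v \<in> hex" if "T \<in> triangles" "{u, v} \<subseteq> T" for T
  proof -
    have "card (T - {u, v}) = 1"
      using that assms(4) card_triangle[OF that(1)] by (simp add: card_Diff_subset)
    then obtain w where w: "T - {u, v} = {w}" by (auto simp: card_1_singleton_iff)
    have "T = {u, v} \<union> (T - {u, v})" using that(2) by blast
    then have T: "T = {u, v, w}" unfolding w by auto
    have "w \<in> T - {u, v}" unfolding w by simp
    then have wuv: "w \<noteq> u" "w \<noteq> v" by auto
    then have "{u, w} \<in> tri_complex" "{v, w} \<in> tri_complex"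
      using T by (auto intro!: complexI[OF that(1)])
    then have "w - u \<in> hex" "w - v \<in> hex" using wuv edge_iff[of u w] edge_iff[of v w] by simp_all
    with T show ?thesis by blast
  qed
  obtain w where w: "T = {u, v, w}" "w - u \<in> hex" "w - v \<in> hex" using ex[OF assms(1,5)] by blast
  obtain w' where w': "T' = {u, v, w'}" "w' - u \<in> hex" "w' - v \<in> hex" using ex[OF assms(2,6)] by blast
  obtain w'' where w'': "T'' = {u, v, w''}" "w'' - u \<in> hex" "w'' - v \<in> hex" using ex[OF assms(3,7)] by blast
  have "{u, v} \<in> tri_complex" by (rule complexI[OF assms(1,5)]) simp
  then have uv: "v - u \<in> hex" using assms(4) edge_iff[of u v] by simp
  show ?thesis
  proof (rule ccontr)
    assume *: "\<not> ?thesis"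
    have "w \<noteq> w'" using assms(8) w(1) w'(1) by auto
    moreover have "w \<noteq> w''" "w' \<noteq> w''" using * w(1) w'(1) w''(1) by auto
    ultimately have "w + w' = u + v" "w + w'' = u + v"
      using opposite_vertices[OF uv w(2,3) w'(2,3)] opposite_vertices[OF uv w(2,3) w''(2,3)] by blast+
    then have "w + w' = w + w''" by simp
    then show False using \<open>w' \<noteq> w''\<close> by simp
  qed
qed

section \<open>Apartments in coordinates\<close>

context
  fixes A :: "'v set set" and z :: "'v \<Rightarrow> int \<times> int"
  assumes z: "zchart A z"
begin

lemma zchart_bij: "bij_betw z (\<Union>A) UNIV"
  and zchart_inj: "inj_on z (\<Union>A)"
  using z by (auto simp: zchart_def bij_betw_def)

lemma zchart_simplex: "s \<in> A \<Longrightarrow> z ` s \<in> tri_complex"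
  using z by (auto simp: zchart_def)

lemma zchart_mem: "s \<subseteq> \<Union>A \<Longrightarrow> s \<in> A \<longleftrightarrow> z ` s \<in> tri_complex"
proof
  assume s: "s \<subseteq> \<Union>A" "z ` s \<in> tri_complex"
  then have "z ` s \<in> (\<lambda>r. z ` r) ` A" using z by (simp add: zchart_def)
  then obtain r where "r \<in> A" "z ` s = z ` r" by blast
  then show "s \<in> A" using s zchart_inj inj_on_image_eq_iff[of z "\<Union>A" s r] by auto
qed (rule zchart_simplex)

lemma zchart_inv_mem: "inv_into (\<Union>A) z y \<in> \<Union>A"
  and zchart_inv: "z (inv_into (\<Union>A) z y) = y"
  using inv_into_into[of y z "\<Union>A"] f_inv_into_f[of y z "\<Union>A"] zchart_bij
  by (simp_all add: bij_betw_def)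

lemma zchart_inv_left: "v \<in> \<Union>A \<Longrightarrow> inv_into (\<Union>A) z (z v) = v"
  using zchart_inj by simp

lemma zchart_inv_simplex:
  assumes "T \<in> tri_complex"
  shows "inv_into (\<Union>A) z ` T \<in> A"
proof -
  have "inv_into (\<Union>A) z ` T \<subseteq> \<Union>A" using zchart_inv_mem by blast
  then show ?thesis using assms zchart_inv by (simp add: zchart_mem image_image)
qed

lemma zchart_card: "s \<in> A \<Longrightarrow> card (z ` s) = card s"
  using zchart_inj by (intro card_image) (auto intro: inj_on_subset)

lemma zchart_finite:
  assumes "s \<in> A"
  shows "finite s \<and> card s \<le> 3"
proof -
  have "inj_on z s" using zchart_inj assms by (auto intro: inj_on_subset)
  moreover have "finite (z ` s)" "card (z ` s) \<le> 3"
    using simplex_card_le[OF zchart_simplex[OF assms]] by auto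
  ultimately show ?thesis using finite_imageD[of z s] zchart_card[OF assms] by simp
qed

lemma zchart_chamber: "s \<in> A \<Longrightarrow> card s = 3 \<Longrightarrow> z ` s \<in> triangles"
  using zchart_simplex[of s] zchart_card[of s] triangle_iff[of "z ` s"] by simp

lemma zchart_inv_card: "card (inv_into (\<Union>A) z ` T) = card T"
  by (intro card_image inj_on_inverseI[where g = z]) (simp add: zchart_inv)

lemma zchart_edge:
  assumes "s \<in> A" "u \<in> s" "v \<in> s" "u \<noteq> v"
  shows "z v - z u \<in> hex"
proof -
  obtain T where "T \<in> triangles" "z ` s \<subseteq> T"
    using zchart_simplex[OF assms(1)] by (auto simp: tri_complex_def)
  then have "{z u, z v} \<in> tri_complex" using assms(2,3) by (intro complexI[of T]) auto
  moreover have "z u \<noteq> z v" using assms inj_onD[OF zchart_inj, of u v] by blast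
  ultimately show ?thesis using edge_iff[of "z u" "z v"] by simp
qed

lemma zchart_change_auto:
  assumes z': "zchart A z'"
  shows "tri_auto (z' \<circ> inv_into (\<Union>A) z)"
proof -
  have "inj (z' \<circ> inv_into (\<Union>A) z)"
  proof (rule injI)
    fix x y assume "(z' \<circ> inv_into (\<Union>A) z) x = (z' \<circ> inv_into (\<Union>A) z) y"
    then have "inv_into (\<Union>A) z x = inv_into (\<Union>A) z y"
      using inj_onD[OF _ _ zchart_inv_mem zchart_inv_mem, of z' x y] z'
      by (simp add: zchart_def bij_betw_def)
    then show "x = y" using zchart_inv by metis
  qed
  moreover have "z' ` inv_into (\<Union>A) z ` s \<in> tri_complex" if "s \<in> tri_complex" for s
    using zchart_inv_simplex[OF that] z' by (auto simp: zchart_def)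
  ultimately show ?thesis by (auto simp: tri_auto_def image_comp)
qed

lemma zchart_affine:
  assumes z': "zchart A z'"
  obtains q \<alpha> \<beta> where "hex_pair \<alpha> \<beta>" "\<And>v. v \<in> \<Union>A \<Longrightarrow> z' v = affine_map q \<alpha> \<beta> (z v)"
proof -
  obtain q \<alpha> \<beta> where *: "hex_pair \<alpha> \<beta>" "\<And>y. (z' \<circ> inv_into (\<Union>A) z) y = affine_map q \<alpha> \<beta> y"
    using tri_auto_affine[OF zchart_change_auto[OF z']] by metis
  then have "z' v = affine_map q \<alpha> \<beta> (z v)" if "v \<in> \<Union>A" for v
    using zchart_inv_left[OF that] *(2)[of "z v"] by simp
  with * that show thesis by blast
qed

text \<open>The change of charts is an automorphism of the lattice that fixes a triangle pointwise,
  hence the identity.\<close>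

lemma zchart_unique:
  assumes z': "zchart A z'" and "C \<in> A" "card C = 3" "\<And>v. v \<in> C \<Longrightarrow> z v = z' v" "v \<in> \<Union>A"
  shows "z v = z' v"
proof -
  have id: "tri_auto id" by (simp add: tri_auto_def)
  have "id (z v) = (z' \<circ> inv_into (\<Union>A) z) (z v)"
  proof (rule tri_auto_unique[OF id zchart_change_auto[OF z'] zchart_chamber[OF assms(2,3)]])
    fix y assume "y \<in> z ` C"
    then obtain u where "u \<in> C" "y = z u" by blast
    moreover then have "u \<in> \<Union>A" using assms(2) by blast
    ultimately show "id y = (z' \<circ> inv_into (\<Union>A) z) y"
      using assms(4)[of u] zchart_inv_left[of u] by simp
  qed
  then show ?thesis using zchart_inv_left[OF assms(5)] by simp
qed

end

context triangle_building
begin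

lemma apartment_zchart: "A \<in> Apts \<Longrightarrow> \<exists>z. zchart A z"
  using apartment_chart chart_zchart by blast

lemma simplex_card: "s \<in> X \<Longrightarrow> finite s \<and> card s \<le> 3"
  using common_apartment[of s s] apartment_zchart zchart_finite by metis

lemma chamberI:
  assumes "C \<in> X" "card C = 3"
  shows "C \<in> chambers X"
proof -
  have "D = C" if "D \<in> X" "C \<subseteq> D" for D
  proof -
    have "finite D" "card D \<le> card C" using simplex_card[OF that(1)] assms(2) by auto
    then show "D = C" using card_seteq[OF _ that(2)] by auto
  qed
  then show ?thesis using assms(1) by (auto simp: chambers_def)
qed

lemma apartment_has_chamber: "A \<in> Apts \<Longrightarrow> \<exists>C\<in>A. card C = 3"
  using apartment_zchart zchart_inv_simplex zchart_inv_card
  by (metis card_triangle triangle_in_complex up_triangle)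

text \<open>The isomorphism given by the building axiom pulls the chart of \<open>B\<close> back to
  \<open>A\<close> and fixes the common vertices, so a single system of coordinates serves both
  apartments.\<close>

lemma apartment_coords:
  assumes "A \<in> Apts" "B \<in> Apts" "C \<in> A" "C \<in> B" "card C = 3" "zchart B z"
  obtains z' where "zchart A z'" "\<And>v. v \<in> \<Union>A \<Longrightarrow> v \<in> \<Union>B \<Longrightarrow> z' v = z v"
proof -
  have "C \<in> X" using apartment_subcomplex[OF assms(1)] assms(3) by blast
  from chamberI[OF this assms(5)]
  obtain \<sigma> where \<sigma>: "type_iso t t A B \<sigma>" "\<And>v. v \<in> \<Union>A \<inter> \<Union>B \<Longrightarrow> \<sigma> v = v"
    using apartment_iso[OF assms(1,2) _ assms(3,4)] by blast
  have "zchart A (z \<circ> \<sigma>)"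
  proof -
    have "bij_betw (z \<circ> \<sigma>) (\<Union>A) UNIV"
      using \<sigma>(1) assms(6) bij_betw_trans[of \<sigma> "\<Union>A" "\<Union>B" z UNIV]
      unfolding type_iso_def zchart_def by simp
    moreover have "(\<lambda>s. (z \<circ> \<sigma>) ` s) ` A = (\<lambda>s. z ` s) ` (\<lambda>s. \<sigma> ` s) ` A"
      by (simp add: image_image image_comp)
    ultimately show ?thesis using \<sigma>(1) assms(6) unfolding type_iso_def zchart_def by simp
  qed
  with \<sigma>(2) that show thesis by simp
qed

text \<open>Some apartment contains \<open>s\<close> and a chamber of \<open>B\<close>. Its
  coordinates can be matched with those of \<open>B\<close>, and in them the vertices of
  \<open>s\<close> span a simplex. Hence vertices alone decide whether a simplex belongs to an
  apartment.\<close>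

lemma apartment_full:
  assumes "s \<in> X" "B \<in> Apts" "s \<subseteq> \<Union>B"
  shows "s \<in> B"
proof -
  obtain C where C: "C \<in> B" "card C = 3" using apartment_has_chamber assms by blast
  then have "C \<in> X" using apartment_subcomplex assms by blast
  then obtain A where A: "A \<in> Apts" "C \<in> A" "s \<in> A" using common_apartment assms by blast
  obtain z where z: "zchart B z" using apartment_zchart assms by blast
  obtain z' where z': "zchart A z'" "\<And>v. v \<in> \<Union>A \<Longrightarrow> v \<in> \<Union>B \<Longrightarrow> z' v = z v"
    using apartment_coords[OF A(1) assms(2) A(2) C(1,2) z] by metis
  have "z ` s = z' ` s"
  proof (rule image_cong)
    fix v assume "v \<in> s"
    then have "v \<in> \<Union>A" "v \<in> \<Union>B" using A(3) assms(3) by blast+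
    then show "z v = z' v" using z'(2) by simp
  qed simp
  then have "z ` s \<in> tri_complex" using zchart_simplex[OF z'(1) A(3)] by simp
  then show ?thesis using zchart_mem[OF z assms(3)] by simp
qed

text \<open>Here \<open>r\<close> is the retraction onto \<open>B\<close> centred at \<open>C\<close>, followed by the chart \<open>z\<close> of \<open>B\<close>.\<close>

lemma retraction_exists:
  assumes B: "B \<in> Apts" "zchart B z" and C: "C \<in> B" "card C = 3"
  obtains r where "\<And>A. A \<in> Apts \<Longrightarrow> C \<in> A \<Longrightarrow> zchart A r" "\<And>v. v \<in> \<Union>B \<Longrightarrow> r v = z v"
proof -
  have CX: "C \<in> X" using apartment_subcomplex B C by blast
  define ap where "ap v = (SOME A. A \<in> Apts \<and> C \<in> A \<and> v \<in> \<Union>A)" for v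
  define ch where "ch A = (SOME z'. zchart A z' \<and> (\<forall>v\<in>\<Union>A \<inter> \<Union>B. z' v = z v))" for A
  have ap: "ap v \<in> Apts \<and> C \<in> ap v \<and> v \<in> \<Union>(ap v)" if "v \<in> \<Union>X" for v
  proof -
    obtain s where s: "s \<in> X" "v \<in> s" using \<open>v \<in> \<Union>X\<close> by blast
    then obtain A where "A \<in> Apts" "C \<in> A" "s \<in> A" using common_apartment[OF CX s(1)] by blast
    then have "\<exists>A. A \<in> Apts \<and> C \<in> A \<and> v \<in> \<Union>A" using s by blast
    then show ?thesis unfolding ap_def by (rule someI_ex)
  qed
  have ch: "zchart A (ch A) \<and> (\<forall>v\<in>\<Union>A \<inter> \<Union>B. ch A v = z v)" if AC: "A \<in> Apts" "C \<in> A" for A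
  proof -
    obtain z' where "zchart A z'" "\<And>v. v \<in> \<Union>A \<Longrightarrow> v \<in> \<Union>B \<Longrightarrow> z' v = z v"
      using apartment_coords[OF AC(1) B(1) AC(2) C B(2)] by metis
    then have "\<exists>z'. zchart A z' \<and> (\<forall>v\<in>\<Union>A \<inter> \<Union>B. z' v = z v)" by blast
    then show ?thesis unfolding ch_def by (rule someI_ex)
  qed
  define r where "r v = ch (ap v) v" for v
  \<comment> \<open>The value at \<open>v\<close> does not depend on the apartment chosen for
    \<open>v\<close>: the two candidate charts on \<open>ap v\<close> agree on \<open>C\<close>,
    hence everywhere.\<close>
  have r: "r v = ch A v" if A: "A \<in> Apts" "C \<in> A" and v: "v \<in> \<Union>A" for A v
  proof -
    have "v \<in> \<Union>X" using apartment_subcomplex A v by blast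
    note a = ap[OF this]
    obtain z' where z': "zchart (ap v) z'" "\<And>u. u \<in> \<Union>(ap v) \<Longrightarrow> u \<in> \<Union>A \<Longrightarrow> z' u = ch A u"
      using apartment_coords[of "ap v" A C "ch A"] a A C ch[OF A] by metis
    have "ch (ap v) v = z' v"
    proof (rule zchart_unique[where z = "ch (ap v)" and v = v and C = C, OF _ z'(1)])
      show "zchart (ap v) (ch (ap v))" "C \<in> ap v" "card C = 3" "v \<in> \<Union>(ap v)" using ch a C by auto
      show "ch (ap v) u = z' u" if "u \<in> C" for u
      proof -
        have "u \<in> \<Union>(ap v)" "u \<in> \<Union>A" "u \<in> \<Union>B" using that a A C by blast+
        then show ?thesis using ch[of "ap v"] ch[OF A] z'(2)[of u] a by simp
      qed
    qed
    then show ?thesis using z'(2)[of v] a v by (simp add: r_def)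
  qed
  have "zchart A r" if A: "A \<in> Apts" "C \<in> A" for A
  proof -
    have "bij_betw r (\<Union>A) UNIV \<longleftrightarrow> bij_betw (ch A) (\<Union>A) UNIV"
      by (rule bij_betw_cong) (rule r[OF A])
    moreover have "(\<lambda>s. r ` s) ` A = (\<lambda>s. ch A ` s) ` A"
      by (intro image_cong refl) (use r[OF A] in blast)
    ultimately show ?thesis using ch[OF A] by (simp add: zchart_def)
  qed
  moreover have "r v = z v" if "v \<in> \<Union>B" for v
    using r[OF B(1) C(1) that] ch[OF B(1) C(1)] that by auto
  ultimately show thesis using that by blast
qed

text \<open>
  A monotone gallery of \<open>A\<close> that leaves \<open>B\<close> at \<open>T'\<close> would be folded by the retraction onto \<open>B\<close>
  centred at the chamber of \<open>B\<close> in position \<open>T'\<close>; the folded gallery is too short to reach \<open>(n, m)\<close>.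
\<close>

lemma gallery_step:
  assumes A: "A \<in> Apts" "zchart A z" and B: "B \<in> Apts" "zchart B z"
    and L: "L = z ` (\<Union>A \<inter> \<Union>B)" and nm: "(n, m) \<in> L"
    and T: "T \<in> triangles" "T \<subseteq> L" and T': "T' \<in> triangles" "tri_height T < tri_height T'"
    and e: "u \<in> T" "u \<in> T'" "v \<in> T" "v \<in> T'" "u \<noteq> v"
    and mono: "\<And>g. tri_fold g \<Longrightarrow> tri_height (g ` down (n - 1) (m - 1)) \<le>
        tri_height (g ` T') + (tri_height (down (n - 1) (m - 1)) - tri_height T')"
  shows "T' \<subseteq> L"
proof (rule ccontr)
  assume nsub: "\<not> T' \<subseteq> L"
  define a where "a = inv_into (\<Union>A) z"
  define b where "b = inv_into (\<Union>B) z"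
  have a: "a y \<in> \<Union>A" "z (a y) = y" for y
    unfolding a_def using zchart_inv[OF A(2)] zchart_inv_mem[OF A(2)] by auto
  have b: "b y \<in> \<Union>B" "z (b y) = y" for y
    unfolding b_def using zchart_inv[OF B(2)] zchart_inv_mem[OF B(2)] by auto
  have ab: "a y = b y" if yL: "y \<in> L" for y
  proof -
    obtain v where "v \<in> \<Union>A" "v \<in> \<Union>B" "y = z v" using yL unfolding L by blast
    then show ?thesis
      unfolding a_def b_def using zchart_inv_left[OF A(2), of v] zchart_inv_left[OF B(2), of v] by simp
  qed
  have ba: "y \<in> L" if "a y = b y" for y
  proof -
    have "a y \<in> \<Union>A \<inter> \<Union>B" "y = z (a y)" using a[of y] b[of y] that by simp_all
    then show ?thesis unfolding L by blast
  qed
  have tA: "a ` T \<in> A" if "T \<in> triangles" for T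
    unfolding a_def by (rule zchart_inv_simplex[OF A(2) triangle_in_complex[OF that]])
  have cA: "card (a ` T) = 3" if "T \<in> triangles" for T
    unfolding a_def using zchart_inv_card[OF A(2)] card_triangle[OF that] by simp
  define C where "C = b ` T'"
  have C: "C \<in> B" "card C = 3"
    unfolding C_def b_def using zchart_inv_simplex[OF B(2) triangle_in_complex[OF T'(1)]]
      zchart_inv_card[OF B(2)] card_triangle[OF T'(1)] by auto
  then have CX: "C \<in> X" using apartment_subcomplex B by blast
  obtain r where r: "\<And>A. A \<in> Apts \<Longrightarrow> C \<in> A \<Longrightarrow> zchart A r" "\<And>v. v \<in> \<Union>B \<Longrightarrow> r v = z v"
    using retraction_exists[OF B C] by metis
  define g where "g = r \<circ> a"
  have rA: "\<exists>D\<in>Apts. zchart D r \<and> C \<in> D \<and> a ` T \<in> D" if "T \<in> triangles" for T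
  proof -
    have "a ` T \<in> X" using tA[OF that] apartment_subcomplex A by blast
    then obtain D where "D \<in> Apts" "C \<in> D" "a ` T \<in> D" using common_apartment[OF CX] by blast
    then show ?thesis using r(1) by blast
  qed
  have fold: "tri_fold g"
    unfolding tri_fold_def
  proof (intro ballI conjI)
    fix T assume T: "T \<in> triangles"
    obtain D where D: "zchart D r" "a ` T \<in> D" using rA[OF T] by blast
    have "a ` T \<subseteq> \<Union>D" using D(2) by blast
    with zchart_inj[OF D(1)] have "inj_on r (a ` T)" by (rule inj_on_subset)
    moreover have "inj_on a T" by (rule inj_on_inverseI[where g = z]) (simp add: a)
    ultimately show "inj_on g T" unfolding g_def by (rule comp_inj_on[rotated])
    show "g ` T \<in> triangles"
      using zchart_chamber[OF D cA[OF T]] by (simp add: g_def image_comp)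
  qed
  have gL: "g y = y" if "y \<in> L" for y
    using ab[OF that] b r(2) by (simp add: g_def)
  \<comment> \<open>If \<open>g\<close> preserved \<open>T'\<close>, then \<open>C\<close> and the
    chamber of \<open>A\<close> in position \<open>T'\<close> would have the same image under
    \<open>r\<close>, which is injective on an apartment containing both. They would coincide, and
    \<open>T'\<close> would lie in both apartments.\<close>
  have "g ` T' \<noteq> T'"
  proof
    assume eq: "g ` T' = T'"
    obtain D where D: "zchart D r" "C \<in> D" "a ` T' \<in> D" using rA[OF T'(1)] by blast
    have "r ` C = T'" unfolding C_def image_image using r(2) b by simp
    moreover have "r ` (a ` T') = T'" using eq by (simp add: g_def image_comp)
    ultimately have aC: "a ` T' = C"
      using inj_on_image_eq_iff[OF zchart_inj[OF D(1)], of "a ` T'" C] D(2,3) by (simp add: Sup_upper)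
    have "y \<in> L" if y: "y \<in> T'" for y
    proof -
      have "a y \<in> C" unfolding aC[symmetric] using y by (rule imageI)
      then obtain y' where y': "a y = b y'" unfolding C_def by blast
      then have "y = y'" using a(2)[of y] b(2)[of y'] by simp
      then show ?thesis using ba y' by simp
    qed
    then show False using nsub by blast
  qed
  moreover have "g ` T' \<in> triangles" using fold T' by (auto simp: tri_fold_def)
  moreover have "{u, v} \<subseteq> g ` T'"
  proof -
    have "u \<in> L" "v \<in> L" using e T(2) by auto
    then show ?thesis using imageI[OF e(2), of g] imageI[OF e(4), of g] gL by simp
  qed
  moreover have "T \<noteq> T'" using T'(2) by auto
  ultimately have "g ` T' = T"
    using edge_two_triangles[OF T(1) T'(1), of "g ` T'" u v] e by simp
  \<comment> \<open>Folded back to \<open>T\<close>, the gallery starts too low, yet it has to end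
    at a triangle containing the fixed vertex \<open>(n, m)\<close>, and none of these lies below
    \<open>down (n - 1) (m - 1)\<close>.\<close>
  then have "tri_height (g ` down (n - 1) (m - 1)) < tri_height (down (n - 1) (m - 1))"
    using mono[OF fold] T'(2) by simp
  moreover have "tri_height (down (n - 1) (m - 1)) \<le> tri_height (g ` down (n - 1) (m - 1))"
  proof (rule height_star)
    show "g ` down (n - 1) (m - 1) \<in> triangles" using fold by (auto simp: tri_fold_def)
    show "(n, m) \<in> g ` down (n - 1) (m - 1)" 
      using imageI[of "(n, m)" "down (n - 1) (m - 1)" g] gL[OF nm] by (simp add: down_def)
  qed
  ultimately show False by simp
qed

text \<open>A staircase of \<open>up\<close> and \<open>down\<close> triangles leads from the common
  tail along a row and then up a column to \<open>down (n - 1) (m - 1)\<close>, which contains both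
  required vertices. By \<open>gallery_step\<close> no crossing leaves the intersection.\<close>

lemma apartments_share_cone:
  assumes A: "A \<in> Apts" "zchart A z" and B: "B \<in> Apts" "zchart B z"
    and L: "L = z ` (\<Union>A \<inter> \<Union>B)" and nm: "(n, m) \<in> L"
    and tail: "\<And>i j. i \<le> k \<Longrightarrow> j \<le> k \<Longrightarrow> (i, j) \<in> L"
  shows "(n - 1, m) \<in> L" "(n, m - 1) \<in> L"
proof -
  note step = gallery_step[OF A B L nm]
  \<comment> \<open>Bounded by \<open>k - 1\<close> because \<open>down i0 i0\<close> has vertices
    with the coordinate \<open>i0 + 1\<close>.\<close>
  define i0 where "i0 = min (k - 1) (min (n - 1) (m - 1))"
  have ud: "down i j \<subseteq> L" if sub: "up i j \<subseteq> L" and ij: "i \<le> n - 1" "j \<le> m - 1" for i j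
  proof (rule step[OF up_triangle sub down_triangle])
    show "(i + 1, j) \<in> up i j" "(i + 1, j) \<in> down i j" "(i, j + 1) \<in> up i j" "(i, j + 1) \<in> down i j"
      by (simp_all add: up_def down_def)
  qed (use tri_fold_height(1)[OF _ ij] in \<open>simp_all add: algebra_simps\<close>)
  have du1: "up (i + 1) j \<subseteq> L" if sub: "down i j \<subseteq> L" and ij: "i + 1 \<le> n - 1" "j \<le> m - 1" for i j
  proof (rule step[OF down_triangle sub up_triangle])
    show "(i + 1, j) \<in> down i j" "(i + 1, j) \<in> up (i + 1) j"
      "(i + 1, j + 1) \<in> down i j" "(i + 1, j + 1) \<in> up (i + 1) j"
      by (simp_all add: up_def down_def)
  qed (use tri_fold_height(2)[OF _ ij] in \<open>simp_all add: algebra_simps\<close>)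
  have du2: "up i (j + 1) \<subseteq> L" if sub: "down i j \<subseteq> L" and ij: "i \<le> n - 1" "j + 1 \<le> m - 1" for i j
  proof (rule step[OF down_triangle sub up_triangle])
    show "(i, j + 1) \<in> down i j" "(i, j + 1) \<in> up i (j + 1)"
      "(i + 1, j + 1) \<in> down i j" "(i + 1, j + 1) \<in> up i (j + 1)"
      by (simp_all add: up_def down_def)
  qed (use tri_fold_height(2)[OF _ ij] in \<open>simp_all add: algebra_simps\<close>)
  have start: "down i0 i0 \<subseteq> L"
    using tail by (auto simp: down_def i0_def)
  have i0: "i0 \<le> n - 1" "i0 \<le> m - 1" by (auto simp: i0_def)
  have row: "i \<le> n - 1 \<Longrightarrow> down i i0 \<subseteq> L" if "i0 \<le> i" for i
    using that
  proof (induction i rule: int_ge_induct)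
    case base
    show ?case by (rule start)
  next
    case (step i)
    then have "down i i0 \<subseteq> L" by simp
    then show ?case using step.prems i0(2) by (intro ud[OF du1]) simp_all
  qed
  have col: "j \<le> m - 1 \<Longrightarrow> down (n - 1) j \<subseteq> L" if "i0 \<le> j" for j
    using that
  proof (induction j rule: int_ge_induct)
    case base
    show ?case using row i0(1) by simp
  next
    case (step j)
    then have "down (n - 1) j \<subseteq> L" by simp
    then show ?case using step.prems by (intro ud[OF du2]) simp_all
  qed
  have "down (n - 1) (m - 1) \<subseteq> L" using col i0(2) by simp
  then show "(n - 1, m) \<in> L" "(n, m - 1) \<in> L" by (auto simp: down_def)
qed

section \<open>Links of vertices\<close>

lemma third_vertices:
  assumes "{u, v} \<in> X" "u \<noteq> v"
  shows "finite {w. {u, v, w} \<in> X \<and> w \<notin> {u, v}}" "card {w. {u, v, w} \<in> X \<and> w \<notin> {u, v}} \<le> q + 1"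
proof -
  let ?W = "{w. {u, v, w} \<in> X \<and> w \<notin> {u, v}}" and ?K = "{C \<in> chambers X. {u, v} \<subseteq> C}"
  have card: "card ?K = q + 1" using regular[OF assms(1)] assms(2) by simp
  \<comment> \<open>The count is nonzero, whereas an infinite set has \<open>card\<close> 0.\<close>
  then have fin: "finite ?K" by (metis Suc_eq_plus1 card.infinite nat.distinct(1))
  have inj: "inj_on (\<lambda>w. {u, v, w}) ?W" by (auto simp: inj_on_def)
  have sub: "(\<lambda>w. {u, v, w}) ` ?W \<subseteq> ?K" using assms(2) by (auto intro!: chamberI)
  show "finite ?W" using inj_on_finite[OF inj sub fin] .
  show "card ?W \<le> q + 1" using card_inj_on_le[OF inj sub fin] card by simp
qed

text \<open>Two of the chambers without a common edge of the cycle lie in one apartment, which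
  contains the other two by fullness; there the link of \<open>x\<close> is a hexagon. In terms of
  points and lines: two points lie on at most one line.\<close>

lemma link_girth:
  assumes "{x, p, l} \<in> X" "{x, p', l} \<in> X" "{x, p, l'} \<in> X" "{x, p', l'} \<in> X"
    and "x \<notin> {p, p', l, l'}" "p \<notin> {l, l'}" "p' \<notin> {l, l'}"
  shows "p = p' \<or> l = l'"
proof -
  obtain A where A: "A \<in> Apts" "{x, p, l} \<in> A" "{x, p', l'} \<in> A" using common_apartment assms by blast
  obtain z where z: "zchart A z" using apartment_zchart A by blast
  have vs: "{x, p, p', l, l'} \<subseteq> \<Union>A" using A(2,3) by blast
  have "{x, p, l} \<in> A" "{x, p', l} \<in> A" "{x, p, l'} \<in> A" "{x, p', l'} \<in> A"
    by (rule apartment_full[OF _ A(1)]; use assms(1-4) vs in simp)+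
  note e = zchart_edge[OF z this(1)] zchart_edge[OF z this(2)]
    zchart_edge[OF z this(3)] zchart_edge[OF z this(4)]
  have "z p = z p' \<or> z l = z l'"
  proof (rule no_four_cycle)
    show "z p - z x \<in> hex" "z p' - z x \<in> hex" "z l - z x \<in> hex" "z l' - z x \<in> hex"
      using e(1)[of x p] e(2)[of x p'] e(1)[of x l] e(3)[of x l'] assms(5) by simp_all
    show "z p - z l \<in> hex" "z p - z l' \<in> hex" "z p' - z l \<in> hex" "z p' - z l' \<in> hex"
      using e(1)[of l p] e(3)[of l' p] e(2)[of l p'] e(4)[of l' p'] assms(6,7) by auto
  qed
  then show ?thesis using inj_onD[OF zchart_inj[OF z], of p p'] inj_onD[OF zchart_inj[OF z], of l l'] vs by blast
qed

end

section \<open>Sectors of the building\<close>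

definition vpoint :: "'v \<Rightarrow> 'v point" where
  "vpoint v = (\<lambda>u. if u = v then 1 else 0)"

lemma realization_support:
  assumes "b \<in> realization A"
  shows "{v. b v \<noteq> 0} \<in> A" "\<And>v. 0 \<le> b v" "(\<Sum>v | b v \<noteq> 0. b v) = 1"
proof -
  obtain s where s: "s \<in> A" "\<forall>v\<in>s. b v > 0" "\<forall>v. v \<notin> s \<longrightarrow> b v = 0" "(\<Sum>v\<in>s. b v) = 1"
    using assms by (auto simp: realization_def)
  then have eq: "{v. b v \<noteq> 0} = s" by force
  show "{v. b v \<noteq> 0} \<in> A" "(\<Sum>v | b v \<noteq> 0. b v) = 1" using s eq by auto
  show "0 \<le> b v" for v using s by (cases "v \<in> s") (auto intro: less_imp_le)
qed

lemma realizationI: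
  assumes "{v. b v \<noteq> 0} \<in> A" "\<And>v. 0 \<le> b v" "(\<Sum>v | b v \<noteq> 0. b v) = 1"
  shows "b \<in> realization A"
  unfolding realization_def using assms
  by (intro CollectI bexI[of _ "{v. b v \<noteq> 0}"]) (auto simp: order.not_eq_order_implies_strict)

lemma vpoint_support [simp]: "{u. vpoint v u \<noteq> 0} = {v}"
  by (auto simp: vpoint_def)

lemma extend_affine_vpoint [simp]: "extend_affine \<phi> (vpoint v) = \<phi> v"
  unfolding extend_affine_def vpoint_support by (simp add: vpoint_def)

lemma vpoint_realization: "vpoint v \<in> realization A \<longleftrightarrow> {v} \<in> A"
proof
  assume "vpoint v \<in> realization A"
  from realization_support(1)[OF this] show "{v} \<in> A" by simp
qed (auto intro!: realizationI simp: vpoint_def)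

lemma singleton_simplex:
  assumes "zchart A z"
  shows "{v} \<in> A \<longleftrightarrow> v \<in> \<Union>A"
proof
  assume "v \<in> \<Union>A"
  moreover have "{z v} \<in> tri_complex"
  proof -
    obtain n m where "z v = (n, m)" by fastforce
    then show ?thesis by (intro complexI[OF up_triangle[of n m]]) (auto simp: up_def)
  qed
  ultimately show "{v} \<in> A" by (simp add: zchart_mem[OF assms])
qed blast

lemma vpoint_zchart: "zchart A z \<Longrightarrow> vpoint v \<in> realization A \<longleftrightarrow> v \<in> \<Union>A"
  by (simp add: vpoint_realization singleton_simplex)

lemma chart_wt: "chart t A \<phi> \<Longrightarrow> v \<in> \<Union>A \<Longrightarrow> \<phi> v = wt (coord (\<phi> v))"
  by (metis Union_cox_complex bij_betwE type_iso_def wt_coord)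

context
  fixes t :: "'v \<Rightarrow> (real^3) set" and A \<phi> w \<mu> \<nu>
  assumes chart: "chart t A \<phi>" and dir: "weyl_dir w \<mu> \<nu>"
begin

definition chart_sector :: "int \<times> int \<Rightarrow> 'v point set" where
  "chart_sector p = {b \<in> realization A. extend_affine \<phi> b \<in> cox_sector (wt p) w}"

lemma chart_sector_vertices: "vpoint v \<in> chart_sector p \<longleftrightarrow> v \<in> \<Union>A \<and> coord (\<phi> v) \<in> zsector p \<mu> \<nu>"
proof (cases "v \<in> \<Union>A")
  case True
  then have "\<phi> v \<in> cox_sector (wt p) w \<longleftrightarrow> coord (\<phi> v) \<in> zsector p \<mu> \<nu>"
    using chart_wt[OF chart True] weyl_sector_wt[OF dir, of "coord (\<phi> v)" p] by simp
  then show ?thesis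
    using True vpoint_zchart[OF chart_zchart[OF chart], of v] by (simp add: chart_sector_def)
next
  case False
  then show ?thesis
    using vpoint_zchart[OF chart_zchart[OF chart], of v] by (simp add: chart_sector_def)
qed

text \<open>Sectors are convex, so a point belongs to one as soon as the vertices of its carrier
  do.\<close>

lemma chart_sectorI:
  assumes b: "b \<in> realization A" and v: "\<And>v. b v \<noteq> 0 \<Longrightarrow> coord (\<phi> v) \<in> zsector p \<mu> \<nu>"
  shows "b \<in> chart_sector p"
proof -
  note s = realization_support[OF b]
  have fin: "finite {v. b v \<noteq> 0}" using zchart_finite[OF chart_zchart[OF chart] s(1)] by simp
  have "extend_affine \<phi> b \<in> cox_sector (wt p) w"
    unfolding extend_affine_def
  proof (rule convex_sum[OF fin convex_cox_sector[OF dir] s(3)])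
    fix v assume "v \<in> {v. b v \<noteq> 0}"
    then have "vpoint v \<in> chart_sector p" unfolding chart_sector_vertices using v s(1) by blast
    then show "\<phi> v \<in> cox_sector (wt p) w" by (simp add: chart_sector_def)
  qed (use s(2) in auto)
  with b show ?thesis by (simp add: chart_sector_def)
qed

text \<open>A point of an open sector may have carrier vertices on the bounding walls, so the
  converse of \<open>chart_sectorI\<close> costs one step \<open>(1, 1)\<close>: in each coordinate
  some carrier vertex is positive, and adjacent vertices differ by at most one.\<close>

lemma chart_sector_support:
  assumes b: "b \<in> chart_sector (affine_map p \<mu> \<nu> (1, 1))" and v: "b v \<noteq> 0"
  shows "coord (\<phi> v) \<in> zsector p \<mu> \<nu>"
proof -
  have hp: "hex_pair \<mu> \<nu>" using dir by (simp add: weyl_dir_def)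
  let ?p = "affine_map p \<mu> \<nu> (1, 1)" and ?s = "{v. b v \<noteq> 0}"
  let ?c = "\<lambda>v. pair_coords \<mu> \<nu> (coord (\<phi> v) - ?p)"
  have bA: "b \<in> realization A" using b by (simp add: chart_sector_def)
  note s = realization_support[OF bA]
  have fin: "finite ?s" using zchart_finite[OF chart_zchart[OF chart] s(1)] by simp
  have vA: "v \<in> \<Union>A" if "b v \<noteq> 0" for v using that s(1) by blast
  have \<phi>: "\<phi> v = wt ?p + (of_int (fst (?c v)) *\<^sub>R wt \<mu> + of_int (snd (?c v)) *\<^sub>R wt \<nu>)" if "b v \<noteq> 0" for v
    using chart_wt[OF chart vA[OF that]] affine_map_pair_coords[OF hp, of ?p "coord (\<phi> v)"]
      wt_affine_map[of ?p \<mu> \<nu> "?c v"] by (simp add: add.assoc)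
  have "extend_affine \<phi> b = (\<Sum>v\<in>?s. b v *\<^sub>R (wt ?p + (of_int (fst (?c v)) *\<^sub>R wt \<mu> + of_int (snd (?c v)) *\<^sub>R wt \<nu>)))"
    unfolding extend_affine_def by (rule sum.cong) (use \<phi> in simp_all)
  also have "\<dots> = (\<Sum>v\<in>?s. b v) *\<^sub>R wt ?p + (\<Sum>v\<in>?s. b v * of_int (fst (?c v))) *\<^sub>R wt \<mu>
      + (\<Sum>v\<in>?s. b v * of_int (snd (?c v))) *\<^sub>R wt \<nu>"
    by (simp add: scaleR_add_right sum.distrib scaleR_sum_left)
  finally have pos: "0 < (\<Sum>v\<in>?s. b v * of_int (fst (?c v))) \<and> 0 < (\<Sum>v\<in>?s. b v * of_int (snd (?c v)))"
    using b s(3) weyl_sector_iff[OF dir, of ?p] by (simp add: chart_sector_def)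
  have ex: "\<exists>u\<in>?s. 0 < f u" if "0 < (\<Sum>v\<in>?s. b v * of_int (f v))" for f :: "_ \<Rightarrow> int"
  proof (rule ccontr)
    assume "\<not> ?thesis"
    then have "(\<Sum>v\<in>?s. b v * of_int (f v)) \<le> 0"
      using s(2) by (intro sum_nonpos) (auto simp: mult_le_0_iff not_less)
    with that show False by simp
  qed
  have near: "\<bar>fst (?c v) - fst (?c u)\<bar> \<le> 1 \<and> \<bar>snd (?c v) - snd (?c u)\<bar> \<le> 1" if u: "b u \<noteq> 0" for u
  proof (cases "u = v")
    case False
    then have "coord (\<phi> v) - coord (\<phi> u) \<in> hex"
      using zchart_edge[OF chart_zchart[OF chart] s(1), of u v] u v by simp
    then have "pair_coords \<mu> \<nu> (coord (\<phi> v) - coord (\<phi> u)) \<in> hex" by (rule pair_coords_hex[OF hp])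
    moreover have "?c v = ?c u + pair_coords \<mu> \<nu> (coord (\<phi> v) - coord (\<phi> u))"
      unfolding pair_coords_add[symmetric] by simp
    moreover have "\<bar>fst h\<bar> \<le> 1 \<and> \<bar>snd h\<bar> \<le> 1" if "h \<in> hex" for h
      using that by (auto simp: hex_def)
    ultimately show ?thesis by simp
  qed simp
  have nonneg: "0 \<le> fst (?c v)" "0 \<le> snd (?c v)"
    using ex[of "\<lambda>v. fst (?c v)"] ex[of "\<lambda>v. snd (?c v)"] pos near by force+
  have "pair_coords \<mu> \<nu> (coord (\<phi> v) - p) = ?c v + pair_coords \<mu> \<nu> (?p - p)"
    unfolding pair_coords_add[symmetric] by simp
  also have "pair_coords \<mu> \<nu> (?p - p) = (1, 1)" by (rule pair_coords_affine_map[OF hp])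
  finally show ?thesis using nonneg by (simp add: zsector_iff[OF hp])
qed

lemma chart_sector_mono: "0 \<le> k \<Longrightarrow> chart_sector (affine_map p \<mu> \<nu> (k + 1, k + 1)) \<subseteq> chart_sector p"
proof
  fix b assume k: "0 \<le> k" and b: "b \<in> chart_sector (affine_map p \<mu> \<nu> (k + 1, k + 1))"
  have eq: "affine_map p \<mu> \<nu> (k + 1, k + 1) = affine_map (affine_map p \<mu> \<nu> (k, k)) \<mu> \<nu> (1, 1)"
    by (simp add: affine_map_def algebra_simps)
  have hp: "hex_pair \<mu> \<nu>" using dir by (simp add: weyl_dir_def)
  show "b \<in> chart_sector p"
    using chart_sector_support[of b "affine_map p \<mu> \<nu> (k, k)"] b zsector_mono[OF hp k, of p]
    by (intro chart_sectorI) (auto simp: eq[symmetric] chart_sector_def)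
qed

end

lemma sector_inE:
  assumes "sector_in t A x S"
  obtains \<phi> w \<mu> \<nu> p where "chart t A \<phi>" "w \<in> finite_weyl_group" "weyl_dir w \<mu> \<nu>" "hex_pair \<mu> \<nu>"
    "\<phi> x = wt p" "S = chart_sector A \<phi> w p"
proof -
  obtain \<phi> w where *: "x \<in> \<Union>A" "chart t A \<phi>" "w \<in> finite_weyl_group"
    "S = {b \<in> realization A. extend_affine \<phi> b \<in> cox_sector (\<phi> x) w}"
    using assms by (auto simp: sector_in_def)
  obtain \<mu> \<nu> where d: "weyl_dir w \<mu> \<nu>" using finite_weyl_dir[OF *(3)] by blast
  have "\<phi> x = wt (coord (\<phi> x))" by (rule chart_wt[OF *(2,1)])
  moreover from this have "S = chart_sector A \<phi> w (coord (\<phi> x))"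
    unfolding chart_sector_def[OF *(2) d] using *(4) by simp
  ultimately show thesis using that[OF *(2,3) d] d by (auto simp: weyl_dir_def)
qed

lemma sector_inI:
  assumes "chart t A \<phi>" "w \<in> finite_weyl_group"
  shows "\<exists>x. sector_in t A x {b \<in> realization A. extend_affine \<phi> b \<in> cox_sector (wt p) w}"
proof -
  obtain x where "x \<in> \<Union>A" "coord (\<phi> x) = p"
    using zchart_inv_mem[OF chart_zchart[OF assms(1)]] zchart_inv[OF chart_zchart[OF assms(1)]]
    by (metis comp_apply)
  then have "sector_in t A x {b \<in> realization A. extend_affine \<phi> b \<in> cox_sector (wt p) w}"
    unfolding sector_in_def using chart_wt[OF assms(1), of x] assms
    by (intro conjI exI[of _ \<phi>] exI[of _ w]) simp_all
  then show ?thesis by blast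
qed

context triangle_building
begin

text \<open>A sector of \<open>A\<close> inside \<open>B\<close> contains a whole chamber, so
  coordinates of the two apartments can be matched; the change of coordinates is affine and takes
  sectors to sectors.\<close>

lemma sector_in_other_apartment:
  assumes A: "A \<in> Apts" and chart: "chart t A \<phi>" and dir: "weyl_dir w \<mu> \<nu>"
    and B: "B \<in> Apts" "zchart B z" and sub: "chart_sector A \<phi> w p \<subseteq> realization B"
  obtains c \<alpha> \<beta> where "hex_pair \<alpha> \<beta>"
    "\<And>v. vpoint v \<in> chart_sector A \<phi> w p \<Longrightarrow> z v = affine_map c \<alpha> \<beta> (coord (\<phi> v))"
    "\<And>v. vpoint v \<in> chart_sector A \<phi> w p \<longleftrightarrow> v \<in> \<Union>B \<and>
      z v \<in> zsector (affine_map c \<alpha> \<beta> p) (affine_map 0 \<alpha> \<beta> \<mu>) (affine_map 0 \<alpha> \<beta> \<nu>)"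
proof -
  let ?S = "chart_sector A \<phi> w p" and ?c = "coord \<circ> \<phi>"
  have zA: "zchart A ?c" by (rule chart_zchart[OF chart])
  have hp: "hex_pair \<mu> \<nu>" using dir by (simp add: weyl_dir_def)
  note vert = chart_sector_vertices[OF chart dir]
  obtain s where s: "s \<in> A" "card s = 3" "\<And>v. v \<in> s \<Longrightarrow> coord (\<phi> v) \<in> zsector p \<mu> \<nu>"
  proof -
    \<comment> \<open>A triangle near the tip with all three vertices in the open sector.\<close>
    define T where "T = {affine_map p \<mu> \<nu> (1, 1), affine_map p \<mu> \<nu> (2, 1), affine_map p \<mu> \<nu> (1, 2)}"
    have "affine_map p \<mu> \<nu> (2, 1) - affine_map p \<mu> \<nu> (1, 1) = \<mu>"
      "affine_map p \<mu> \<nu> (1, 2) - affine_map p \<mu> \<nu> (1, 1) = \<nu>"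
      "affine_map p \<mu> \<nu> (1, 2) - affine_map p \<mu> \<nu> (2, 1) = \<nu> - \<mu>"
      by (simp_all add: affine_map_def prod_eq_iff)
    then have T: "T \<in> triangles" unfolding T_def
      using hp by (intro triangle_completion) (simp_all add: hex_pair_def)
    have "T \<subseteq> zsector p \<mu> \<nu>" by (auto simp: T_def zsector_def)
    then have "coord (\<phi> v) \<in> zsector p \<mu> \<nu>" if "v \<in> inv_into (\<Union>A) ?c ` T" for v
      using that zchart_inv[OF zA] by auto
    then show thesis
      using that[of "inv_into (\<Union>A) ?c ` T"] zchart_inv_simplex[OF zA triangle_in_complex[OF T]]
        zchart_inv_card[OF zA] card_triangle[OF T] by auto
  qed
  have "s \<in> B"
  proof -
    \<comment> \<open>The barycentre of \<open>s\<close>: a point of the sector whose carrier is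
      exactly \<open>s\<close>.\<close>
    define b where "b = (\<lambda>v. if v \<in> s then 1 / 3 else 0 :: real)"
    have supp: "{v. b v \<noteq> 0} = s" by (auto simp: b_def)
    have "b \<in> realization A"
      by (rule realizationI, unfold supp) (use s in \<open>auto simp: b_def\<close>)
    then have "b \<in> ?S" using s(3) supp by (intro chart_sectorI[OF chart dir]) auto
    then show ?thesis using realization_support(1)[of b B] sub supp by auto
  qed
  then obtain z' where z': "zchart A z'" "\<And>v. v \<in> \<Union>A \<Longrightarrow> v \<in> \<Union>B \<Longrightarrow> z' v = z v"
    using apartment_coords[OF A B(1) s(1) _ s(2) B(2)] by metis
  obtain c \<alpha> \<beta> where q: "hex_pair \<alpha> \<beta>" "\<And>v. v \<in> \<Union>A \<Longrightarrow> z' v = affine_map c \<alpha> \<beta> (?c v)"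
    using zchart_affine[OF zA z'(1)] by metis
  have vB: "v \<in> \<Union>B" if "vpoint v \<in> ?S" for v
    using that sub vpoint_zchart[OF B(2)] by blast
  have zv: "z v = affine_map c \<alpha> \<beta> (coord (\<phi> v))" if v: "vpoint v \<in> ?S" for v
  proof -
    have "v \<in> \<Union>A" using v by (simp add: vert)
    then show ?thesis using z'(2) vB[OF v] q(2) by simp
  qed
  let ?Z = "zsector (affine_map c \<alpha> \<beta> p) (affine_map 0 \<alpha> \<beta> \<mu>) (affine_map 0 \<alpha> \<beta> \<nu>)"
  have Z: "?Z = affine_map c \<alpha> \<beta> ` zsector p \<mu> \<nu>" by (simp add: affine_map_zsector)
  have "vpoint v \<in> ?S \<longleftrightarrow> v \<in> \<Union>B \<and> z v \<in> ?Z" for v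
  proof
    assume v: "vpoint v \<in> ?S"
    then have "coord (\<phi> v) \<in> zsector p \<mu> \<nu>" by (simp add: vert)
    then show "v \<in> \<Union>B \<and> z v \<in> ?Z" unfolding Z zv[OF v] using vB[OF v] by blast
  next
    assume v: "v \<in> \<Union>B \<and> z v \<in> ?Z"
    then obtain y where y: "y \<in> zsector p \<mu> \<nu>" "z v = affine_map c \<alpha> \<beta> y" unfolding Z by blast
    define u where "u = inv_into (\<Union>A) ?c y"
    have u: "u \<in> \<Union>A" "coord (\<phi> u) = y"
      unfolding u_def using zchart_inv_mem[OF zA] zchart_inv[OF zA, of y] by auto
    then have uS: "vpoint u \<in> ?S" using y by (simp add: vert)
    then have "z u = z v" using zv[OF uS] u y by simp
    then have "u = v" using inj_onD[OF zchart_inj[OF B(2)], of u v] vB[OF uS] v by blast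
    then show "vpoint v \<in> ?S" using uS by simp
  qed
  with q(1) zv that show thesis by blast
qed

text \<open>In the coordinates of \<open>B\<close> the set \<open>U\<close> is again a sector, and
  inclusion in a sector forces its direction.\<close>

lemma subsector_direction:
  assumes B: "B \<in> Apts" "zchart B z" and U: "U \<in> sectors t Apts" "U \<subseteq> realization B"
    and sub: "\<And>v. vpoint v \<in> U \<Longrightarrow> z v \<in> zsector r \<mu> \<nu>" and hp: "hex_pair \<mu> \<nu>"
  obtains p where "\<And>v. vpoint v \<in> U \<longleftrightarrow> v \<in> \<Union>B \<and> z v \<in> zsector p \<mu> \<nu>"
proof -
  obtain A x where A: "A \<in> Apts" "sector_in t A x U" using U(1) by (auto simp: sectors_def)
  obtain \<phi> w \<mu>' \<nu>' p' where c: "chart t A \<phi>" "weyl_dir w \<mu>' \<nu>'" "hex_pair \<mu>' \<nu>'" "U = chart_sector A \<phi> w p'"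
    using sector_inE[OF A(2)] by metis
  obtain c \<alpha> \<beta> where q: "hex_pair \<alpha> \<beta>" and v: "\<And>v. vpoint v \<in> U \<longleftrightarrow> v \<in> \<Union>B \<and>
      z v \<in> zsector (affine_map c \<alpha> \<beta> p') (affine_map 0 \<alpha> \<beta> \<mu>') (affine_map 0 \<alpha> \<beta> \<nu>')"
    using sector_in_other_apartment[OF A(1) c(1,2) B U(2)[unfolded c(4)]] c(4) by metis
  have "zsector (affine_map c \<alpha> \<beta> p') (affine_map 0 \<alpha> \<beta> \<mu>') (affine_map 0 \<alpha> \<beta> \<nu>') \<subseteq> zsector r \<mu> \<nu>"
  proof
    fix y assume y: "y \<in> zsector (affine_map c \<alpha> \<beta> p') (affine_map 0 \<alpha> \<beta> \<mu>') (affine_map 0 \<alpha> \<beta> \<nu>')"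
    define u where "u = inv_into (\<Union>B) z y"
    have "u \<in> \<Union>B" "z u = y" unfolding u_def using zchart_inv_mem[OF B(2)] zchart_inv[OF B(2)] by auto
    then show "y \<in> zsector r \<mu> \<nu>" using sub[of u] v[of u] y by simp
  qed
  from zsector_subset_direction[OF hex_pair_comp[OF q c(3)] hp this]
  show thesis using that[of "affine_map c \<alpha> \<beta> p'"] v by simp
qed

text \<open>The point \<open>b\<close> is given in another apartment \<open>B\<close>; fullness
  moves its carrier into \<open>A\<close>.\<close>

lemma sector_subsetI:
  assumes A: "A \<in> Apts" and c: "chart t A \<phi>" "weyl_dir w \<mu> \<nu>"
    and b: "b \<in> realization B" "B \<in> Apts" and v: "\<And>v. b v \<noteq> 0 \<Longrightarrow> vpoint v \<in> chart_sector A \<phi> w p"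
  shows "b \<in> chart_sector A \<phi> w p"
proof (rule chart_sectorI[OF c])
  note s = realization_support[OF b(1)]
  have v': "v \<in> \<Union>A \<and> coord (\<phi> v) \<in> zsector p \<mu> \<nu>" if "b v \<noteq> 0" for v
    using v[OF that] by (simp add: chart_sector_vertices[OF c])
  then show "\<And>v. b v \<noteq> 0 \<Longrightarrow> coord (\<phi> v) \<in> zsector p \<mu> \<nu>" by blast
  have "{v. b v \<noteq> 0} \<in> X" using s(1) apartment_subcomplex[OF b(2)] by blast
  moreover have "{v. b v \<noteq> 0} \<subseteq> \<Union>A" using v' by blast
  ultimately have "{v. b v \<noteq> 0} \<in> A" using apartment_full A by blast
  then show "b \<in> realization A" using s by (intro realizationI) auto
qed

text \<open>In an apartment containing \<open>S\<close> both \<open>U\<close> and \<open>V\<close>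
  have the direction of \<open>S\<close>, so going far enough inside \<open>U\<close> enters
  \<open>V\<close>.\<close>

lemma common_subsector:
  assumes S: "S \<in> sectors t Apts" and U: "U \<in> sectors t Apts" "U \<subseteq> S" and V: "V \<in> sectors t Apts" "V \<subseteq> S"
  obtains W where "W \<in> sectors t Apts" "W \<subseteq> U" "W \<subseteq> V"
proof -
  obtain B y where B: "B \<in> Apts" "sector_in t B y S" using S by (auto simp: sectors_def)
  obtain \<phi>1 w1 \<mu>1 \<nu>1 p1 where c1: "chart t B \<phi>1" "weyl_dir w1 \<mu>1 \<nu>1" "hex_pair \<mu>1 \<nu>1" "S = chart_sector B \<phi>1 w1 p1"
    using sector_inE[OF B(2)] by metis
  let ?z = "coord \<circ> \<phi>1"
  have zB: "zchart B ?z" by (rule chart_zchart[OF c1(1)])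
  have SB: "S \<subseteq> realization B" unfolding c1(4) chart_sector_def[OF c1(1,2)] by blast
  have Sv: "vpoint v \<in> S \<Longrightarrow> ?z v \<in> zsector p1 \<mu>1 \<nu>1" for v
    unfolding c1(4) chart_sector_vertices[OF c1(1,2)] by simp
  obtain r2 where r2: "\<And>v. vpoint v \<in> V \<longleftrightarrow> v \<in> \<Union>B \<and> ?z v \<in> zsector r2 \<mu>1 \<nu>1"
    using subsector_direction[OF B(1) zB V(1) _ Sv c1(3)] V(2) SB by blast
  obtain A x where A: "A \<in> Apts" "sector_in t A x U" using U(1) by (auto simp: sectors_def)
  obtain \<phi> w \<mu> \<nu> p where c: "chart t A \<phi>" "weyl_dir w \<mu> \<nu>" "hex_pair \<mu> \<nu>" "U = chart_sector A \<phi> w p"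
    and w: "w \<in> finite_weyl_group"
    using sector_inE[OF A(2)] by metis
  have "chart_sector A \<phi> w p \<subseteq> realization B" using U(2) SB c(4) by blast
  then obtain c \<alpha> \<beta> where q: "hex_pair \<alpha> \<beta>"
    and zU: "\<And>v. vpoint v \<in> U \<Longrightarrow> ?z v = affine_map c \<alpha> \<beta> (coord (\<phi> v))"
    and vU: "\<And>v. vpoint v \<in> U \<longleftrightarrow> v \<in> \<Union>B \<and>
      ?z v \<in> zsector (affine_map c \<alpha> \<beta> p) (affine_map 0 \<alpha> \<beta> \<mu>) (affine_map 0 \<alpha> \<beta> \<nu>)"
    using sector_in_other_apartment[OF A(1) c(1,2) B(1) zB] c(4) by metis
  let ?\<mu> = "affine_map 0 \<alpha> \<beta> \<mu>" and ?\<nu> = "affine_map 0 \<alpha> \<beta> \<nu>" and ?r = "affine_map c \<alpha> \<beta> p"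
  have hp: "hex_pair ?\<mu> ?\<nu>" by (rule hex_pair_comp[OF q c(3)])
  have "zsector ?r ?\<mu> ?\<nu> \<subseteq> zsector p1 \<mu>1 \<nu>1"
  proof
    fix y assume y: "y \<in> zsector ?r ?\<mu> ?\<nu>"
    define u where "u = inv_into (\<Union>B) ?z y"
    have "u \<in> \<Union>B" "?z u = y" unfolding u_def using zchart_inv_mem[OF zB] zchart_inv[OF zB] by auto
    then show "y \<in> zsector p1 \<mu>1 \<nu>1" using Sv[of u] vU[of u] y U(2) by auto
  qed
  then have same: "zsector r2 ?\<mu> ?\<nu> = zsector r2 \<mu>1 \<nu>1" by (rule zsector_subset_direction[OF hp c1(3)])
  obtain k where k: "0 \<le> k" "zsector (affine_map ?r ?\<mu> ?\<nu> (k, k)) ?\<mu> ?\<nu> \<subseteq> zsector r2 ?\<mu> ?\<nu>"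
    using zsector_deeper[OF hp] by metis
  \<comment> \<open>After \<open>k\<close> steps the vertices lie in \<open>V\<close>; one more step
    passes from vertices to all points.\<close>
  let ?W = "chart_sector A \<phi> w (affine_map p \<mu> \<nu> (k + 1, k + 1))"
  have WU: "?W \<subseteq> U" unfolding c(4) by (rule chart_sector_mono[OF c(1,2) k(1)])
  have "?W \<in> sectors t Apts"
    using sector_inI[OF c(1) w, of "affine_map p \<mu> \<nu> (k + 1, k + 1)"] A(1)
    unfolding sectors_def chart_sector_def[OF c(1,2)] by blast
  moreover have "?W \<subseteq> V"
  proof
    fix b assume b: "b \<in> ?W"
    have eq: "affine_map p \<mu> \<nu> (k + 1, k + 1) = affine_map (affine_map p \<mu> \<nu> (k, k)) \<mu> \<nu> (1, 1)"
      by (simp add: affine_map_def algebra_simps)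
    have bA: "b \<in> realization A" using b by (simp add: chart_sector_def[OF c(1,2)])
    have vV: "vpoint v \<in> V" if v: "b v \<noteq> 0" for v
    proof -
      have z: "coord (\<phi> v) \<in> zsector (affine_map p \<mu> \<nu> (k, k)) \<mu> \<nu>"
        using chart_sector_support[OF c(1,2), of b "affine_map p \<mu> \<nu> (k, k)" v] b v by (simp add: eq)
      have "v \<in> \<Union>A" using realization_support(1)[OF bA] v by blast
      then have vpU: "vpoint v \<in> U"
        unfolding c(4) chart_sector_vertices[OF c(1,2)] using z zsector_mono[OF c(3) k(1)] by blast
      have "?z v \<in> affine_map c \<alpha> \<beta> ` zsector (affine_map p \<mu> \<nu> (k, k)) \<mu> \<nu>"
        using zU[OF vpU] z by simp
      then have "?z v \<in> zsector r2 \<mu>1 \<nu>1"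
        using k(2) same by (auto simp: affine_map_zsector affine_map_comp)
      then show ?thesis using r2 vU vpU by blast
    qed
    obtain A' x' where A': "A' \<in> Apts" "sector_in t A' x' V" using V(1) by (auto simp: sectors_def)
    obtain \<phi>' w' \<mu>' \<nu>' p' where c': "chart t A' \<phi>'" "weyl_dir w' \<mu>' \<nu>'" "V = chart_sector A' \<phi>' w' p'"
      using sector_inE[OF A'(2)] by metis
    show "b \<in> V"
      unfolding c'(3) using vV sector_subsetI[OF A'(1) c'(1,2) bA A(1)] c'(3) by blast
  qed
  ultimately show thesis using that WU by blast
qed

text \<open>Both sectors share a subsector with the representative \<open>R\<close>, and
  \<open>common_subsector\<close> inside \<open>R\<close> provides the transitivity.\<close>

lemma boundary_common_subsector:
  assumes "\<omega> \<in> boundary t Apts" "S \<in> \<omega>" "S' \<in> \<omega>"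
  obtains U where "U \<in> sectors t Apts" "U \<subseteq> S" "U \<subseteq> S'"
proof -
  obtain R where R: "R \<in> sectors t Apts" "\<omega> = sector_equiv t Apts `` {R}"
    using assms(1) by (auto simp: boundary_def quotient_def)
  have "(R, S) \<in> sector_equiv t Apts" "(R, S') \<in> sector_equiv t Apts" using R(2) assms(2,3) by simp_all
  then have "\<exists>U\<in>sectors t Apts. U \<subseteq> R \<and> U \<subseteq> S" "\<exists>U\<in>sectors t Apts. U \<subseteq> R \<and> U \<subseteq> S'"
    by (simp_all add: sector_equiv_def)
  then obtain U U' where U: "U \<in> sectors t Apts" "U \<subseteq> R" "U \<subseteq> S" "U' \<in> sectors t Apts" "U' \<subseteq> R" "U' \<subseteq> S'"
    by blast
  obtain W where "W \<in> sectors t Apts" "W \<subseteq> U" "W \<subseteq> U'"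
    using common_subsector[OF R(1) U(1,2,4,5)] by metis
  with U that[of W] show thesis by simp
qed

end

section \<open>Averages over a partition\<close>

lemma ennreal_powr_mono: "x \<le> y \<Longrightarrow> 0 \<le> a \<Longrightarrow> ennreal_powr x a \<le> ennreal_powr y a"
  by (cases x; cases y) (auto simp: ennreal_powr_def top_unique intro!: ennreal_leI powr_mono2)

lemma ennreal_powr_ennreal: "0 \<le> r \<Longrightarrow> ennreal_powr (ennreal r) a = ennreal (r powr a)"
  by (simp add: ennreal_powr_def)

lemma ennreal_powr_inverse: "a \<noteq> 0 \<Longrightarrow> ennreal_powr (ennreal_powr x a) (1 / a) = x"
  by (cases x) (auto simp: ennreal_powr_def powr_powr)

lemma ennreal_powr_inverse': "a \<noteq> 0 \<Longrightarrow> ennreal_powr (ennreal_powr x (1 / a)) a = x"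
  using ennreal_powr_inverse[of "1 / a" x] by simp

lemma ennreal_powr_mult: "0 \<le> r \<Longrightarrow> 0 < a \<Longrightarrow> ennreal_powr (ennreal r * x) a = ennreal (r powr a) * ennreal_powr x a"
  by (cases x; cases "r = 0") (auto simp: ennreal_powr_def powr_mult ennreal_mult[symmetric] ennreal_mult_top)

text \<open>The inverse power is monotone too, which replaces a continuity argument.\<close>

lemma ennreal_powr_Sup:
  assumes "0 < a"
  shows "ennreal_powr (SUP i\<in>I. f i) a \<le> (SUP i\<in>I. ennreal_powr (f i) a)"
proof -
  have "f i \<le> ennreal_powr (SUP i\<in>I. ennreal_powr (f i) a) (1 / a)" if "i \<in> I" for i
    using ennreal_powr_mono[OF SUP_upper[OF that, of "\<lambda>i. ennreal_powr (f i) a"], of "1 / a"] assms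
    by (simp add: ennreal_powr_inverse)
  then have "(SUP i\<in>I. f i) \<le> ennreal_powr (SUP i\<in>I. ennreal_powr (f i) a) (1 / a)" by (rule SUP_least)
  from ennreal_powr_mono[OF this, of a] show ?thesis using assms by (simp add: ennreal_powr_inverse')
qed

lemma ennreal_powr_measurable [measurable]:
  "f \<in> borel_measurable M \<Longrightarrow> (\<lambda>x. ennreal_powr (f x) a) \<in> borel_measurable M"
proof -
  assume [measurable]: "f \<in> borel_measurable M"
  have "(\<lambda>x. if f x \<in> {\<top>} then \<infinity> else ennreal (enn2real (f x) powr a)) \<in> borel_measurable M"
    by measurable
  then show ?thesis by (simp add: ennreal_powr_def)
qed

locale uniform_partition =
  fixes M :: "'w measure" and k :: "'w \<Rightarrow> 'v" and c :: real
  assumes c_pos: "0 < c"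
    and block_sets: "\<omega> \<in> space M \<Longrightarrow> {\<omega>' \<in> space M. k \<omega>' = k \<omega>} \<in> sets M"
    and block_emeasure: "\<omega> \<in> space M \<Longrightarrow> emeasure M {\<omega>' \<in> space M. k \<omega>' = k \<omega>} = ennreal c"
    and countable_blocks: "countable (k ` space M)"
begin

abbreviation block :: "'w \<Rightarrow> 'w set" where
  "block \<omega> \<equiv> {\<omega>' \<in> space M. k \<omega>' = k \<omega>}"

definition avg :: "('w \<Rightarrow> ennreal) \<Rightarrow> 'w \<Rightarrow> ennreal" where
  "avg f \<omega> = (\<integral>\<^sup>+\<omega>'. f \<omega>' * indicator (block \<omega>) \<omega>' \<partial>M) / ennreal c"

lemma sigma_finite: "sigma_finite_measure M"
proof
  let ?A = "(\<lambda>v. {\<omega>' \<in> space M. k \<omega>' = v}) ` k ` space M"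
  have "?A \<subseteq> sets M" "\<forall>a\<in>?A. emeasure M a \<noteq> \<infinity>" using block_sets block_emeasure by auto
  moreover have "\<Union>?A = space M" by auto
  ultimately show "\<exists>A. countable A \<and> A \<subseteq> sets M \<and> \<Union>A = space M \<and> (\<forall>a\<in>A. emeasure M a \<noteq> \<infinity>)"
    using countable_blocks by (intro exI[of _ ?A]) simp
qed

lemma label_measurable: "k \<in> measurable M (count_space (k ` space M))"
  unfolding measurable_count_space_eq_countable[OF countable_blocks]
proof (intro conjI ballI)
  fix a assume "a \<in> k ` space M"
  then obtain \<omega> where "\<omega> \<in> space M" "a = k \<omega>" by blast
  then have "k -` {a} \<inter> space M = block \<omega>" by auto
  then show "k -` {a} \<inter> space M \<in> sets M" using block_sets \<open>\<omega> \<in> space M\<close> by simp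
qed auto

lemma avg_cong: "k \<omega> = k \<omega>' \<Longrightarrow> avg f \<omega> = avg f \<omega>'"
  by (simp add: avg_def)

lemma label_function_measurable: "(\<lambda>\<omega>. G (k \<omega>)) \<in> borel_measurable M"
  using measurable_compose[OF label_measurable, of G borel] by simp

lemma avg_measurable [measurable]: "avg f \<in> borel_measurable M"
  unfolding avg_def[abs_def]
  by (rule label_function_measurable[of "\<lambda>v. (\<integral>\<^sup>+\<omega>'. f \<omega>' * indicator {\<omega>' \<in> space M. k \<omega>' = v} \<omega>' \<partial>M) / ennreal c"])

lemma avg_mono: "(\<And>\<omega>. \<omega> \<in> space M \<Longrightarrow> f \<omega> \<le> g \<omega>) \<Longrightarrow> avg f \<omega> \<le> avg g \<omega>"
  unfolding avg_def by (intro divide_right_mono_ennreal nn_integral_mono mult_right_mono) auto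

lemma same_block_measurable: "{z \<in> space (M \<Otimes>\<^sub>M M). k (fst z) = k (snd z)} \<in> sets (M \<Otimes>\<^sub>M M)"
proof -
  have "{z \<in> space (M \<Otimes>\<^sub>M M). k (fst z) = k (snd z)}
    = (\<Union>v\<in>k ` space M. {\<omega>' \<in> space M. k \<omega>' = v} \<times> {\<omega>' \<in> space M. k \<omega>' = v})"
    by (auto simp: space_pair_measure)
  also have "\<dots> \<in> sets (M \<Otimes>\<^sub>M M)"
    using countable_blocks block_sets by (intro sets.countable_UN') auto
  finally show ?thesis .
qed

text \<open>The kernel is the indicator of the pairs lying in one block, divided by
  \<open>c\<close>, hence symmetric; the rest is Fubini for nonnegative functions.\<close>

lemma avg_adjoint:
  assumes [measurable]: "f \<in> borel_measurable M" "g \<in> borel_measurable M"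
  shows "(\<integral>\<^sup>+\<omega>. g \<omega> * avg f \<omega> \<partial>M) = (\<integral>\<^sup>+\<omega>. avg g \<omega> * f \<omega> \<partial>M)"
proof -
  interpret sigma_finite_measure M by (rule sigma_finite)
  interpret pair_sigma_finite M M ..
  define S where "S = {z \<in> space (M \<Otimes>\<^sub>M M). k (fst z) = k (snd z)}"
  have [measurable]: "S \<in> sets (M \<Otimes>\<^sub>M M)" unfolding S_def by (rule same_block_measurable)
  have S: "indicator (block \<omega>) \<omega>' = (indicator S (\<omega>, \<omega>') :: ennreal)"
    "indicator (block \<omega>') \<omega> = (indicator S (\<omega>, \<omega>') :: ennreal)"
    if "\<omega> \<in> space M" "\<omega>' \<in> space M" for \<omega> \<omega>'
    using that by (auto simp: S_def space_pair_measure indicator_def)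
  have "(\<integral>\<^sup>+\<omega>. g \<omega> * avg f \<omega> \<partial>M) = (\<integral>\<^sup>+\<omega>. (\<integral>\<^sup>+\<omega>'. g \<omega> * f \<omega>' * indicator S (\<omega>, \<omega>') / ennreal c \<partial>M) \<partial>M)"
  proof (intro nn_integral_cong)
    fix \<omega> assume \<omega>: "\<omega> \<in> space M"
    have "avg f \<omega> = (\<integral>\<^sup>+\<omega>'. f \<omega>' * indicator S (\<omega>, \<omega>') \<partial>M) / ennreal c"
      unfolding avg_def using S(1)[OF \<omega>] by (simp cong: nn_integral_cong)
    then show "g \<omega> * avg f \<omega> = (\<integral>\<^sup>+\<omega>'. g \<omega> * f \<omega>' * indicator S (\<omega>, \<omega>') / ennreal c \<partial>M)"
      using \<omega> by (simp add: nn_integral_divide nn_integral_cmult mult.assoc ennreal_times_divide)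
  qed
  also have "\<dots> = (\<integral>\<^sup>+\<omega>'. (\<integral>\<^sup>+\<omega>. g \<omega> * f \<omega>' * indicator S (\<omega>, \<omega>') / ennreal c \<partial>M) \<partial>M)"
    by (rule Fubini') measurable
  also have "\<dots> = (\<integral>\<^sup>+\<omega>. avg g \<omega> * f \<omega> \<partial>M)"
  proof (intro nn_integral_cong)
    fix \<omega>' assume \<omega>': "\<omega>' \<in> space M"
    have "avg g \<omega>' = (\<integral>\<^sup>+\<omega>. g \<omega> * indicator S (\<omega>, \<omega>') \<partial>M) / ennreal c"
      unfolding avg_def using S(2)[OF _ \<omega>'] by (simp cong: nn_integral_cong)
    moreover have "(\<integral>\<^sup>+\<omega>. g \<omega> * f \<omega>' * indicator S (\<omega>, \<omega>') / ennreal c \<partial>M)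
        = (\<integral>\<^sup>+\<omega>. (f \<omega>' / ennreal c) * (g \<omega> * indicator S (\<omega>, \<omega>')) \<partial>M)"
      by (intro nn_integral_cong) (simp add: divide_ennreal_def mult_ac)
    moreover have "\<dots> = (f \<omega>' / ennreal c) * (\<integral>\<^sup>+\<omega>. g \<omega> * indicator S (\<omega>, \<omega>') \<partial>M)"
      using \<omega>' by (intro nn_integral_cmult) measurable
    ultimately show "(\<integral>\<^sup>+\<omega>. g \<omega> * f \<omega>' * indicator S (\<omega>, \<omega>') / ennreal c \<partial>M) = avg g \<omega>' * f \<omega>'"
      by (simp add: divide_ennreal_def mult_ac)
  qed
  finally show ?thesis .
qed

lemma avg_indicator:
  assumes "E \<in> sets M" "\<omega> \<in> space M"
  shows "avg (indicator E) \<omega> = emeasure M (E \<inter> block \<omega>) / ennreal c"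
proof -
  have "(\<integral>\<^sup>+\<omega>'. indicator E \<omega>' * indicator (block \<omega>) \<omega>' \<partial>M) = (\<integral>\<^sup>+\<omega>'. indicator (E \<inter> block \<omega>) \<omega>' \<partial>M)"
    by (intro nn_integral_cong) (auto simp: indicator_def)
  also have "\<dots> = emeasure M (E \<inter> block \<omega>)" using assms block_sets by (intro nn_integral_indicator) auto
  finally show ?thesis by (simp add: avg_def)
qed

lemma avg_saturated_mult:
  assumes "\<And>\<omega>'. \<omega>' \<in> space M \<Longrightarrow> k \<omega>' = k \<omega> \<Longrightarrow> g \<omega>' = g \<omega>" "\<omega> \<in> space M"
    and [measurable]: "f \<in> borel_measurable M"
  shows "avg (\<lambda>\<omega>'. g \<omega>' * f \<omega>') \<omega> = g \<omega> * avg f \<omega>"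
proof -
  have [measurable]: "block \<omega> \<in> sets M" using block_sets assms by simp
  have "(\<integral>\<^sup>+\<omega>'. g \<omega>' * f \<omega>' * indicator (block \<omega>) \<omega>' \<partial>M) = (\<integral>\<^sup>+\<omega>'. g \<omega> * (f \<omega>' * indicator (block \<omega>) \<omega>') \<partial>M)"
  proof (rule nn_integral_cong)
    fix \<omega>' assume "\<omega>' \<in> space M"
    then show "g \<omega>' * f \<omega>' * indicator (block \<omega>) \<omega>' = g \<omega> * (f \<omega>' * indicator (block \<omega>) \<omega>')"
      using assms(1)[of \<omega>'] by (cases "k \<omega>' = k \<omega>") (simp_all add: mult.assoc)
  qed
  also have "\<dots> = g \<omega> * (\<integral>\<^sup>+\<omega>'. f \<omega>' * indicator (block \<omega>) \<omega>' \<partial>M)"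
    by (rule nn_integral_cmult) measurable
  finally show ?thesis unfolding avg_def by (simp add: ennreal_times_divide)
qed

lemma avg_saturated:
  assumes "\<And>\<omega>'. \<omega>' \<in> space M \<Longrightarrow> k \<omega>' = k \<omega> \<Longrightarrow> g \<omega>' = g \<omega>" "\<omega> \<in> space M"
  shows "avg g \<omega> = g \<omega>"
proof -
  have "avg (\<lambda>\<omega>. 1) \<omega> = 1"
  proof -
    have "(\<integral>\<^sup>+\<omega>'. 1 * indicator (block \<omega>) \<omega>' \<partial>M) = ennreal c"
      using nn_integral_indicator[OF block_sets[OF assms(2)]] block_emeasure[OF assms(2)] by simp
    then show ?thesis
      unfolding avg_def using c_pos by (metis ennreal_divide_self ennreal_eq_0_iff ennreal_neq_top less_top not_le)
  qed
  moreover have "avg (\<lambda>\<omega>'. g \<omega>' * 1) \<omega> = g \<omega> * avg (\<lambda>\<omega>. 1) \<omega>"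
    by (rule avg_saturated_mult) (erule (1) assms(1), rule assms(2), simp)
  ultimately show ?thesis by simp
qed

lemma avg_le_bound:
  assumes "AE \<omega> in M. f \<omega> \<le> C" "\<omega> \<in> space M"
  shows "avg f \<omega> \<le> C"
proof -
  have [measurable]: "block \<omega> \<in> sets M" using block_sets assms by simp
  have "(\<integral>\<^sup>+\<omega>'. f \<omega>' * indicator (block \<omega>) \<omega>' \<partial>M) \<le> (\<integral>\<^sup>+\<omega>'. C * indicator (block \<omega>) \<omega>' \<partial>M)"
    using assms(1) by (intro nn_integral_mono_AE) (auto intro!: mult_right_mono elim!: eventually_mono)
  also have "\<dots> = C * ennreal c" using block_emeasure[OF assms(2)] by (simp add: nn_integral_cmult_indicator)
  finally have "avg f \<omega> \<le> C * ennreal c / ennreal c" unfolding avg_def by (rule divide_right_mono_ennreal)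
  also have "\<dots> = C" using c_pos by (simp add: ennreal_mult_divide_eq)
  finally show ?thesis .
qed

lemma avg_split:
  assumes [measurable]: "f \<in> borel_measurable M" "g \<in> borel_measurable M" and "\<omega> \<in> space M"
  shows "avg (\<lambda>\<omega>. f \<omega> + g \<omega>) \<omega> = avg f \<omega> + avg g \<omega>"
proof -
  have [measurable]: "block \<omega> \<in> sets M" using block_sets assms by simp
  show ?thesis unfolding avg_def
    by (simp add: distrib_right nn_integral_add add_divide_distrib_ennreal)
qed

end

section \<open>Doob's maximal inequality\<close>

lemma nn_integral_power_interval:
  assumes "-1 < a" "0 \<le> r"
  shows "(\<integral>\<^sup>+s. ennreal (s powr a) * indicator {0<..<r} s \<partial>lborel) = ennreal (r powr (a + 1) / (a + 1))"
proof -
  have "((\<lambda>s. s powr a) has_integral (r powr (a + 1) / (a + 1))) {0..r}"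
    using assms by (intro has_integral_powr_from_0) auto
  then have "((\<lambda>s. s powr a) has_integral (r powr (a + 1) / (a + 1))) {0<..<r}"
    by (simp add: has_integral_Icc_iff_Ioo)
  from nn_integral_has_integral_lebesgue[OF _ this]
  have "(\<integral>\<^sup>+s. ennreal (indicator {0<..<r} s * s powr a) \<partial>lborel) = ennreal (r powr (a + 1) / (a + 1))"
    by simp
  moreover have "ennreal (indicator {0<..<r} s * s powr a) = ennreal (s powr a) * indicator {0<..<r} s" for s
    by (auto simp: indicator_def)
  ultimately show ?thesis by simp
qed

lemma layer_cake:
  assumes p: "1 < p"
  shows "ennreal_powr x p \<le> (\<integral>\<^sup>+s. ennreal (p * s powr (p - 1)) * indicator {s. 0 < s \<and> ennreal s < x} s \<partial>lborel)"
    (is "_ \<le> ?I")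
proof -
  have fin: "ennreal (r powr p) \<le> ?I" if r: "0 \<le> r" "ennreal r \<le> x" for r
  proof -
    have "p - 1 + 1 = p" by simp
    then have "ennreal (r powr p) = ennreal p * ennreal (r powr (p - 1 + 1) / (p - 1 + 1))"
      using p by (simp add: ennreal_mult[symmetric])
    also have "\<dots> = ennreal p * (\<integral>\<^sup>+s. ennreal (s powr (p - 1)) * indicator {0<..<r} s \<partial>lborel)"
      using p r by (subst nn_integral_power_interval) simp_all
    also have "\<dots> = (\<integral>\<^sup>+s. ennreal p * (ennreal (s powr (p - 1)) * indicator {0<..<r} s) \<partial>lborel)"
      by (rule nn_integral_cmult[symmetric]) measurable
    also have "\<dots> \<le> ?I"
    proof (intro nn_integral_mono)
      fix s :: real
      show "ennreal p * (ennreal (s powr (p - 1)) * indicator {0<..<r} s)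
          \<le> ennreal (p * s powr (p - 1)) * indicator {s. 0 < s \<and> ennreal s < x} s"
      proof (cases "0 < s \<and> s < r")
        case True
        then have "ennreal s < ennreal r" by (simp add: ennreal_lessI)
        then have "ennreal s < x" using r(2) by (rule less_le_trans)
        then show ?thesis using True p by (simp add: ennreal_mult)
      qed simp
    qed
    finally show ?thesis .
  qed
  show ?thesis
  proof (cases x)
    case (real r)
    then show ?thesis using fin[of r] by (simp add: ennreal_powr_ennreal)
  next
    case top
    \<comment> \<open>If \<open>x\<close> is infinite, every level
      \<open>real n powr (1 / p)\<close> lies below it, so the integral exceeds every
      \<open>n\<close>.\<close>
    have "of_nat n \<le> ?I" for n
    proof -
      have "(of_nat n :: ennreal) = ennreal ((real n powr (1 / p)) powr p)"
        using p by (simp add: powr_powr ennreal_of_nat_eq_real_of_nat)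
      also have "\<dots> \<le> ?I"
        by (rule fin) (simp_all add: top)
      finally show ?thesis .
    qed
    then have "(SUP n. of_nat n) \<le> ?I" by (rule SUP_least)
    then have "?I = \<top>" unfolding ennreal_SUP_of_nat_eq_top by (rule top_le)
    then show ?thesis by (simp only: top_greatest)
  qed
qed

text \<open>The integral in \<open>s\<close> runs up to twice \<open>x\<close>, which is the origin
  of the factor \<open>2 powr p\<close> in \<open>doob\<close>; convergence at 0 uses
  \<open>1 < p\<close>.\<close>

lemma layer_bound:
  assumes "1 < p"
  shows "x * (\<integral>\<^sup>+s. ennreal (2 * p * s powr (p - 2)) * indicator {s. 0 < s \<and> ennreal (s / 2) < x} s \<partial>lborel)
    \<le> ennreal (2 powr p * p / (p - 1)) * ennreal_powr x p"
proof (cases x)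
  case (real r)
  have ind: "{s. 0 < s \<and> ennreal (s / 2) < x} = {0<..<2 * r}"
    using real by (auto simp: ennreal_less_iff)
  have "(\<integral>\<^sup>+s. ennreal (2 * p * s powr (p - 2)) * indicator {0<..<2 * r} s \<partial>lborel)
      = (\<integral>\<^sup>+s. ennreal (2 * p) * (ennreal (s powr (p - 2)) * indicator {0<..<2 * r} s) \<partial>lborel)"
    using assms by (intro nn_integral_cong) (simp add: ennreal_mult mult.assoc)
  also have "\<dots> = ennreal (2 * p) * ennreal ((2 * r) powr (p - 2 + 1) / (p - 2 + 1))"
    using assms real by (subst nn_integral_cmult) (simp_all add: nn_integral_power_interval)
  finally have int: "(\<integral>\<^sup>+s. ennreal (2 * p * s powr (p - 2)) * indicator {0<..<2 * r} s \<partial>lborel)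
      = ennreal (2 * p) * ennreal ((2 * r) powr (p - 2 + 1) / (p - 2 + 1))" .
  have "x * (\<integral>\<^sup>+s. ennreal (2 * p * s powr (p - 2)) * indicator {s. 0 < s \<and> ennreal (s / 2) < x} s \<partial>lborel)
      = ennreal (r * (2 * p * ((2 * r) powr (p - 1) / (p - 1))))"
    unfolding ind int using assms real by (simp add: ennreal_mult[symmetric])
  also have "r * (2 * p * ((2 * r) powr (p - 1) / (p - 1))) = 2 powr p * p / (p - 1) * r powr p"
  proof (cases "r = 0")
    case False
    then have "(2 * r) powr (p - 1) = 2 powr p * r powr p / (2 * r)"
      using real by (simp add: powr_diff powr_mult)
    then show ?thesis using False by (simp add: field_simps)
  qed simp
  also have "ennreal \<dots> = ennreal (2 powr p * p / (p - 1)) * ennreal_powr x p"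
    using real assms by (simp add: ennreal_powr_ennreal ennreal_mult[symmetric])
  finally show ?thesis by simp
next
  case top
  then show ?thesis using assms by (simp add: ennreal_powr_def ennreal_mult_top)
qed

locale partition_chain =
  fixes M :: "'w measure" and I :: "'i::linorder set" and \<kappa> :: "'i \<Rightarrow> 'w \<Rightarrow> 'v" and c :: "'i \<Rightarrow> real"
  assumes finite_I: "finite I"
    and partition: "i \<in> I \<Longrightarrow> uniform_partition M (\<kappa> i) (c i)"
    and nested: "i \<in> I \<Longrightarrow> j \<in> I \<Longrightarrow> i \<le> j \<Longrightarrow> \<omega> \<in> space M \<Longrightarrow> \<omega>' \<in> space M \<Longrightarrow>
      \<kappa> j \<omega> = \<kappa> j \<omega>' \<Longrightarrow> \<kappa> i \<omega> = \<kappa> i \<omega>'"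
begin

abbreviation av :: "'i \<Rightarrow> ('w \<Rightarrow> ennreal) \<Rightarrow> 'w \<Rightarrow> ennreal" where
  "av i \<equiv> uniform_partition.avg M (\<kappa> i) (c i)"

definition maxf :: "('w \<Rightarrow> ennreal) \<Rightarrow> 'w \<Rightarrow> ennreal" where
  "maxf f \<omega> = (SUP i\<in>I. av i f \<omega>)"

lemma av_measurable [measurable]: "i \<in> I \<Longrightarrow> av i f \<in> borel_measurable M"
  by (rule uniform_partition.avg_measurable[OF partition])

lemma maxf_measurable [measurable]: "maxf f \<in> borel_measurable M"
  unfolding maxf_def[abs_def] using finite_I by (intro borel_measurable_SUP) (auto intro: countable_finite)

text \<open>Stopping at the first index whose average exceeds \<open>s\<close> cuts the set into
  pieces \<open>B i\<close>. Earlier averages are constant on blocks of \<open>\<kappa> i\<close>,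
  so \<open>B i\<close> is a union of such blocks, and the average can be moved from
  \<open>f\<close> to the indicator, where it has no effect.\<close>

lemma weak_type:
  assumes [measurable]: "f \<in> borel_measurable M"
  shows "s * emeasure M {\<omega> \<in> space M. s < maxf f \<omega>} \<le> (\<integral>\<^sup>+\<omega>. f \<omega> \<partial>M)"
proof -
  define B where "B i = {\<omega> \<in> space M. s < av i f \<omega> \<and> (\<forall>j\<in>{j\<in>I. j < i}. av j f \<omega> \<le> s)}" for i
  have Bm [measurable]: "B i \<in> sets M" if [simp]: "i \<in> I" for i
  proof -
    have "{\<omega> \<in> space M. av j f \<omega> \<le> s} \<in> sets M" if "j \<in> I" for j
      using av_measurable[OF that, of f] by measurable
    moreover have "{\<omega> \<in> space M. s < av i f \<omega>} \<in> sets M" by measurable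
    ultimately show ?thesis
      unfolding B_def using finite_I by (intro sets.sets_Collect_conj sets.sets_Collect_finite_All) auto
  qed
  have disj: "disjoint_family_on B I"
    unfolding disjoint_family_on_def
  proof (intro ballI impI)
    fix i j assume "i \<in> I" "j \<in> I" "i \<noteq> j"
    then show "B i \<inter> B j = {}" unfolding B_def by (cases i j rule: linorder_cases) fastforce+
  qed
  have cover: "{\<omega> \<in> space M. s < maxf f \<omega>} = (\<Union>i\<in>I. B i)"
  proof (intro equalityI subsetI)
    fix \<omega> assume \<omega>: "\<omega> \<in> {\<omega> \<in> space M. s < maxf f \<omega>}"
    define J where "J = {i\<in>I. s < av i f \<omega>}"
    have "finite J" "J \<noteq> {}" using finite_I \<omega> by (auto simp: J_def maxf_def less_SUP_iff)
    then have "Min J \<in> J" "\<And>j. j \<in> I \<Longrightarrow> j < Min J \<Longrightarrow> j \<notin> J" by (auto dest: Min_le)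
    then have "\<omega> \<in> B (Min J)" "Min J \<in> I" using \<omega> by (auto simp: B_def J_def not_less)
    then show "\<omega> \<in> (\<Union>i\<in>I. B i)" by blast
  qed (auto simp: B_def maxf_def less_SUP_iff)
  have one: "s * emeasure M (B i) \<le> (\<integral>\<^sup>+\<omega>. f \<omega> * indicator (B i) \<omega> \<partial>M)" if i: "i \<in> I" for i
  proof -
    interpret uniform_partition M "\<kappa> i" "c i" by (rule partition[OF i])
    have [measurable]: "B i \<in> sets M" by (rule Bm[OF i])
    have "s * emeasure M (B i) = (\<integral>\<^sup>+\<omega>. s * indicator (B i) \<omega> \<partial>M)"
      by (simp add: nn_integral_cmult_indicator)
    also have "\<dots> \<le> (\<integral>\<^sup>+\<omega>. indicator (B i) \<omega> * av i f \<omega> \<partial>M)"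
      by (intro nn_integral_mono) (auto simp: indicator_def B_def less_imp_le)
    also have "\<dots> = (\<integral>\<^sup>+\<omega>. av i (indicator (B i)) \<omega> * f \<omega> \<partial>M)"
      by (rule avg_adjoint) measurable
    also have "\<dots> = (\<integral>\<^sup>+\<omega>. f \<omega> * indicator (B i) \<omega> \<partial>M)"
    proof (intro nn_integral_cong)
      fix \<omega> assume \<omega>: "\<omega> \<in> space M"
      have "av i (indicator (B i)) \<omega> = indicator (B i) \<omega>"
      proof (rule avg_saturated[OF _ \<omega>])
        fix \<omega>' assume \<omega>': "\<omega>' \<in> space M" "\<kappa> i \<omega>' = \<kappa> i \<omega>"
        have "av j f \<omega>' = av j f \<omega>" if "j \<in> I" "j \<le> i" for j
          using uniform_partition.avg_cong[OF partition[OF that(1)]] nested[OF that(1) i that(2) \<omega>'(1) \<omega> \<omega>'(2)] by blast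
        then show "indicator (B i) \<omega>' = (indicator (B i) \<omega> :: ennreal)"
          using \<omega> \<omega>' i by (auto simp: B_def indicator_def)
      qed
      then show "av i (indicator (B i)) \<omega> * f \<omega> = f \<omega> * indicator (B i) \<omega>" by (simp add: mult.commute)
    qed
    finally show ?thesis .
  qed
  have "s * emeasure M {\<omega> \<in> space M. s < maxf f \<omega>} = (\<Sum>i\<in>I. s * emeasure M (B i))"
    unfolding cover using finite_I disj Bm by (subst sum_emeasure[symmetric]) (auto simp: sum_distrib_left)
  also have "\<dots> \<le> (\<Sum>i\<in>I. \<integral>\<^sup>+\<omega>. f \<omega> * indicator (B i) \<omega> \<partial>M)" by (rule sum_mono) (rule one)
  also have "\<dots> = (\<integral>\<^sup>+\<omega>. (\<Sum>i\<in>I. f \<omega> * indicator (B i) \<omega>) \<partial>M)"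
    by (rule nn_integral_sum[symmetric]) (use Bm in measurable)
  also have "\<dots> \<le> (\<integral>\<^sup>+\<omega>. f \<omega> \<partial>M)"
  proof (intro nn_integral_mono)
    fix \<omega>
    have "(\<Sum>i\<in>I. indicator (B i) \<omega>) = (indicator (\<Union>i\<in>I. B i) \<omega> :: ennreal)"
      using finite_I disj by (rule indicator_UN_disjoint[symmetric])
    then show "(\<Sum>i\<in>I. f \<omega> * indicator (B i) \<omega>) \<le> f \<omega>"
      by (simp add: sum_distrib_left[symmetric] indicator_def)
  qed
  finally show ?thesis .
qed

text \<open>The part of \<open>f\<close> up to the level \<open>s / 2\<close> contributes at most
  \<open>s / 2\<close> to any average, so the other part accounts for the rest. This cut makes the
  later integral over \<open>s\<close> converge.\<close>

lemma weak_type_truncated: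
  assumes [measurable]: "f \<in> borel_measurable M" and s: "0 < s"
  shows "emeasure M {\<omega> \<in> space M. ennreal s < maxf f \<omega>} \<le>
    ennreal (2 / s) * (\<integral>\<^sup>+\<omega>. f \<omega> * indicator {\<omega>. ennreal (s / 2) < f \<omega>} \<omega> \<partial>M)"
proof -
  define g where "g \<omega> = f \<omega> * indicator {\<omega>. ennreal (s / 2) < f \<omega>} \<omega>" for \<omega>
  have [measurable]: "g \<in> borel_measurable M" unfolding g_def by measurable
  have le: "maxf f \<omega> \<le> ennreal (s / 2) + maxf g \<omega>" if \<omega>: "\<omega> \<in> space M" for \<omega>
    unfolding maxf_def
  proof (rule SUP_least)
    fix i assume i: "i \<in> I"
    interpret uniform_partition M "\<kappa> i" "c i" by (rule partition[OF i])
    have "av i f \<omega> \<le> av i (\<lambda>\<omega>. ennreal (s / 2) + g \<omega>) \<omega>"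
      by (rule avg_mono) (auto simp: g_def indicator_def not_less add_increasing)
    also have "\<dots> = av i (\<lambda>\<omega>. ennreal (s / 2)) \<omega> + av i g \<omega>"
      by (rule avg_split) (use \<omega> in measurable)
    also have "av i (\<lambda>\<omega>. ennreal (s / 2)) \<omega> = ennreal (s / 2)"
      by (rule avg_saturated) (use \<omega> in auto)
    also have "av i g \<omega> \<le> (SUP i\<in>I. av i g \<omega>)" by (rule SUP_upper[OF i])
    finally show "av i f \<omega> \<le> ennreal (s / 2) + (SUP i\<in>I. av i g \<omega>)" by (simp add: add_left_mono)
  qed
  have half: "ennreal s = ennreal (s / 2) + ennreal (s / 2)" using s by (simp add: ennreal_plus[symmetric])
  have "{\<omega> \<in> space M. ennreal s < maxf f \<omega>} \<subseteq> {\<omega> \<in> space M. ennreal (s / 2) < maxf g \<omega>}"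
  proof safe
    fix \<omega> assume \<omega>: "\<omega> \<in> space M" "ennreal s < maxf f \<omega>"
    show "ennreal (s / 2) < maxf g \<omega>"
    proof (rule ccontr)
      assume "\<not> ennreal (s / 2) < maxf g \<omega>"
      then have "ennreal (s / 2) + maxf g \<omega> \<le> ennreal s" unfolding half by (intro add_left_mono) simp
      with le[OF \<omega>(1)] have "maxf f \<omega> \<le> ennreal s" by (rule order_trans)
      with \<omega>(2) show False by simp
    qed
  qed
  then have "emeasure M {\<omega> \<in> space M. ennreal s < maxf f \<omega>} \<le> emeasure M {\<omega> \<in> space M. ennreal (s / 2) < maxf g \<omega>}"
    by (rule emeasure_mono) measurable
  also have "\<dots> = ennreal (2 / s) * (ennreal (s / 2) * emeasure M {\<omega> \<in> space M. ennreal (s / 2) < maxf g \<omega>})"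
    using s by (simp add: mult.assoc[symmetric] ennreal_mult[symmetric])
  also have "\<dots> \<le> ennreal (2 / s) * (\<integral>\<^sup>+\<omega>. g \<omega> \<partial>M)"
    by (intro mult_left_mono weak_type) auto
  finally show ?thesis by (simp add: g_def)
qed

text \<open>Marcinkiewicz interpolation between the weak-type bound and the trivial bound by the
  supremum: integrate the truncated estimate over all levels and exchange the integrals.\<close>

theorem doob:
  assumes [measurable]: "f \<in> borel_measurable M" and p: "1 < p" and ne: "sigma_finite_measure M"
  shows "(\<integral>\<^sup>+\<omega>. ennreal_powr (maxf f \<omega>) p \<partial>M) \<le>
    ennreal (2 powr p * p / (p - 1)) * (\<integral>\<^sup>+\<omega>. ennreal_powr (f \<omega>) p \<partial>M)"
proof -
  interpret sigma_finite_measure M by (rule ne)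
  interpret pair_sigma_finite M lborel ..
  have "(\<integral>\<^sup>+\<omega>. ennreal_powr (maxf f \<omega>) p \<partial>M) \<le>
      (\<integral>\<^sup>+\<omega>. (\<integral>\<^sup>+s. ennreal (p * s powr (p - 1)) * indicator {s. 0 < s \<and> ennreal s < maxf f \<omega>} s \<partial>lborel) \<partial>M)"
    by (intro nn_integral_mono layer_cake p)
  also have "\<dots> = (\<integral>\<^sup>+s. (\<integral>\<^sup>+\<omega>. ennreal (p * s powr (p - 1)) * indicator {s. 0 < s \<and> ennreal s < maxf f \<omega>} s \<partial>M) \<partial>lborel)"
    by (rule Fubini'[symmetric]) (simp add: indicator_def[abs_def], measurable)
  also have "\<dots> \<le> (\<integral>\<^sup>+s. (\<integral>\<^sup>+\<omega>. f \<omega> * (ennreal (2 * p * s powr (p - 2)) * indicator {s. 0 < s \<and> ennreal (s / 2) < f \<omega>} s) \<partial>M) \<partial>lborel)"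
  proof (rule nn_integral_mono)
    fix s :: real
    show "(\<integral>\<^sup>+\<omega>. ennreal (p * s powr (p - 1)) * indicator {s. 0 < s \<and> ennreal s < maxf f \<omega>} s \<partial>M)
      \<le> (\<integral>\<^sup>+\<omega>. f \<omega> * (ennreal (2 * p * s powr (p - 2)) * indicator {s. 0 < s \<and> ennreal (s / 2) < f \<omega>} s) \<partial>M)"
    proof (cases "0 < s")
      case True
      have "(\<integral>\<^sup>+\<omega>. ennreal (p * s powr (p - 1)) * indicator {s. 0 < s \<and> ennreal s < maxf f \<omega>} s \<partial>M)
        = (\<integral>\<^sup>+\<omega>. ennreal (p * s powr (p - 1)) * indicator {\<omega> \<in> space M. ennreal s < maxf f \<omega>} \<omega> \<partial>M)"
        using True by (intro nn_integral_cong) (auto simp: indicator_def)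
      also have "\<dots> = ennreal (p * s powr (p - 1)) * emeasure M {\<omega> \<in> space M. ennreal s < maxf f \<omega>}"
        by (rule nn_integral_cmult_indicator) measurable
      also have "\<dots> \<le> ennreal (p * s powr (p - 1)) *
          (ennreal (2 / s) * (\<integral>\<^sup>+\<omega>. f \<omega> * indicator {\<omega>. ennreal (s / 2) < f \<omega>} \<omega> \<partial>M))"
        by (intro mult_left_mono weak_type_truncated True) auto
      also have "\<dots> = ennreal (2 * p * s powr (p - 2)) * (\<integral>\<^sup>+\<omega>. f \<omega> * indicator {\<omega>. ennreal (s / 2) < f \<omega>} \<omega> \<partial>M)"
      proof -
        have "s powr (p - 1) = s * s powr (p - 2)"
          using True powr_mult_base[of s "p - 2"] by (simp add: algebra_simps)
        then have "p * s powr (p - 1) * (2 / s) = 2 * p * s powr (p - 2)" using True by simp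
        then show ?thesis using True p by (simp add: mult.assoc[symmetric] ennreal_mult[symmetric])
      qed
      also have "\<dots> = (\<integral>\<^sup>+\<omega>. ennreal (2 * p * s powr (p - 2)) * (f \<omega> * indicator {\<omega>. ennreal (s / 2) < f \<omega>} \<omega>) \<partial>M)"
        by (rule nn_integral_cmult[symmetric]) measurable
      also have "\<dots> = (\<integral>\<^sup>+\<omega>. f \<omega> * (ennreal (2 * p * s powr (p - 2)) * indicator {s. 0 < s \<and> ennreal (s / 2) < f \<omega>} s) \<partial>M)"
        using True by (intro nn_integral_cong) (auto simp: indicator_def mult_ac)
      finally show ?thesis .
    qed simp
  qed
  also have "\<dots> = (\<integral>\<^sup>+\<omega>. (\<integral>\<^sup>+s. f \<omega> * (ennreal (2 * p * s powr (p - 2)) * indicator {s. 0 < s \<and> ennreal (s / 2) < f \<omega>} s) \<partial>lborel) \<partial>M)"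
    by (rule Fubini') (simp add: indicator_def[abs_def], measurable)
  also have "\<dots> \<le> (\<integral>\<^sup>+\<omega>. ennreal (2 powr p * p / (p - 1)) * ennreal_powr (f \<omega>) p \<partial>M)"
  proof (rule nn_integral_mono)
    fix \<omega>
    have "(\<integral>\<^sup>+s. f \<omega> * (ennreal (2 * p * s powr (p - 2)) * indicator {s. 0 < s \<and> ennreal (s / 2) < f \<omega>} s) \<partial>lborel)
      = f \<omega> * (\<integral>\<^sup>+s. ennreal (2 * p * s powr (p - 2)) * indicator {s. 0 < s \<and> ennreal (s / 2) < f \<omega>} s \<partial>lborel)"
      by (rule nn_integral_cmult) measurable
    also have "\<dots> \<le> ennreal (2 powr p * p / (p - 1)) * ennreal_powr (f \<omega>) p" by (rule layer_bound[OF p])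
    finally show "(\<integral>\<^sup>+s. f \<omega> * (ennreal (2 * p * s powr (p - 2)) * indicator {s. 0 < s \<and> ennreal (s / 2) < f \<omega>} s) \<partial>lborel)
      \<le> ennreal (2 powr p * p / (p - 1)) * ennreal_powr (f \<omega>) p" .
  qed
  also have "\<dots> = ennreal (2 powr p * p / (p - 1)) * (\<integral>\<^sup>+\<omega>. ennreal_powr (f \<omega>) p \<partial>M)"
    by (rule nn_integral_cmult) measurable
  finally show ?thesis .
qed

end

section \<open>Two-parameter partitions\<close>

text \<open>Turns upper bounds from the geometry into exact counts: a prescribed total mass leaves
  no slack.\<close>

lemma sum_saturated:
  fixes a :: "'l \<Rightarrow> real"
  assumes "finite L" "card L \<le> q" "\<And>l. l \<in> L \<Longrightarrow> a l \<le> A" "sum a L = real q * A" "0 < A"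
  shows "card L = q" "\<And>l. l \<in> L \<Longrightarrow> a l = A"
proof -
  have "real q * A \<le> real (card L) * A" using sum_bounded_above[of L a A] assms by simp
  then show card: "card L = q" using assms(2,5) by simp
  show "a l = A" if "l \<in> L" for l
  proof (rule ccontr)
    assume "a l \<noteq> A"
    then have "sum a L < sum (\<lambda>_. A) L" using assms that by (intro sum_strict_mono_ex1) (auto simp: less_le)
    then show False using assms(4) card by simp
  qed
qed

text \<open>
  The label \<open>x n m \<omega>\<close> is the vertex over \<open>weight n m\<close> of the apartment joining \<open>\<omega>\<close> to \<open>\<omega>0\<close>.  In the
  link of \<open>x n m \<omega>\<close>, the labels \<open>x n (m + 1)\<close> behave as points and \<open>x (n + 1) m\<close> as lines.
\<close>

locale two_parameter =
  fixes M :: "'w measure" and x :: "int \<Rightarrow> int \<Rightarrow> 'w \<Rightarrow> 'v" and q :: nat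
  assumes q2: "2 \<le> q"
    and block_sets: "\<omega> \<in> space M \<Longrightarrow> {\<omega>' \<in> space M. x n m \<omega>' = x n m \<omega>} \<in> sets M"
    and block_emeasure: "\<omega> \<in> space M \<Longrightarrow>
      emeasure M {\<omega>' \<in> space M. x n m \<omega>' = x n m \<omega>} = ennreal (real q powi (- 2 * (n + m)))"
    and mono1: "\<omega> \<in> space M \<Longrightarrow> \<omega>' \<in> space M \<Longrightarrow> x (n + 1) m \<omega> = x (n + 1) m \<omega>' \<Longrightarrow> x n m \<omega> = x n m \<omega>'"
    and mono2: "\<omega> \<in> space M \<Longrightarrow> \<omega>' \<in> space M \<Longrightarrow> x n (m + 1) \<omega> = x n (m + 1) \<omega>' \<Longrightarrow> x n m \<omega> = x n m \<omega>'"
    and tail: "\<omega> \<in> space M \<Longrightarrow> \<omega>' \<in> space M \<Longrightarrow> \<exists>k. x k k \<omega> = x k k \<omega>'"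
    and fiber: "\<omega> \<in> space M \<Longrightarrow>
      finite (x (n + 1) (m + 1) ` {\<omega>' \<in> space M. x (n + 1) m \<omega>' = x (n + 1) m \<omega> \<and> x n (m + 1) \<omega>' = x n (m + 1) \<omega>}) \<and>
      card (x (n + 1) (m + 1) ` {\<omega>' \<in> space M. x (n + 1) m \<omega>' = x (n + 1) m \<omega> \<and> x n (m + 1) \<omega>' = x n (m + 1) \<omega>}) \<le> q"
    and fiber1: "\<omega> \<in> space M \<Longrightarrow> finite (x n (m + 1) ` {\<omega>' \<in> space M. x (n + 1) m \<omega>' = x (n + 1) m \<omega>}) \<and>
      card (x n (m + 1) ` {\<omega>' \<in> space M. x (n + 1) m \<omega>' = x (n + 1) m \<omega>}) \<le> q"
    and fiber2: "\<omega> \<in> space M \<Longrightarrow> finite (x (n + 1) m ` {\<omega>' \<in> space M. x n (m + 1) \<omega>' = x n (m + 1) \<omega>}) \<and>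
      card (x (n + 1) m ` {\<omega>' \<in> space M. x n (m + 1) \<omega>' = x n (m + 1) \<omega>}) \<le> q"
    and girth: "\<omega>1 \<in> space M \<Longrightarrow> \<omega>2 \<in> space M \<Longrightarrow> \<omega>3 \<in> space M \<Longrightarrow> \<omega>4 \<in> space M \<Longrightarrow>
      x n (m + 1) \<omega>1 = x n (m + 1) \<omega>2 \<Longrightarrow> x n (m + 1) \<omega>3 = x n (m + 1) \<omega>4 \<Longrightarrow>
      x (n + 1) m \<omega>1 = x (n + 1) m \<omega>3 \<Longrightarrow> x (n + 1) m \<omega>2 = x (n + 1) m \<omega>4 \<Longrightarrow>
      x n (m + 1) \<omega>1 = x n (m + 1) \<omega>3 \<or> x (n + 1) m \<omega>1 = x (n + 1) m \<omega>2"
    and rigid1: "\<omega> \<in> space M \<Longrightarrow> \<omega>' \<in> space M \<Longrightarrow> x n (m + 1) \<omega> = x n (m + 1) \<omega>' \<Longrightarrow>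
      x (n + 2) m \<omega> = x (n + 2) m \<omega>' \<Longrightarrow> x (n + 1) (m + 1) \<omega> = x (n + 1) (m + 1) \<omega>'"
    and rigid2: "\<omega> \<in> space M \<Longrightarrow> \<omega>' \<in> space M \<Longrightarrow> x (n + 1) m \<omega> = x (n + 1) m \<omega>' \<Longrightarrow>
      x n (m + 2) \<omega> = x n (m + 2) \<omega>' \<Longrightarrow> x (n + 1) (m + 1) \<omega> = x (n + 1) (m + 1) \<omega>'"
begin

definition B :: "int \<Rightarrow> int \<Rightarrow> 'w \<Rightarrow> 'w set" where
  "B n m \<omega> = {\<omega>' \<in> space M. x n m \<omega>' = x n m \<omega>}"

definition s :: "int \<Rightarrow> int \<Rightarrow> real" where
  "s n m = real q powi (- 2 * (n + m))"

lemma q_pos: "0 < real q" and q_gt1: "1 < real q" using q2 by auto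

lemma s_pos [simp]: "0 < s n m" using q_pos by (simp add: s_def)

lemma s_nonneg [simp]: "0 \<le> s n m" using s_pos[of n m] by linarith

lemma s_step: "s (n + 1) m = s n m / real q ^ 2" "s n (m + 1) = s n m / real q ^ 2"
proof -
  have "real q powi (- 2 * (n + m) - 2) = real q powi (- 2 * (n + m)) / real q ^ 2"
    using q_pos by (simp add: power_int_diff)
  moreover have "- 2 * (n + 1 + m) = - 2 * (n + m) - 2" "- 2 * (n + (m + 1)) = - 2 * (n + m) - 2" by simp_all
  ultimately show "s (n + 1) m = s n m / real q ^ 2" "s n (m + 1) = s n m / real q ^ 2"
    unfolding s_def by (simp_all only:)
qed

lemma s_diag: "real q * s (n + 1) (m + 1) = s n m / real q ^ 3"
proof -
  have "s (n + 1) (m + 1) = s n m / real q ^ 2 / real q ^ 2" unfolding s_step(1) s_step(2) ..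
  then show ?thesis using q_pos by (simp add: power2_eq_square power3_eq_cube)
qed

lemma B_sets [measurable]: "\<omega> \<in> space M \<Longrightarrow> B n m \<omega> \<in> sets M"
  unfolding B_def by (rule block_sets)

lemma B_emeasure: "\<omega> \<in> space M \<Longrightarrow> emeasure M (B n m \<omega>) = ennreal (s n m)"
  unfolding B_def s_def by (rule block_emeasure)

lemma B_measure: "\<omega> \<in> space M \<Longrightarrow> measure M (B n m \<omega>) = s n m"
  by (simp add: measure_def B_emeasure)

lemma B_fmeasurable: "\<omega> \<in> space M \<Longrightarrow> B n m \<omega> \<in> fmeasurable M"
  by (intro fmeasurableI) (auto simp: B_emeasure)

lemma B_self: "\<omega> \<in> space M \<Longrightarrow> \<omega> \<in> B n m \<omega>" by (simp add: B_def)

lemma B_mem: "\<omega>' \<in> B n m \<omega> \<longleftrightarrow> \<omega>' \<in> space M \<and> x n m \<omega>' = x n m \<omega>" by (simp add: B_def)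

lemma mono:
  assumes "\<omega> \<in> space M" "\<omega>' \<in> space M" "x n m \<omega> = x n m \<omega>'" "i \<le> n" "j \<le> m"
  shows "x i j \<omega> = x i j \<omega>'"
proof -
  have "x i m \<omega> = x i m \<omega>'" using assms(4)
  proof (induction i rule: int_le_induct)
    case (step i)
    then show ?case using mono1[OF assms(1,2), of "i - 1" m] by simp
  qed (rule assms(3))
  with assms(5) show ?thesis
  proof (induction j rule: int_le_induct)
    case (step j)
    then show ?case using mono2[OF assms(1,2), of i "j - 1"] by simp
  qed simp
qed

section \<open>Counting blocks by their masses\<close>

lemma measure_partition:
  assumes E: "E \<in> fmeasurable M" and L: "finite L" "f ` E \<subseteq> L"
    and meas: "\<And>l. l \<in> L \<Longrightarrow> {\<omega> \<in> E. f \<omega> = l} \<in> sets M"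
  shows "measure M E = (\<Sum>l\<in>L. measure M {\<omega> \<in> E. f \<omega> = l})"
proof -
  have "E = (\<Union>l\<in>L. {\<omega> \<in> E. f \<omega> = l})" using L by auto
  then have "measure M E = measure M (\<Union>l\<in>L. {\<omega> \<in> E. f \<omega> = l})" by simp
  also have "\<dots> = (\<Sum>l\<in>L. measure M {\<omega> \<in> E. f \<omega> = l})"
  proof (rule measure_UNION'[OF L(1)])
    show "{\<omega> \<in> E. f \<omega> = l} \<in> fmeasurable M" if "l \<in> L" for l
      by (rule fmeasurableI2[OF E _ meas[OF that]]) blast
  qed (auto simp: pairwise_def disjnt_def)
  finally show ?thesis .
qed

lemma card_blocks:
  assumes E: "E \<in> fmeasurable M" and sat: "\<And>\<omega>. \<omega> \<in> E \<Longrightarrow> B n m \<omega> \<subseteq> E"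
  shows "finite (x n m ` E)" "measure M E = real (card (x n m ` E)) * s n m"
proof -
  have sp: "E \<subseteq> space M" using E by (auto dest: fmeasurableD sets.sets_into_space)
  have part: "{\<omega> \<in> E. x n m \<omega> = x n m \<omega>0} = B n m \<omega>0" if "\<omega>0 \<in> E" for \<omega>0
    using sat[OF that] sp that by (auto simp: B_def)
  \<comment> \<open>Finite sets of labels come first: finiteness of all labels has to be known
    before the mass of \<open>E\<close> can be written as a finite sum.\<close>
  have bound: "real (card F) * s n m \<le> measure M E" if F: "finite F" "F \<subseteq> x n m ` E" for F
  proof -
    define D where "D = {\<omega> \<in> E. x n m \<omega> \<in> F}"
    have eq: "D = (\<Union>l\<in>F. {\<omega> \<in> E. x n m \<omega> = l})" by (auto simp: D_def)
    have m: "{\<omega> \<in> E. x n m \<omega> = l} \<in> sets M \<and> measure M {\<omega> \<in> E. x n m \<omega> = l} = s n m" if l: "l \<in> F" for l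
    proof -
      obtain \<omega>0 where w: "\<omega>0 \<in> E" "l = x n m \<omega>0" using F(2) l by blast
      then show ?thesis unfolding w(2) part[OF w(1)] using sp by (simp add: subsetD B_measure)
    qed
    have "D \<in> sets M" unfolding eq using F m by (intro sets.finite_UN) auto
    then have D: "D \<in> fmeasurable M" by (intro fmeasurableI2[OF E]) (auto simp: D_def)
    have DF: "{\<omega> \<in> D. x n m \<omega> = l} = {\<omega> \<in> E. x n m \<omega> = l}" if "l \<in> F" for l
      using that by (auto simp: D_def)
    have "measure M D = (\<Sum>l\<in>F. measure M {\<omega> \<in> D. x n m \<omega> = l})"
      using F m DF by (intro measure_partition[OF D]) (auto simp: D_def)
    also have "\<dots> = real (card F) * s n m" using m DF by simp
    finally have "real (card F) * s n m = measure M D" by simp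
    also have "\<dots> \<le> measure M E" using E D by (intro measure_mono_fmeasurable) (auto simp: D_def)
    finally show ?thesis .
  qed
  show fin: "finite (x n m ` E)"
  proof (rule ccontr)
    assume inf: "infinite (x n m ` E)"
    obtain N :: nat where "measure M E / s n m < real N" using reals_Archimedean2 by blast
    then have N: "measure M E < real N * s n m" by (simp add: pos_divide_less_eq)
    obtain F where "finite F" "card F = N" "F \<subseteq> x n m ` E" using infinite_arbitrarily_large[OF inf] by blast
    with bound[of F] N show False by simp
  qed
  have "measure M {\<omega> \<in> E. x n m \<omega> = l} = s n m \<and> {\<omega> \<in> E. x n m \<omega> = l} \<in> sets M" if l: "l \<in> x n m ` E" for l
  proof -
    obtain \<omega>0 where w: "\<omega>0 \<in> E" "l = x n m \<omega>0" using l by blast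
    then show ?thesis unfolding w(2) part[OF w(1)] using sp by (simp add: subsetD B_measure)
  qed
  then show "measure M E = real (card (x n m ` E)) * s n m"
    using measure_partition[OF E fin order_refl] by simp
qed

text \<open>By \<open>tail\<close> and monotonicity, every label is attained in the block of a fixed
  \<open>\<omega>0\<close> over some \<open>(b, b)\<close> with \<open>b\<close> small enough. Such
  a block has finite mass, hence only finitely many labels over \<open>(n, m)\<close>.\<close>

lemma countable_labels: "countable (x n m ` space M)"
proof (cases "space M = {}")
  case False
  then obtain \<omega>0 where \<omega>0: "\<omega>0 \<in> space M" by blast
  define b where "b i = min n m - int i" for i
  have sub: "x n m ` space M \<subseteq> (\<Union>i. x n m ` B (b i) (b i) \<omega>0)"
  proof
    fix l assume "l \<in> x n m ` space M"
    then obtain \<omega> where w: "\<omega> \<in> space M" "l = x n m \<omega>" by blast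
    obtain k where k: "x k k \<omega> = x k k \<omega>0" using tail[OF w(1) \<omega>0] by blast
    define i where "i = nat (min n m - k)"
    have "b i \<le> k" unfolding b_def i_def by linarith
    then have "x (b i) (b i) \<omega> = x (b i) (b i) \<omega>0" by (intro mono[OF w(1) \<omega>0 k])
    then have "\<omega> \<in> B (b i) (b i) \<omega>0" using w(1) by (simp add: B_mem)
    then show "l \<in> (\<Union>i. x n m ` B (b i) (b i) \<omega>0)" using w by blast
  qed
  have fin: "finite (x n m ` B (b i) (b i) \<omega>0)" for i
  proof (rule card_blocks(1)[OF B_fmeasurable[OF \<omega>0]])
    fix \<omega> assume w: "\<omega> \<in> B (b i) (b i) \<omega>0"
    show "B n m \<omega> \<subseteq> B (b i) (b i) \<omega>0"
    proof
      fix \<omega>' assume w': "\<omega>' \<in> B n m \<omega>"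
      then have "x n m \<omega>' = x n m \<omega>" "\<omega>' \<in> space M" "\<omega> \<in> space M" using w by (simp_all add: B_mem)
      then have "x (b i) (b i) \<omega>' = x (b i) (b i) \<omega>"
        using mono[of \<omega>' \<omega> n m "b i" "b i"] by (simp add: b_def)
      then show "\<omega>' \<in> B (b i) (b i) \<omega>0" using w w' unfolding B_mem by simp
    qed
  qed
  have "countable (\<Union>i. x n m ` B (b i) (b i) \<omega>0)" by (rule countable_UN[OF countableI_type countable_finite[OF fin]])
  with sub show ?thesis by (rule countable_subset)
qed simp

lemma uniform_partition: "uniform_partition M (x n m) (s n m)"
  unfolding s_def by standard (use block_sets block_emeasure countable_labels q_pos in simp_all)

text \<open>The axioms are symmetric under exchange of the two fundamental weights, that is, of
  points and lines in the links; each counting lemma thus serves twice.\<close>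

lemma transposed: "two_parameter M (\<lambda>n m. x m n) q"
proof
  show "2 \<le> q" by (rule q2)
next
  fix \<omega> n m assume w: "\<omega> \<in> space M"
  show "{\<omega>' \<in> space M. x m n \<omega>' = x m n \<omega>} \<in> sets M" by (rule block_sets[OF w])
  show "emeasure M {\<omega>' \<in> space M. x m n \<omega>' = x m n \<omega>} = ennreal (real q powi (- 2 * (n + m)))"
    using block_emeasure[OF w, of m n] by (simp only: add.commute)
  show "finite (x (m + 1) (n + 1) ` {\<omega>' \<in> space M. x m (n + 1) \<omega>' = x m (n + 1) \<omega> \<and> x (m + 1) n \<omega>' = x (m + 1) n \<omega>}) \<and>
      card (x (m + 1) (n + 1) ` {\<omega>' \<in> space M. x m (n + 1) \<omega>' = x m (n + 1) \<omega> \<and> x (m + 1) n \<omega>' = x (m + 1) n \<omega>}) \<le> q"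
    using fiber[OF w, of m n] by (simp only: conj_ac)
  show "finite (x (m + 1) n ` {\<omega>' \<in> space M. x m (n + 1) \<omega>' = x m (n + 1) \<omega>}) \<and>
      card (x (m + 1) n ` {\<omega>' \<in> space M. x m (n + 1) \<omega>' = x m (n + 1) \<omega>}) \<le> q"
    by (rule fiber2[OF w])
  show "finite (x m (n + 1) ` {\<omega>' \<in> space M. x (m + 1) n \<omega>' = x (m + 1) n \<omega>}) \<and>
      card (x m (n + 1) ` {\<omega>' \<in> space M. x (m + 1) n \<omega>' = x (m + 1) n \<omega>}) \<le> q"
    by (rule fiber1[OF w])
next
  fix \<omega> \<omega>' n m assume w: "\<omega> \<in> space M" "\<omega>' \<in> space M"
  show "\<exists>k. x k k \<omega> = x k k \<omega>'" by (rule tail[OF w])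
  show "x m n \<omega> = x m n \<omega>'" if "x m (n + 1) \<omega> = x m (n + 1) \<omega>'" by (rule mono2[OF w that])
  show "x m n \<omega> = x m n \<omega>'" if "x (m + 1) n \<omega> = x (m + 1) n \<omega>'" by (rule mono1[OF w that])
  show "x (m + 1) (n + 1) \<omega> = x (m + 1) (n + 1) \<omega>'"
    if "x (m + 1) n \<omega> = x (m + 1) n \<omega>'" "x m (n + 2) \<omega> = x m (n + 2) \<omega>'"
    by (rule rigid2[OF w that])
  show "x (m + 1) (n + 1) \<omega> = x (m + 1) (n + 1) \<omega>'"
    if "x m (n + 1) \<omega> = x m (n + 1) \<omega>'" "x (m + 2) n \<omega> = x (m + 2) n \<omega>'"
    by (rule rigid1[OF w that])
next
  fix \<omega>1 \<omega>2 \<omega>3 \<omega>4 n m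
  assume *: "\<omega>1 \<in> space M" "\<omega>2 \<in> space M" "\<omega>3 \<in> space M" "\<omega>4 \<in> space M"
      "x (m + 1) n \<omega>1 = x (m + 1) n \<omega>2" "x (m + 1) n \<omega>3 = x (m + 1) n \<omega>4"
      "x m (n + 1) \<omega>1 = x m (n + 1) \<omega>3" "x m (n + 1) \<omega>2 = x m (n + 1) \<omega>4"
  then have "x m (n + 1) \<omega>1 = x m (n + 1) \<omega>2 \<or> x (m + 1) n \<omega>1 = x (m + 1) n \<omega>3"
    by (intro girth[OF *(1,3,2,4)])
  then show "x (m + 1) n \<omega>1 = x (m + 1) n \<omega>3 \<or> x m (n + 1) \<omega>1 = x m (n + 1) \<omega>2" by blast
qed

text \<open>The bounds \<open>fiber\<close> and \<open>fiber1\<close> are attained since the measures have to add up.\<close>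

lemma flag_measure:
  assumes w: "\<omega> \<in> space M"
  shows "measure M (B n (m + 1) \<omega> \<inter> B (n + 1) m \<omega>) = s n m / real q ^ 3"
    and "card (x n (m + 1) ` B (n + 1) m \<omega>) = q"
proof -
  let ?L = "x n (m + 1) ` B (n + 1) m \<omega>"
  \<comment> \<open>At most \<open>q\<close> blocks over \<open>(n + 1, m + 1)\<close> make up a
    flag, of total mass at most \<open>q * s (n + 1) (m + 1)\<close>, which is
    \<open>s n m / q ^ 3\<close>.\<close>
  have le: "measure M (B n (m + 1) \<eta> \<inter> B (n + 1) m \<eta>) \<le> s n m / real q ^ 3" if e: "\<eta> \<in> space M" for \<eta>
  proof -
    let ?E = "B n (m + 1) \<eta> \<inter> B (n + 1) m \<eta>"
    have fm: "?E \<in> fmeasurable M" using e by (intro fmeasurable.Int B_fmeasurable)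
    have sat: "B (n + 1) (m + 1) \<omega>' \<subseteq> ?E" if "\<omega>' \<in> ?E" for \<omega>'
    proof
      fix \<omega>'' assume "\<omega>'' \<in> B (n + 1) (m + 1) \<omega>'"
      then show "\<omega>'' \<in> ?E" using that mono[of \<omega>'' \<omega>' "n + 1" "m + 1"] by (auto simp: B_mem)
    qed
    have "card (x (n + 1) (m + 1) ` ?E) \<le> q"
      using fiber[OF e, of n m] by (simp add: B_def Collect_conj_eq[symmetric] conj_ac)
    then have "real (card (x (n + 1) (m + 1) ` ?E)) * s (n + 1) (m + 1) \<le> real q * s (n + 1) (m + 1)"
      by (intro mult_right_mono) auto
    then show ?thesis unfolding s_diag using card_blocks(2)[OF fm sat] by simp
  qed
  have L: "finite ?L" "card ?L \<le> q" using fiber1[OF w, of n m] by (auto simp: B_def)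
  have part: "{\<omega>' \<in> B (n + 1) m \<omega>. x n (m + 1) \<omega>' = x n (m + 1) \<eta>} = B n (m + 1) \<eta> \<inter> B (n + 1) m \<eta>"
    if "\<eta> \<in> B (n + 1) m \<omega>" for \<eta>
    using that by (auto simp: B_mem)
  let ?a = "\<lambda>l. measure M {\<omega>' \<in> B (n + 1) m \<omega>. x n (m + 1) \<omega>' = l}"
  have "measure M (B (n + 1) m \<omega>) = sum ?a ?L"
  proof (rule measure_partition[OF B_fmeasurable[OF w] L(1) order_refl])
    fix l assume "l \<in> ?L"
    then obtain \<eta> where "\<eta> \<in> B (n + 1) m \<omega>" "l = x n (m + 1) \<eta>" by blast
    then show "{\<omega>' \<in> B (n + 1) m \<omega>. x n (m + 1) \<omega>' = l} \<in> sets M"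
      using part[of \<eta>] by (auto simp: B_mem)
  qed
  \<comment> \<open>The block over \<open>(n + 1, m)\<close> has mass \<open>s n m / q ^ 2\<close>
    and at most \<open>q\<close> flags, so all the bounds are attained.\<close>
  moreover have "real q * (s n m / real q ^ 3) = measure M (B (n + 1) m \<omega>)"
    using q_pos by (simp add: B_measure[OF w] s_step power2_eq_square power3_eq_cube)
  ultimately have sum: "sum ?a ?L = real q * (s n m / real q ^ 3)" by simp
  have a: "?a l \<le> s n m / real q ^ 3" if "l \<in> ?L" for l
  proof -
    obtain \<eta> where "\<eta> \<in> B (n + 1) m \<omega>" "l = x n (m + 1) \<eta>" using \<open>l \<in> ?L\<close> by blast
    then show ?thesis using part[of \<eta>] le[of \<eta>] by (simp add: B_mem)
  qed
  have pos: "0 < s n m / real q ^ 3" using q_pos by simp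
  show "card ?L = q" by (rule sum_saturated(1)[OF L a sum pos])
  have "?a (x n (m + 1) \<omega>) = s n m / real q ^ 3"
    by (rule sum_saturated(2)[OF L a sum pos]) (use B_self[OF w] in auto)
  then show "measure M (B n (m + 1) \<omega> \<inter> B (n + 1) m \<omega>) = s n m / real q ^ 3"
    using part[OF B_self[OF w]] by simp
qed

text \<open>Given the vertex over \<open>(N, m)\<close>, the one over \<open>(n, m + 1)\<close> is
  uniformly distributed over \<open>q\<close> possibilities: the quantitative form of the fact that
  two rays 120 degrees apart, leaving the vertex over \<open>(n + 1, m)\<close>, span a sector. In
  particular the intersection is not empty.\<close>

lemma flag_measure_far:
  assumes "n + 1 \<le> N" "\<omega> \<in> space M" "\<omega>' \<in> space M" "x (n + 1) m \<omega> = x (n + 1) m \<omega>'"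
  shows "measure M (B n (m + 1) \<omega> \<inter> B N m \<omega>') = s N m / real q"
  using assms
proof (induction "nat (N - (n + 1))" arbitrary: n \<omega> \<omega>')
  case 0
  then have "N = n + 1" by simp
  moreover from this have "B N m \<omega>' = B (n + 1) m \<omega>" using 0 by (simp add: B_def)
  ultimately show ?case
    using flag_measure(1)[OF 0(3), of n m] q_pos by (simp add: s_step power2_eq_square power3_eq_cube)
next
  case (Suc d)
  then have N: "n + 2 \<le> N" by linarith
  let ?L = "x n (m + 1) ` B (n + 1) m \<omega>'"
  let ?a = "\<lambda>l. measure M {\<eta> \<in> B N m \<omega>'. x n (m + 1) \<eta> = l}"
  have part: "{\<eta> \<in> B N m \<omega>'. x n (m + 1) \<eta> = x n (m + 1) \<zeta>} = B n (m + 1) \<zeta> \<inter> B N m \<omega>'" for \<zeta>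
    by (auto simp: B_mem)
  \<comment> \<open>That the label occurs inside the block over \<open>(N, m)\<close> is not known
    beforehand; the upper bound holds in any case, and saturation excludes the empty one.\<close>
  have le: "?a l \<le> s N m / real q" for l
  proof (cases "{\<eta> \<in> B N m \<omega>'. x n (m + 1) \<eta> = l} = {}")
    case True
    show ?thesis unfolding True using q_pos by simp
  next
    case False
    then obtain \<eta> where e: "\<eta> \<in> B N m \<omega>'" "l = x n (m + 1) \<eta>" by blast
    then have es: "\<eta> \<in> space M" "x N m \<eta> = x N m \<omega>'" by (auto simp: B_mem)
    \<comment> \<open>By \<open>rigid1\<close> the vertices over \<open>(n, m + 1)\<close> and
      \<open>(n + 2, m)\<close> determine the one over \<open>(n + 1, m + 1)\<close>, so the corner
      moves one step along the ray.\<close>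
    have "B n (m + 1) \<eta> \<inter> B N m \<omega>' = B (n + 1) (m + 1) \<eta> \<inter> B N m \<omega>'"
    proof (intro equalityI subsetI)
      fix \<zeta> assume z: "\<zeta> \<in> B n (m + 1) \<eta> \<inter> B N m \<omega>'"
      then have zs: "\<zeta> \<in> space M" "x n (m + 1) \<zeta> = x n (m + 1) \<eta>" "x N m \<zeta> = x N m \<eta>"
        using es by (auto simp: B_mem)
      have "x (n + 2) m \<zeta> = x (n + 2) m \<eta>" by (rule mono[OF zs(1) es(1) zs(3) N order_refl])
      then have "x (n + 1) (m + 1) \<zeta> = x (n + 1) (m + 1) \<eta>" by (rule rigid1[OF zs(1) es(1) zs(2)])
      then show "\<zeta> \<in> B (n + 1) (m + 1) \<eta> \<inter> B N m \<omega>'" using z by (simp add: B_mem)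
    next
      fix \<zeta> assume z: "\<zeta> \<in> B (n + 1) (m + 1) \<eta> \<inter> B N m \<omega>'"
      then show "\<zeta> \<in> B n (m + 1) \<eta> \<inter> B N m \<omega>'" using mono1[of \<zeta> \<eta> n "m + 1"] es by (simp add: B_mem)
    qed
    moreover have "measure M (B (n + 1) (m + 1) \<eta> \<inter> B N m \<omega>') = s N m / real q"
    proof (rule Suc.hyps(1))
      show "d = nat (N - (n + 1 + 1))" "n + 1 + 1 \<le> N" using Suc.hyps(2) N by auto
      show "x (n + 1 + 1) m \<eta> = x (n + 1 + 1) m \<omega>'"
        using mono[OF es(1) Suc.prems(3) es(2), of "n + 1 + 1" m] N by simp
    qed (use es Suc.prems in auto)
    ultimately show ?thesis using part[of \<eta>] e(2) by simp
  qed
  have L: "finite ?L" "card ?L = q"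
    using fiber1[OF Suc.prems(3), of n m] flag_measure(2)[OF Suc.prems(3), of n m] by (auto simp: B_def)
  have "measure M (B N m \<omega>') = sum ?a ?L"
  proof (rule measure_partition[OF B_fmeasurable[OF Suc.prems(3)] L(1)])
    have "B N m \<omega>' \<subseteq> B (n + 1) m \<omega>'"
    proof
      fix \<eta> assume "\<eta> \<in> B N m \<omega>'"
      then have "\<eta> \<in> space M" "x N m \<eta> = x N m \<omega>'" by (simp_all add: B_mem)
      then show "\<eta> \<in> B (n + 1) m \<omega>'"
        unfolding B_mem using mono[OF _ Suc.prems(3) _ Suc.prems(1) order_refl] by blast
    qed
    then show "x n (m + 1) ` B N m \<omega>' \<subseteq> ?L" by blast
    fix l assume "l \<in> ?L"
    then obtain \<eta> where "\<eta> \<in> space M" "l = x n (m + 1) \<eta>" by (auto simp: B_mem)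
    then show "{\<eta> \<in> B N m \<omega>'. x n (m + 1) \<eta> = l} \<in> sets M" using part[of \<eta>] Suc.prems(3) by simp
  qed
  then have sum: "sum ?a ?L = real q * (s N m / real q)" using q_pos by (simp add: B_measure[OF Suc.prems(3)])
  have "?a (x n (m + 1) \<omega>) = s N m / real q"
  proof (rule sum_saturated(2)[OF L(1) _ le sum])
    show "x n (m + 1) \<omega> \<in> ?L" using Suc.prems(2,4) by (intro imageI) (simp add: B_mem)
  qed (use q_pos L(2) in simp_all)
  then show ?case unfolding part .
qed

text \<open>In the link, \<open>q * (q - 1)\<close> points are joined to a given one by a line, and by girth none of them has
  the same vertex over \<open>(n - 1, m + 1)\<close>; there are exactly \<open>q * (q - 1)\<close> points outside that class.\<close>

lemma joined:
  assumes w: "\<omega> \<in> space M" "\<omega>' \<in> space M" "x n m \<omega> = x n m \<omega>'" "x (n - 1) (m + 1) \<omega> \<noteq> x (n - 1) (m + 1) \<omega>'"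
  obtains \<omega>1 \<omega>2 where "\<omega>1 \<in> space M" "\<omega>2 \<in> space M" "x n (m + 1) \<omega>1 = x n (m + 1) \<omega>"
    "x n (m + 1) \<omega>2 = x n (m + 1) \<omega>'" "x (n + 1) m \<omega>1 = x (n + 1) m \<omega>2"
proof -
  interpret tr: two_parameter M "\<lambda>n m. x m n" q by (rule transposed)
  define W where "W = B n m \<omega> - B (n - 1) (m + 1) \<omega>"
  have WI: "W = B n m \<omega> - B (n - 1) (m + 1) \<omega> \<inter> B n m \<omega>" by (auto simp: W_def)
  have Wf: "W \<in> fmeasurable M" unfolding W_def using w by (intro fmeasurable_Diff B_fmeasurable) auto
  have Wm: "measure M W = s n m - s n m / real q"
  proof -
    have "measure M (B (n - 1) (m + 1) \<omega> \<inter> B n m \<omega>) = s n m / real q"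
      using flag_measure_far[of "n - 1" n \<omega> \<omega> m] w by simp
    then show ?thesis
      unfolding WI using w
      by (subst measure_Diff) (auto simp: B_emeasure B_measure)
  qed
  have Wsat: "B n (m + 1) \<eta> \<subseteq> W" if "\<eta> \<in> W" for \<eta>
  proof
    fix \<zeta> assume "\<zeta> \<in> B n (m + 1) \<eta>"
    then show "\<zeta> \<in> W"
      using that mono[of \<zeta> \<eta> n "m + 1" n m] mono[of \<zeta> \<eta> n "m + 1" "n - 1" "m + 1"] by (auto simp: W_def B_mem)
  qed
  note cW = card_blocks[OF Wf Wsat]
  \<comment> \<open>The mass \<open>s n m * (1 - 1 / q)\<close> is made up of blocks of mass
    \<open>s n m / q ^ 2\<close>.\<close>
  have cardW: "card (x n (m + 1) ` W) = q * (q - 1)"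
  proof -
    have "real (card (x n (m + 1) ` W)) * (s n m / real q ^ 2) = s n m - s n m / real q"
      using cW(2) Wm by (simp add: s_step)
    also have "\<dots> = real (q * (q - 1)) * (s n m / real q ^ 2)"
      using q2 by (simp add: of_nat_diff field_simps power2_eq_square)
    finally have "real (card (x n (m + 1) ` W)) = real (q * (q - 1))"
      using q_pos less_imp_neq[OF s_pos[of n m]] by (subst (asm) mult_right_cancel) simp_all
    then show ?thesis by (simp only: of_nat_eq_iff)
  qed
  \<comment> \<open>Pairs of a line through the point of \<open>\<omega>\<close> and another point
    on it: \<open>q\<close> lines with \<open>q - 1\<close> further points each.\<close>
  define P where "P = (SIGMA l:x (n + 1) m ` B n (m + 1) \<omega>.
    x n (m + 1) ` {\<eta> \<in> space M. x (n + 1) m \<eta> = l} - {x n (m + 1) \<omega>})"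
  have fib: "finite (x n (m + 1) ` {\<eta> \<in> space M. x (n + 1) m \<eta> = l} - {x n (m + 1) \<omega>}) \<and>
      card (x n (m + 1) ` {\<eta> \<in> space M. x (n + 1) m \<eta> = l} - {x n (m + 1) \<omega>}) = q - 1"
    if l: "l \<in> x (n + 1) m ` B n (m + 1) \<omega>" for l
  proof -
    obtain \<eta> where e: "\<eta> \<in> space M" "x n (m + 1) \<eta> = x n (m + 1) \<omega>" "l = x (n + 1) m \<eta>"
      using l by (auto simp: B_mem)
    have "x n (m + 1) \<omega> \<in> x n (m + 1) ` B (n + 1) m \<eta>" using e by (auto simp: B_mem image_iff intro!: bexI[of _ \<eta>])
    then show ?thesis
      using fiber1[OF e(1), of n m] flag_measure(2)[OF e(1), of n m] unfolding e(3) by (simp add: B_def)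
  qed
  have "card P = (\<Sum>l\<in>x (n + 1) m ` B n (m + 1) \<omega>. q - 1)"
    unfolding P_def using fib fiber2[OF w(1), of n m]
    by (subst card_SigmaI) (auto simp: B_def)
  also have "\<dots> = q * (q - 1)"
    using tr.flag_measure(2)[OF w(1), where n = m and m = n] by (simp add: B_def tr.B_def)
  finally have cardP: "card P = q * (q - 1)" .
  have P_E: "\<exists>\<eta> \<zeta>. \<eta> \<in> space M \<and> \<zeta> \<in> space M \<and> x n (m + 1) \<eta> = x n (m + 1) \<omega> \<and>
      x (n + 1) m \<zeta> = x (n + 1) m \<eta> \<and> fst a = x (n + 1) m \<eta> \<and> snd a = x n (m + 1) \<zeta> \<and>
      x n (m + 1) \<zeta> \<noteq> x n (m + 1) \<omega>" if "a \<in> P" for a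
  proof -
    have "fst a \<in> x (n + 1) m ` B n (m + 1) \<omega>"
      and "snd a \<in> x n (m + 1) ` {\<eta> \<in> space M. x (n + 1) m \<eta> = fst a} - {x n (m + 1) \<omega>}"
      using that by (auto simp: P_def)
    then obtain \<eta> \<zeta> where "\<eta> \<in> space M" "x n (m + 1) \<eta> = x n (m + 1) \<omega>" "fst a = x (n + 1) m \<eta>"
      "\<zeta> \<in> space M" "x (n + 1) m \<zeta> = fst a" "snd a = x n (m + 1) \<zeta>" "snd a \<noteq> x n (m + 1) \<omega>"
      unfolding B_def by blast
    then show ?thesis by (intro exI[of _ \<eta>] exI[of _ \<zeta>]) simp
  qed
  \<comment> \<open>Two lines through the given point that met again would form a 4-cycle.\<close>
  have inj: "inj_on snd P"
  proof (rule inj_onI)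
    fix a b assume "a \<in> P" "b \<in> P" "snd a = snd b"
    obtain \<eta>1 \<eta>2 \<zeta>1 \<zeta>2 where *: "\<eta>1 \<in> space M" "\<eta>2 \<in> space M" "\<zeta>1 \<in> space M" "\<zeta>2 \<in> space M"
      "x n (m + 1) \<eta>1 = x n (m + 1) \<omega>" "x n (m + 1) \<zeta>1 = x n (m + 1) \<omega>"
      "fst a = x (n + 1) m \<eta>1" "fst b = x (n + 1) m \<zeta>1" "x (n + 1) m \<eta>2 = fst a" "x (n + 1) m \<zeta>2 = fst b"
      "snd a = x n (m + 1) \<eta>2" "snd b = x n (m + 1) \<zeta>2" "snd a \<noteq> x n (m + 1) \<omega>"
      using P_E[OF \<open>a \<in> P\<close>] P_E[OF \<open>b \<in> P\<close>] by metis
    then have "x n (m + 1) \<eta>1 = x n (m + 1) \<eta>2 \<or> x (n + 1) m \<eta>1 = x (n + 1) m \<zeta>1"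
      using \<open>snd a = snd b\<close> by (intro girth[of \<eta>1 \<zeta>1 \<eta>2 \<zeta>2]) auto
    then show "a = b" using * \<open>snd a = snd b\<close> by (auto simp: prod_eq_iff)
  qed
  have sub: "snd ` P \<subseteq> x n (m + 1) ` W"
  proof
    fix y assume "y \<in> snd ` P"
    then obtain \<eta> \<zeta> where *: "\<eta> \<in> space M" "\<zeta> \<in> space M" "x n (m + 1) \<eta> = x n (m + 1) \<omega>"
      "x (n + 1) m \<zeta> = x (n + 1) m \<eta>" "y = x n (m + 1) \<zeta>" "y \<noteq> x n (m + 1) \<omega>"
      using P_E by fastforce
    have 1: "x n m \<zeta> = x n m \<omega>"
      using mono1[OF *(2,1), of n m] mono2[OF *(1) w(1), of n m] * by simp
    \<comment> \<open>Otherwise \<open>rigid1\<close> would determine the point from the line and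
      the vertex over \<open>(n - 1, m + 1)\<close>, and it would be the given one.\<close>
    have 2: "x (n - 1) (m + 1) \<zeta> \<noteq> x (n - 1) (m + 1) \<omega>"
    proof
      assume "x (n - 1) (m + 1) \<zeta> = x (n - 1) (m + 1) \<omega>"
      also have "\<dots> = x (n - 1) (m + 1) \<eta>" using mono1[OF *(1) w(1), of "n - 1" "m + 1"] *(3) by simp
      finally have "x n (m + 1) \<zeta> = x n (m + 1) \<eta>"
        using rigid1[OF *(2,1), of "n - 1" m] *(4) by (simp add: add.commute)
      then show False using * by simp
    qed
    show "y \<in> x n (m + 1) ` W" using * 1 2 by (auto simp: W_def B_mem)
  qed
  have "snd ` P = x n (m + 1) ` W"
    using card_subset_eq[OF cW(1) sub] card_image[OF inj] cardP cardW by simp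
  moreover have "\<omega>' \<in> W" using w by (auto simp: W_def B_mem)
  ultimately have "x n (m + 1) \<omega>' \<in> snd ` P" by blast
  then obtain \<eta> \<zeta> where "\<eta> \<in> space M" "\<zeta> \<in> space M" "x n (m + 1) \<eta> = x n (m + 1) \<omega>"
    "x (n + 1) m \<zeta> = x (n + 1) m \<eta>" "x n (m + 1) \<omega>' = x n (m + 1) \<zeta>"
    using P_E by fastforce
  then show thesis using that[of \<eta> \<zeta>] by simp
qed

end

section \<open>The maximal function of a two-parameter partition\<close>

lemma ennreal_mult_divide_cancel: "0 < c \<Longrightarrow> ennreal c * (a / ennreal c) = a"
  using ennreal_mult_divide_eq[of "ennreal c" a] by (simp add: ennreal_times_divide mult.commute[of "ennreal c" a])

context two_parameter
begin

lemma s_nonzero [simp]: "s n m \<noteq> 0"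
  using s_pos[of n m] by (rule less_imp_neq[symmetric])

abbreviation A :: "int \<Rightarrow> int \<Rightarrow> ('w \<Rightarrow> ennreal) \<Rightarrow> 'w \<Rightarrow> ennreal" where
  "A n m \<equiv> uniform_partition.avg M (x n m) (s n m)"

lemma A_measurable [measurable]: "A n m f \<in> borel_measurable M"
  by (rule uniform_partition.avg_measurable[OF uniform_partition])

lemma A_adjoint:
  "f \<in> borel_measurable M \<Longrightarrow> g \<in> borel_measurable M \<Longrightarrow>
    (\<integral>\<^sup>+\<omega>. g \<omega> * A n m f \<omega> \<partial>M) = (\<integral>\<^sup>+\<omega>. A n m g \<omega> * f \<omega> \<partial>M)"
  by (rule uniform_partition.avg_adjoint[OF uniform_partition])

lemma A_mono: "(\<And>\<omega>. \<omega> \<in> space M \<Longrightarrow> f \<omega> \<le> g \<omega>) \<Longrightarrow> A n m f \<omega> \<le> A n m g \<omega>"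
  by (rule uniform_partition.avg_mono[OF uniform_partition])

lemma A_cong: "x n m \<omega> = x n m \<omega>' \<Longrightarrow> A n m f \<omega> = A n m f \<omega>'"
  by (rule uniform_partition.avg_cong[OF uniform_partition])

lemma A_indicator: "E \<in> sets M \<Longrightarrow> \<omega> \<in> space M \<Longrightarrow>
    A n m (indicator E) \<omega> = emeasure M (E \<inter> B n m \<omega>) / ennreal (s n m)"
  unfolding B_def by (rule uniform_partition.avg_indicator[OF uniform_partition])

lemma A_eq: "A n m f \<omega> = (\<integral>\<^sup>+\<omega>'. f \<omega>' * indicator (B n m \<omega>) \<omega>' \<partial>M) / ennreal (s n m)"
  unfolding B_def by (rule uniform_partition.avg_def[OF uniform_partition])

lemma A_saturated:
  "(\<And>\<omega>'. \<omega>' \<in> space M \<Longrightarrow> x n m \<omega>' = x n m \<omega> \<Longrightarrow> g \<omega>' = g \<omega>) \<Longrightarrow> \<omega> \<in> space M \<Longrightarrow> A n m g \<omega> = g \<omega>"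
  by (rule uniform_partition.avg_saturated[OF uniform_partition])

text \<open>Given the vertex over \<open>(n + 1, m)\<close>, the vertices over
  \<open>(n, m + 1)\<close> and \<open>(N, m)\<close> are independent by
  \<open>flag_measure_far\<close>, so passing from the block to a flag costs exactly the factor
  \<open>1 / q\<close>.\<close>

lemma flag_integral:
  assumes N: "n + 1 \<le> N" and e: "\<eta> \<in> space M" and [measurable]: "g \<in> borel_measurable M"
    and g: "\<And>\<omega> \<omega>'. \<omega> \<in> space M \<Longrightarrow> \<omega>' \<in> space M \<Longrightarrow> x N m \<omega> = x N m \<omega>' \<Longrightarrow> g \<omega> = g \<omega>'"
  shows "(\<integral>\<^sup>+\<omega>. indicator (B n (m + 1) \<eta> \<inter> B (n + 1) m \<eta>) \<omega> * g \<omega> \<partial>M)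
    = ennreal (1 / real q) * (\<integral>\<^sup>+\<omega>. indicator (B (n + 1) m \<eta>) \<omega> * g \<omega> \<partial>M)"
proof -
  define h where "h \<omega> = indicator (B (n + 1) m \<eta>) \<omega> * g \<omega>" for \<omega>
  have [measurable]: "B n (m + 1) \<eta> \<in> sets M" "B (n + 1) m \<eta> \<in> sets M" using e by (auto intro: B_sets)
  have [measurable]: "h \<in> borel_measurable M" unfolding h_def by measurable
  have h: "A N m h \<omega> = h \<omega>" if w: "\<omega> \<in> space M" for \<omega>
  proof (rule A_saturated[OF _ w])
    fix \<omega>' assume w': "\<omega>' \<in> space M" "x N m \<omega>' = x N m \<omega>"
    have "x (n + 1) m \<omega>' = x (n + 1) m \<omega>" by (rule mono[OF w'(1) w w'(2) N order_refl])
    then show "h \<omega>' = h \<omega>" using g[OF w'(1) w w'(2)] w w' by (simp add: h_def B_mem indicator_def)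
  qed
  have a: "h \<omega> * A N m (indicator (B n (m + 1) \<eta>)) \<omega> = ennreal (1 / real q) * h \<omega>" if w: "\<omega> \<in> space M" for \<omega>
  proof (cases "\<omega> \<in> B (n + 1) m \<eta>")
    case True
    then have eq: "x (n + 1) m \<eta> = x (n + 1) m \<omega>" by (simp add: B_mem)
    have "B n (m + 1) \<eta> \<inter> B N m \<omega> \<in> fmeasurable M" using e w by (intro fmeasurable.Int B_fmeasurable)
    then have "emeasure M (B n (m + 1) \<eta> \<inter> B N m \<omega>) = ennreal (s N m / real q)"
      using flag_measure_far[OF N e w eq] by (simp add: emeasure_eq_measure2)
    then have "A N m (indicator (B n (m + 1) \<eta>)) \<omega> = ennreal (1 / real q)"
      using w q_pos by (subst A_indicator) (simp_all add: divide_ennreal)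
    then show ?thesis by (simp add: mult.commute)
  qed (simp add: h_def)
  have "(\<integral>\<^sup>+\<omega>. indicator (B n (m + 1) \<eta> \<inter> B (n + 1) m \<eta>) \<omega> * g \<omega> \<partial>M)
      = (\<integral>\<^sup>+\<omega>. A N m h \<omega> * indicator (B n (m + 1) \<eta>) \<omega> \<partial>M)"
    by (intro nn_integral_cong) (auto simp: h h_def indicator_def)
  also have "\<dots> = (\<integral>\<^sup>+\<omega>. h \<omega> * A N m (indicator (B n (m + 1) \<eta>)) \<omega> \<partial>M)"
    by (rule A_adjoint[symmetric]) measurable
  also have "\<dots> = (\<integral>\<^sup>+\<omega>. ennreal (1 / real q) * h \<omega> \<partial>M)" by (intro nn_integral_cong a)
  also have "\<dots> = ennreal (1 / real q) * (\<integral>\<^sup>+\<omega>. h \<omega> \<partial>M)" by (rule nn_integral_cmult) measurable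
  finally show ?thesis by (simp add: h_def)
qed

text \<open>The integral is, up to a factor, the kernel of the composition of averages \<open>A n T\<close>, \<open>A N m\<close>, \<open>A n T\<close>
  with \<open>T = m + j\<close>.\<close>

lemma kernel_bound:
  assumes "n \<le> N" "\<omega> \<in> space M" "\<omega>' \<in> space M" "x n m \<omega> = x n m \<omega>'"
    and "j = 0 \<or> x (n - 1) (m + 1) \<omega> \<noteq> x (n - 1) (m + 1) \<omega>'"
  shows "ennreal (s n (m + int j) ^ 2 / s n m) \<le>
    (\<integral>\<^sup>+\<eta>. indicator (B n (m + int j) \<omega>) \<eta> * A N m (indicator (B n (m + int j) \<omega>')) \<eta> \<partial>M)"
  using assms
proof (induction "nat (N - n)" arbitrary: n j \<omega> \<omega>')
  case 0
  then have N: "N = n" by simp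
  have sub: "B n (m + int j) \<omega>' \<inter> B n m \<eta> = B n (m + int j) \<omega>'" if e: "\<eta> \<in> B n (m + int j) \<omega>" for \<eta>
  proof -
    have es: "\<eta> \<in> space M" "x n (m + int j) \<eta> = x n (m + int j) \<omega>" using e by (simp_all add: B_mem)
    have 1: "x n m \<eta> = x n m \<omega>'" using mono[OF es(1) 0(3) es(2), of n m] 0(5) by simp
    have "x n m \<zeta> = x n m \<eta>" if "\<zeta> \<in> B n (m + int j) \<omega>'" for \<zeta>
      using mono[OF _ 0(4), of \<zeta> n "m + int j" n m] that 1 by (simp add: B_mem)
    then show ?thesis by (auto simp: B_mem)
  qed
  have "(\<integral>\<^sup>+\<eta>. indicator (B n (m + int j) \<omega>) \<eta> * A N m (indicator (B n (m + int j) \<omega>')) \<eta> \<partial>M)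
      = (\<integral>\<^sup>+\<eta>. ennreal (s n (m + int j) / s n m) * indicator (B n (m + int j) \<omega>) \<eta> \<partial>M)"
  proof (rule nn_integral_cong)
    fix \<eta> assume e: "\<eta> \<in> space M"
    show "indicator (B n (m + int j) \<omega>) \<eta> * A N m (indicator (B n (m + int j) \<omega>')) \<eta>
        = ennreal (s n (m + int j) / s n m) * indicator (B n (m + int j) \<omega>) \<eta>"
    proof (cases "\<eta> \<in> B n (m + int j) \<omega>")
      case True
      then show ?thesis
        using sub[OF True] e 0(4) by (simp add: N A_indicator B_sets B_emeasure divide_ennreal)
    qed simp
  qed
  also have "\<dots> = ennreal (s n (m + int j) ^ 2 / s n m)"
    using 0(3) by (simp add: nn_integral_cmult_indicator B_sets B_emeasure ennreal_mult[symmetric] power2_eq_square)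
  finally show ?case by simp
next
  case (Suc d)
  then have N: "n + 1 \<le> N" by linarith
  show ?case
  proof (cases j)
    case 0
    have eq: "B n m \<omega>' = B n m \<omega>" using Suc.prems by (simp add: B_def)
    have "A N m (indicator (B n m \<omega>)) \<eta> = indicator (B n m \<omega>) \<eta>" if e: "\<eta> \<in> space M" for \<eta>
    proof (rule A_saturated[OF _ e])
      fix \<zeta> assume z: "\<zeta> \<in> space M" "x N m \<zeta> = x N m \<eta>"
      have "x n m \<zeta> = x n m \<eta>" by (rule mono[OF z(1) e z(2) Suc.prems(1) order_refl])
      then show "indicator (B n m \<omega>) \<zeta> = (indicator (B n m \<omega>) \<eta> :: ennreal)"
        using z e by (simp add: indicator_def B_mem)
    qed
    then have "(\<integral>\<^sup>+\<eta>. indicator (B n m \<omega>) \<eta> * A N m (indicator (B n m \<omega>)) \<eta> \<partial>M) = (\<integral>\<^sup>+\<eta>. indicator (B n m \<omega>) \<eta> \<partial>M)"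
      by (intro nn_integral_cong) (auto simp: indicator_def)
    also have "\<dots> = ennreal (s n m)" using Suc.prems by (simp add: B_sets B_emeasure)
    finally show ?thesis by (simp add: 0 eq power2_eq_square)
  next
    case (Suc i)
    interpret tr: two_parameter M "\<lambda>n m. x m n" q by (rule transposed)
    have trB: "tr.B a b = B b a" and trs: "tr.s a b = s b a" for a b
      by (auto simp: tr.B_def B_def fun_eq_iff tr.s_def s_def add.commute)
    note w = Suc.prems(2,3)
    define k where "k = m + int i"
    have kj: "m + int j = k + 1" by (simp add: k_def Suc)
    have V: "x (n - 1) (m + 1) \<omega> \<noteq> x (n - 1) (m + 1) \<omega>'" using Suc.prems(5) Suc by simp
    have a: "x n (m + 1) \<omega> \<noteq> x n (m + 1) \<omega>'"
      using V mono[OF w, of n "m + 1" "n - 1" "m + 1"] by auto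
    \<comment> \<open>The vertex of the joining line over \<open>(n + 1, m)\<close> becomes the
      common base of the next step.\<close>
    obtain \<omega>1 \<omega>2 where j: "\<omega>1 \<in> space M" "\<omega>2 \<in> space M" "x n (m + 1) \<omega>1 = x n (m + 1) \<omega>"
      "x n (m + 1) \<omega>2 = x n (m + 1) \<omega>'" "x (n + 1) m \<omega>1 = x (n + 1) m \<omega>2"
      using joined[OF w Suc.prems(4) V] by metis
    \<comment> \<open>Seen from the vertex over \<open>(n, m + 1)\<close>, the line and the ray to
      \<open>(n, k + 1)\<close> are 120 degrees apart. So some member has the given line and the
      given vertex over \<open>(n, k + 1)\<close> at once.\<close>
    have ex: "\<exists>\<eta>. \<eta> \<in> B (n + 1) m \<zeta> \<and> \<eta> \<in> B n (k + 1) \<theta>"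
      if "\<zeta> \<in> space M" "\<theta> \<in> space M" "x n (m + 1) \<zeta> = x n (m + 1) \<theta>" for \<zeta> \<theta>
    proof -
      have "measure M (B (n + 1) m \<zeta> \<inter> B n (k + 1) \<theta>) = s n (k + 1) / real q"
        using tr.flag_measure_far[of m "k + 1" \<zeta> \<theta> n] that by (simp add: trB trs k_def)
      then have "B (n + 1) m \<zeta> \<inter> B n (k + 1) \<theta> \<noteq> {}"
        using q_pos by auto
      then show ?thesis by blast
    qed
    obtain \<eta> where e: "\<eta> \<in> B (n + 1) m \<omega>1" "\<eta> \<in> B n (k + 1) \<omega>" using ex[OF j(1) w(1) j(3)] by blast
    obtain \<eta>' where e': "\<eta>' \<in> B (n + 1) m \<omega>2" "\<eta>' \<in> B n (k + 1) \<omega>'" using ex[OF j(2) w(2) j(4)] by blast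
    have es: "\<eta> \<in> space M" "\<eta>' \<in> space M" using e e' by (auto simp: B_mem)
    let ?F = "B n (k + 1) \<eta> \<inter> B (n + 1) k \<eta>" and ?F' = "B n (k + 1) \<eta>' \<inter> B (n + 1) k \<eta>'"
    have [measurable]: "B n (k + 1) \<eta> \<in> sets M" "B (n + 1) k \<eta> \<in> sets M" "B n (k + 1) \<eta>' \<in> sets M" "B (n + 1) k \<eta>' \<in> sets M"
      using es by (auto intro: B_sets)
    have Beq: "B n (k + 1) \<omega> = B n (k + 1) \<eta>" "B n (k + 1) \<omega>' = B n (k + 1) \<eta>'"
      using e e' by (auto simp: B_def)
    have sat: "A N m g \<zeta> = A N m g \<theta>" if z: "\<zeta> \<in> space M" "\<theta> \<in> space M" "x N k \<zeta> = x N k \<theta>" for g \<zeta> \<theta>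
      by (rule A_cong, rule mono[OF z]) (simp_all add: k_def)
    \<comment> \<open>The induction hypothesis with base \<open>(n + 1, m)\<close> and
      \<open>i\<close> for \<open>j\<close>. The new pair is in general position because its points
      over \<open>(n, m + 1)\<close> differ.\<close>
    have "ennreal (s (n + 1) k ^ 2 / s (n + 1) m) \<le>
        (\<integral>\<^sup>+\<zeta>. indicator (B (n + 1) k \<eta>) \<zeta> * A N m (indicator (B (n + 1) k \<eta>')) \<zeta> \<partial>M)"
      unfolding k_def
    proof (rule Suc.hyps(1)[OF _ N es])
      show "d = nat (N - (n + 1))" using Suc.hyps(2) by linarith
      show "x (n + 1) m \<eta> = x (n + 1) m \<eta>'" using e(1) e'(1) j(5) by (simp add: B_mem)
      have "x n (m + 1) \<eta> = x n (m + 1) \<omega>" "x n (m + 1) \<eta>' = x n (m + 1) \<omega>'"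
        using e(2) e'(2) mono[OF es(1) w(1), of n "k + 1" n "m + 1"] mono[OF es(2) w(2), of n "k + 1" n "m + 1"]
        by (simp_all add: B_mem k_def)
      then show "i = 0 \<or> x (n + 1 - 1) (m + 1) \<eta> \<noteq> x (n + 1 - 1) (m + 1) \<eta>'" using a by simp
    qed
    \<comment> \<open>Both indicators are cut down to flags, one after the other by
      self-adjointness, each at the cost \<open>1 / q\<close>; this is made up for by
      \<open>s (n + 1) m = s n m / q ^ 2\<close>.\<close>
    then have "ennreal (1 / real q) * (ennreal (1 / real q) * ennreal (s (n + 1) k ^ 2 / s (n + 1) m)) \<le>
        ennreal (1 / real q) * (ennreal (1 / real q) * (\<integral>\<^sup>+\<zeta>. indicator (B (n + 1) k \<eta>) \<zeta> * A N m (indicator (B (n + 1) k \<eta>')) \<zeta> \<partial>M))"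
      by (intro mult_left_mono) auto
    also have "(\<integral>\<^sup>+\<zeta>. indicator (B (n + 1) k \<eta>) \<zeta> * A N m (indicator (B (n + 1) k \<eta>')) \<zeta> \<partial>M)
        = (\<integral>\<^sup>+\<zeta>. indicator (B (n + 1) k \<eta>') \<zeta> * A N m (indicator (B (n + 1) k \<eta>)) \<zeta> \<partial>M)"
      by (subst A_adjoint) (simp_all add: mult.commute)
    also have "ennreal (1 / real q) * \<dots> = (\<integral>\<^sup>+\<zeta>. indicator ?F' \<zeta> * A N m (indicator (B (n + 1) k \<eta>)) \<zeta> \<partial>M)"
      by (rule flag_integral[OF N es(2) _ sat, symmetric]) measurable
    also have "\<dots> = (\<integral>\<^sup>+\<zeta>. indicator (B (n + 1) k \<eta>) \<zeta> * A N m (indicator ?F') \<zeta> \<partial>M)"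
      by (subst A_adjoint) (simp_all add: mult.commute)
    also have "ennreal (1 / real q) * \<dots> = (\<integral>\<^sup>+\<zeta>. indicator ?F \<zeta> * A N m (indicator ?F') \<zeta> \<partial>M)"
      by (rule flag_integral[OF N es(1) _ sat, symmetric]) measurable
    also have "\<dots> \<le> (\<integral>\<^sup>+\<zeta>. indicator (B n (k + 1) \<eta>) \<zeta> * A N m (indicator (B n (k + 1) \<eta>')) \<zeta> \<partial>M)"
      by (intro nn_integral_mono mult_mono A_mono) (auto simp: indicator_def)
    also have "ennreal (1 / real q) * (ennreal (1 / real q) * ennreal (s (n + 1) k ^ 2 / s (n + 1) m))
        = ennreal (s n (k + 1) ^ 2 / s n m)"
    proof -
      have "s (n + 1) k = s n (k + 1)" "s (n + 1) m = s n m / real q ^ 2" by (simp_all add: s_step)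
      then have "1 / real q * (1 / real q * (s (n + 1) k ^ 2 / s (n + 1) m)) = s n (k + 1) ^ 2 / s n m"
        using q_pos by (simp add: power2_eq_square)
      moreover have "0 \<le> s (n + 1) k ^ 2 / s (n + 1) m" by simp
      ultimately show ?thesis using q_pos by (simp add: ennreal_mult[symmetric])
    qed
    finally show ?thesis unfolding kj Beq .
  qed
qed

text \<open>\<open>W\<close> is the part of the block of \<open>\<omega>\<close> in general position
  to \<open>\<omega>\<close>. There \<open>kernel_bound\<close> makes the kernel of the outer three
  averages at least constant. Pairing it with \<open>A N m f\<close> loses nothing but a factor,
  since \<open>A N m\<close> turns the indicator of \<open>W\<close> into \<open>1 - 1 / q\<close>
  times that of the whole block.\<close>

lemma A_le_composition:
  assumes [measurable]: "f \<in> borel_measurable M" and w: "\<omega> \<in> space M" and N: "n \<le> N" and T: "m < T"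
  shows "A n m f \<omega> \<le> ennreal (real q / (real q - 1)) * A n T (A N m (A n T (A N m f))) \<omega>"
proof -
  let ?E = "indicator (B n T \<omega>) :: 'w \<Rightarrow> ennreal" and ?R = "A n T" and ?L = "A N m"
  define W where "W = B n m \<omega> - B (n - 1) (m + 1) \<omega>"
  have [measurable]: "B n m \<omega> \<in> sets M" "B (n - 1) (m + 1) \<omega> \<in> sets M" "B n T \<omega> \<in> sets M"
    using w by (auto intro: B_sets)
  have [measurable]: "W \<in> sets M" unfolding W_def by measurable
  have "(\<integral>\<^sup>+\<eta>. ennreal (s n T / s n m) * indicator W \<eta> * ?L f \<eta> \<partial>M) \<le> (\<integral>\<^sup>+\<eta>. ?R (?L ?E) \<eta> * ?L f \<eta> \<partial>M)"
  proof (intro nn_integral_mono mult_right_mono)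
    fix \<eta> assume e: "\<eta> \<in> space M"
    show "ennreal (s n T / s n m) * indicator W \<eta> \<le> ?R (?L ?E) \<eta>"
    proof (cases "\<eta> \<in> W")
      case True
      then have "x n m \<eta> = x n m \<omega>" "x (n - 1) (m + 1) \<eta> \<noteq> x (n - 1) (m + 1) \<omega>"
        using e by (auto simp: W_def B_mem)
      from kernel_bound[OF N e w this(1) disjI2[OF this(2)], of "nat (T - m)"] T
      have "ennreal (s n T ^ 2 / s n m) \<le> (\<integral>\<^sup>+\<zeta>. indicator (B n T \<eta>) \<zeta> * ?L ?E \<zeta> \<partial>M)" by simp
      then have "ennreal (s n T ^ 2 / s n m) / ennreal (s n T) \<le> ?R (?L ?E) \<eta>"
        unfolding A_eq[of n T] by (simp only: mult.commute divide_right_mono_ennreal)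
      moreover have "ennreal (s n T ^ 2 / s n m) / ennreal (s n T) = ennreal (s n T / s n m)"
        by (simp add: divide_ennreal power2_eq_square)
      ultimately show ?thesis using True by simp
    qed simp
  qed simp
  also have "\<dots> = (\<integral>\<^sup>+\<eta>. ?L ?E \<eta> * ?R (?L f) \<eta> \<partial>M)" by (rule A_adjoint[symmetric]) measurable
  also have "\<dots> = (\<integral>\<^sup>+\<eta>. ?E \<eta> * ?L (?R (?L f)) \<eta> \<partial>M)" by (rule A_adjoint[symmetric]) measurable
  also have "\<dots> = ennreal (s n T) * ?R (?L (?R (?L f))) \<omega>"
    unfolding A_eq[of n T "?L (?R (?L f))"]
    by (simp add: ennreal_mult_divide_cancel mult.commute)
  finally have 1: "(\<integral>\<^sup>+\<eta>. ennreal (s n T / s n m) * indicator W \<eta> * ?L f \<eta> \<partial>M) \<le> ennreal (s n T) * ?R (?L (?R (?L f))) \<omega>" .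
  \<comment> \<open>Every block over \<open>(N, m)\<close> inside \<open>B n m \<omega>\<close>
    loses exactly the share \<open>1 / q\<close> to the exceptional class, by
    \<open>flag_measure_far\<close>.\<close>
  have LW: "?L (indicator W) \<eta> = ennreal (1 - 1 / real q) * indicator (B n m \<omega>) \<eta>" if e: "\<eta> \<in> space M" for \<eta>
  proof (cases "\<eta> \<in> B n m \<omega>")
    case True
    have "B N m \<eta> \<subseteq> B n m \<omega>"
    proof
      fix \<zeta> assume "\<zeta> \<in> B N m \<eta>"
      then have "\<zeta> \<in> space M" "x N m \<zeta> = x N m \<eta>" by (simp_all add: B_mem)
      then show "\<zeta> \<in> B n m \<omega>" using mono[OF _ e _ N order_refl, of \<zeta> m] True by (simp add: B_mem)
    qed
    then have WB: "W \<inter> B N m \<eta> = B N m \<eta> - B (n - 1) (m + 1) \<omega> \<inter> B N m \<eta>" by (auto simp: W_def)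
    have fm: "B (n - 1) (m + 1) \<omega> \<inter> B N m \<eta> \<in> fmeasurable M" using e w by (intro fmeasurable.Int B_fmeasurable)
    have "measure M (B (n - 1) (m + 1) \<omega> \<inter> B N m \<eta>) = s N m / real q"
      using flag_measure_far[of "n - 1" N \<omega> \<eta> m] N w e True by (simp add: B_mem)
    then have "emeasure M (B (n - 1) (m + 1) \<omega> \<inter> B N m \<eta>) = ennreal (s N m / real q)"
      using fm by (simp add: emeasure_eq_measure2)
    then have "emeasure M (W \<inter> B N m \<eta>) = ennreal (s N m) - ennreal (s N m / real q)"
      unfolding WB using e by (subst emeasure_Diff) (auto simp: B_emeasure B_sets)
    also have "\<dots> = ennreal ((1 - 1 / real q) * s N m)"
      using q_pos by (subst ennreal_minus) (simp_all add: algebra_simps)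
    finally show ?thesis using True e q_gt1 by (simp add: A_indicator divide_ennreal)
  next
    case False
    have "W \<inter> B N m \<eta> = {}"
    proof (rule ccontr)
      assume "W \<inter> B N m \<eta> \<noteq> {}"
      then obtain \<zeta> where "\<zeta> \<in> space M" "x n m \<zeta> = x n m \<omega>" "x N m \<zeta> = x N m \<eta>" by (auto simp: W_def B_mem)
      then show False using mono[OF _ e _ N order_refl, of \<zeta> m] False e by (simp add: B_mem)
    qed
    then show ?thesis using False e by (simp add: A_indicator)
  qed
  have "(\<integral>\<^sup>+\<eta>. ennreal (s n T / s n m) * indicator W \<eta> * ?L f \<eta> \<partial>M) =
      ennreal (s n T / s n m) * (\<integral>\<^sup>+\<eta>. indicator W \<eta> * ?L f \<eta> \<partial>M)"
    unfolding mult.assoc by (rule nn_integral_cmult) measurable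
  also have "(\<integral>\<^sup>+\<eta>. indicator W \<eta> * ?L f \<eta> \<partial>M) = (\<integral>\<^sup>+\<eta>. ?L (indicator W) \<eta> * f \<eta> \<partial>M)"
    by (rule A_adjoint) measurable
  also have "\<dots> = (\<integral>\<^sup>+\<eta>. ennreal (1 - 1 / real q) * (f \<eta> * indicator (B n m \<omega>) \<eta>) \<partial>M)"
    by (intro nn_integral_cong) (simp add: LW mult_ac)
  also have "\<dots> = ennreal (1 - 1 / real q) * (\<integral>\<^sup>+\<eta>. f \<eta> * indicator (B n m \<omega>) \<eta> \<partial>M)"
    by (rule nn_integral_cmult) measurable
  also have "(\<integral>\<^sup>+\<eta>. f \<eta> * indicator (B n m \<omega>) \<eta> \<partial>M) = ennreal (s n m) * A n m f \<omega>"
    unfolding A_eq by (simp add: ennreal_mult_divide_cancel)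
  finally have "ennreal (s n T / s n m) * (ennreal (1 - 1 / real q) * (ennreal (s n m) * A n m f \<omega>))
      \<le> ennreal (s n T) * ?R (?L (?R (?L f))) \<omega>" using 1 by simp
  then have "ennreal (real q / (real q - 1) / s n T) * (ennreal (s n T / s n m) * (ennreal (1 - 1 / real q) * (ennreal (s n m) * A n m f \<omega>)))
      \<le> ennreal (real q / (real q - 1) / s n T) * (ennreal (s n T) * ?R (?L (?R (?L f))) \<omega>)"
    by (rule mult_left_mono) simp
  moreover have "ennreal (real q / (real q - 1) / s n T) * (ennreal (s n T / s n m) * (ennreal (1 - 1 / real q) * ennreal (s n m))) = 1"
    using q_gt1
    by (simp add: ennreal_mult[symmetric] field_simps)
  moreover have "ennreal (real q / (real q - 1) / s n T) * ennreal (s n T) = ennreal (real q / (real q - 1))"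
    using q_gt1 by (simp add: ennreal_mult[symmetric])
  ultimately show ?thesis by (metis (no_types, lifting) mult.assoc mult_1)
qed

theorem strong_maximal:
  assumes p: "1 < p"
  obtains C where "0 < C" "\<And>f. f \<in> borel_measurable M \<Longrightarrow>
    (\<integral>\<^sup>+\<omega>. ennreal_powr (SUP (n, m)\<in>UNIV. A n m f \<omega>) p \<partial>M) \<le> ennreal C * (\<integral>\<^sup>+\<omega>. ennreal_powr (f \<omega>) p \<partial>M)"
proof -
  define c where "c = real q / (real q - 1)"
  define D where "D = 2 powr p * p / (p - 1)"
  have c: "0 < c" using q_gt1 by (simp add: c_def)
  have D: "0 < D" using p by (simp add: D_def)
  have sf: "sigma_finite_measure M" by (rule uniform_partition.sigma_finite[OF uniform_partition])
  define G where "G f K \<omega> = (SUP (n, m)\<in>{- int K..int K} \<times> {- int K..int K}. A n m f \<omega>)" for f K \<omega>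
  have G_meas [measurable]: "G f K \<in> borel_measurable M" for f K
    unfolding G_def[abs_def] by (intro borel_measurable_SUP) (auto intro: countable_finite)
  have bound: "(\<integral>\<^sup>+\<omega>. ennreal_powr (G f K \<omega>) p \<partial>M) \<le> ennreal (c powr p * D ^ 4) * (\<integral>\<^sup>+\<omega>. ennreal_powr (f \<omega>) p \<partial>M)"
    if [measurable]: "f \<in> borel_measurable M" for f K
  proof -
    \<comment> \<open>One beyond the box, since \<open>A_le_composition\<close> requires
      \<open>m < T\<close>. The same value serves as \<open>N\<close>, and the bound does not depend
      on \<open>K\<close>.\<close>
    define T where "T = int K + 1"
    let ?I = "{- int K..int K}"
    interpret R: partition_chain M ?I "\<lambda>n. x n T" "\<lambda>n. s n T"
      by (rule partition_chain.intro) (auto intro: uniform_partition mono)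
    interpret L: partition_chain M ?I "\<lambda>m. x T m" "\<lambda>m. s T m"
      by (rule partition_chain.intro) (auto intro: uniform_partition mono)
    have Rle: "A n T g \<omega> \<le> R.maxf g \<omega>" if "n \<in> ?I" for n g \<omega>
      unfolding R.maxf_def by (rule SUP_upper[OF that])
    have Lle: "A T m g \<omega> \<le> L.maxf g \<omega>" if "m \<in> ?I" for m g \<omega>
      unfolding L.maxf_def by (rule SUP_upper[OF that])
    have le: "G f K \<omega> \<le> ennreal c * R.maxf (L.maxf (R.maxf (L.maxf f))) \<omega>" if w: "\<omega> \<in> space M" for \<omega>
      unfolding G_def
    proof (rule SUP_least, clarify)
      fix n m assume nm: "n \<in> ?I" "m \<in> ?I"
      have "A n m f \<omega> \<le> ennreal c * A n T (A T m (A n T (A T m f))) \<omega>"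
        unfolding c_def using nm w by (intro A_le_composition) (auto simp: T_def)
      also have "\<dots> \<le> ennreal c * R.maxf (L.maxf (R.maxf (L.maxf f))) \<omega>"
        by (intro mult_left_mono order_trans[OF A_mono Rle] order_trans[OF A_mono Lle] Lle nm) simp_all
      finally show "A n m f \<omega> \<le> ennreal c * R.maxf (L.maxf (R.maxf (L.maxf f))) \<omega>" .
    qed
    have "(\<integral>\<^sup>+\<omega>. ennreal_powr (G f K \<omega>) p \<partial>M) \<le>
        (\<integral>\<^sup>+\<omega>. ennreal (c powr p) * ennreal_powr (R.maxf (L.maxf (R.maxf (L.maxf f))) \<omega>) p \<partial>M)"
    proof (rule nn_integral_mono)
      fix \<omega> assume "\<omega> \<in> space M"
      from ennreal_powr_mono[OF le[OF this], of p]
      show "ennreal_powr (G f K \<omega>) p \<le> ennreal (c powr p) * ennreal_powr (R.maxf (L.maxf (R.maxf (L.maxf f))) \<omega>) p"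
        using p c by (simp add: ennreal_powr_mult)
    qed
    also have "\<dots> = ennreal (c powr p) * (\<integral>\<^sup>+\<omega>. ennreal_powr (R.maxf (L.maxf (R.maxf (L.maxf f))) \<omega>) p \<partial>M)"
      by (rule nn_integral_cmult) measurable
    also have "(\<integral>\<^sup>+\<omega>. ennreal_powr (R.maxf (L.maxf (R.maxf (L.maxf f))) \<omega>) p \<partial>M) \<le>
        ennreal D * (ennreal D * (ennreal D * (ennreal D * (\<integral>\<^sup>+\<omega>. ennreal_powr (f \<omega>) p \<partial>M))))"
      unfolding D_def
      by (intro order_trans[OF R.doob] order_trans[OF L.doob] mult_left_mono p sf order_refl) measurable
    also have "ennreal (c powr p) * \<dots> = ennreal (c powr p * D ^ 4) * (\<integral>\<^sup>+\<omega>. ennreal_powr (f \<omega>) p \<partial>M)"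
      using D by (simp add: ennreal_mult ennreal_power[symmetric] power4_eq_xxxx mult_ac)
    finally show ?thesis by (simp add: mult_left_mono)
  qed
  show thesis
  proof (rule that[of "c powr p * D ^ 4"])
    show "0 < c powr p * D ^ 4" using c D by simp
    fix f :: "'w \<Rightarrow> ennreal" assume f [measurable]: "f \<in> borel_measurable M"
    have "(SUP (n, m)\<in>UNIV. A n m f \<omega>) \<le> (SUP K. G f K \<omega>)" for \<omega>
    proof (rule SUP_least, clarify)
      fix n m :: int
      have "A n m f \<omega> \<le> G f (nat \<bar>n\<bar> + nat \<bar>m\<bar>) \<omega>"
        unfolding G_def by (rule SUP_upper2[of "(n, m)"]) auto
      also have "\<dots> \<le> (SUP K. G f K \<omega>)" by (rule SUP_upper) simp
      finally show "A n m f \<omega> \<le> (SUP K. G f K \<omega>)" .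
    qed
    then have "(\<integral>\<^sup>+\<omega>. ennreal_powr (SUP (n, m)\<in>UNIV. A n m f \<omega>) p \<partial>M) \<le>
        (\<integral>\<^sup>+\<omega>. (SUP K. ennreal_powr (G f K \<omega>) p) \<partial>M)"
      using p by (intro nn_integral_mono order_trans[OF ennreal_powr_mono ennreal_powr_Sup]) auto
    also have "\<dots> = (SUP K. \<integral>\<^sup>+\<omega>. ennreal_powr (G f K \<omega>) p \<partial>M)"
    proof (rule nn_integral_monotone_convergence_SUP)
      show "incseq (\<lambda>K \<omega>. ennreal_powr (G f K \<omega>) p)"
        unfolding incseq_def le_fun_def G_def using p
        by (intro allI impI ennreal_powr_mono SUP_subset_mono) auto
    qed measurable
    also have "\<dots> \<le> ennreal (c powr p * D ^ 4) * (\<integral>\<^sup>+\<omega>. ennreal_powr (f \<omega>) p \<partial>M)"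
      by (rule SUP_least) (rule bound[OF f])
    finally show "(\<integral>\<^sup>+\<omega>. ennreal_powr (SUP (n, m)\<in>UNIV. A n m f \<omega>) p \<partial>M) \<le>
        ennreal (c powr p * D ^ 4) * (\<integral>\<^sup>+\<omega>. ennreal_powr (f \<omega>) p \<partial>M)" .
  qed
qed

end

section \<open>The two-parameter partition of the boundary\<close>

locale pointed_building = triangle_building X t Apts q
  for X :: "'v set set" and t :: "'v \<Rightarrow> (real^3) set" and Apts :: "'v set set set" and q :: nat +
  fixes \<omega>0 :: "'v boundary_point" and S0 :: "'v point set" and A0 :: "'v set set"
    and \<psi> :: "'v \<Rightarrow> real^3" and \<rho>0 :: "'v \<Rightarrow> 'v" and \<pi> :: "'v boundary_point measure"
  assumes \<omega>0: "\<omega>0 \<in> boundary t Apts"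
    and S0: "S0 \<in> \<omega>0"
    and A0: "A0 \<in> Apts" "S0 \<subseteq> realization A0"
    and \<psi>: "chart t A0 \<psi>" "extend_affine \<psi> ` S0 = uminus ` base_sector"
    and \<rho>0: "retraction_from_sector t Apts S0 A0 \<rho>0"
    and \<pi>: "boundary_measure X t Apts q \<omega>0 (\<psi> \<circ> \<rho>0) \<pi>"
begin

abbreviation \<Omega> :: "'v boundary_point set" where
  "\<Omega> \<equiv> opposite_set t Apts \<omega>0"

abbreviation ap :: "'v boundary_point \<Rightarrow> 'v set set" where
  "ap \<omega> \<equiv> apartment_between t Apts \<omega> \<omega>0"

abbreviation zc :: "'v \<Rightarrow> int \<times> int" where
  "zc \<equiv> coord \<circ> (\<psi> \<circ> \<rho>0)"

text \<open>The same map \<open>zc\<close> is a chart of all the apartments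
  \<open>[\<omega>, \<omega>0]\<close>, so the position of a common vertex does not depend on the
  apartment.\<close>

definition vtx :: "int \<Rightarrow> int \<Rightarrow> 'v boundary_point \<Rightarrow> 'v" where
  "vtx n m \<omega> = inv_into (\<Union>(ap \<omega>)) zc (n, m)"

lemma ap:
  assumes "\<omega> \<in> \<Omega>"
  shows "ap \<omega> \<in> Apts" "joins t (ap \<omega>) \<omega> \<omega>0"
proof -
  have "\<exists>!A. A \<in> Apts \<and> joins t A \<omega> \<omega>0" using assms by (simp add: opposite_set_def opposite_def)
  from theI'[OF this] show "ap \<omega> \<in> Apts" "joins t (ap \<omega>) \<omega> \<omega>0"
    unfolding apartment_between_def by auto
qed

lemma ap_subsector:
  assumes "\<omega> \<in> \<Omega>"
  obtains U where "U \<in> sectors t Apts" "U \<subseteq> S0" "U \<subseteq> realization (ap \<omega>)"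
proof -
  obtain S y where S: "S \<in> \<omega>0" "sector_in t (ap \<omega>) y S" using ap(2)[OF assms] by (auto simp: joins_def)
  obtain U where U: "U \<in> sectors t Apts" "U \<subseteq> S" "U \<subseteq> S0"
    using boundary_common_subsector[OF \<omega>0 S(1) S0] by metis
  have "S \<subseteq> realization (ap \<omega>)" using S(2) by (auto simp: sector_in_def)
  with U that show thesis by blast
qed

lemma ap_retraction:
  assumes w: "\<omega> \<in> \<Omega>"
  shows "type_iso t t (ap \<omega>) A0 \<rho>0" "v \<in> \<Union>(ap \<omega>) \<Longrightarrow> v \<in> \<Union>A0 \<Longrightarrow> \<rho>0 v = v"
proof -
  obtain U where "U \<in> sectors t Apts" "U \<subseteq> S0" "U \<subseteq> realization (ap \<omega>)" using ap_subsector[OF w] .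
  then have "type_iso t t (ap \<omega>) A0 \<rho>0 \<and> (\<forall>v\<in>\<Union>(ap \<omega>) \<inter> \<Union>A0. \<rho>0 v = v)"
    using \<rho>0 ap(1)[OF w] unfolding retraction_from_sector_def by blast
  then show "type_iso t t (ap \<omega>) A0 \<rho>0" "v \<in> \<Union>(ap \<omega>) \<Longrightarrow> v \<in> \<Union>A0 \<Longrightarrow> \<rho>0 v = v" by auto
qed

lemma ap_chart:
  assumes w: "\<omega> \<in> \<Omega>"
  shows "chart t (ap \<omega>) (\<psi> \<circ> \<rho>0)"
proof -
  have r: "bij_betw \<rho>0 (\<Union>(ap \<omega>)) (\<Union>A0)" "(\<lambda>s. \<rho>0 ` s) ` ap \<omega> = A0" "\<forall>v\<in>\<Union>(ap \<omega>). t (\<rho>0 v) = t v"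
    using ap_retraction(1)[OF w] by (auto simp: type_iso_def)
  have p: "bij_betw \<psi> (\<Union>A0) (\<Union>cox_complex)" "(\<lambda>s. \<psi> ` s) ` A0 = cox_complex" "\<forall>v\<in>\<Union>A0. cox_type (\<psi> v) = t v"
    using \<psi>(1) by (auto simp: type_iso_def)
  have "bij_betw (\<psi> \<circ> \<rho>0) (\<Union>(ap \<omega>)) (\<Union>cox_complex)" using r(1) p(1) by (rule bij_betw_trans)
  moreover have "(\<lambda>s. (\<psi> \<circ> \<rho>0) ` s) ` ap \<omega> = cox_complex"
    unfolding p(2)[symmetric] r(2)[symmetric] by (simp add: image_image image_comp)
  moreover have "cox_type ((\<psi> \<circ> \<rho>0) v) = t v" if "v \<in> \<Union>(ap \<omega>)" for v
  proof -
    have "\<rho>0 v \<in> \<Union>A0" using bij_betwE[OF r(1)] that by blast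
    then have "cox_type (\<psi> (\<rho>0 v)) = t (\<rho>0 v)" using p(3) by blast
    also have "\<dots> = t v" using r(3) that by blast
    finally show ?thesis by simp
  qed
  ultimately show ?thesis unfolding type_iso_def by blast
qed

lemma ap_zchart: "\<omega> \<in> \<Omega> \<Longrightarrow> zchart (ap \<omega>) zc"
  by (rule chart_zchart[OF ap_chart])

lemma vtx: "\<omega> \<in> \<Omega> \<Longrightarrow> vtx n m \<omega> \<in> \<Union>(ap \<omega>)" "\<omega> \<in> \<Omega> \<Longrightarrow> zc (vtx n m \<omega>) = (n, m)"
  unfolding vtx_def using zchart_inv_mem[OF ap_zchart] zchart_inv[OF ap_zchart] by blast+

lemma vtx_unique: "\<omega> \<in> \<Omega> \<Longrightarrow> v \<in> \<Union>(ap \<omega>) \<Longrightarrow> zc v = (n, m) \<Longrightarrow> vtx n m \<omega> = v"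
  unfolding vtx_def using zchart_inv_left[OF ap_zchart, of \<omega> v] by simp

lemma vtx_eq_iff:
  assumes "\<omega> \<in> \<Omega>" "\<omega>' \<in> \<Omega>"
  shows "vtx n m \<omega> = vtx n m \<omega>' \<longleftrightarrow> (n, m) \<in> zc ` (\<Union>(ap \<omega>) \<inter> \<Union>(ap \<omega>'))"
proof
  assume eq: "vtx n m \<omega> = vtx n m \<omega>'"
  have "vtx n m \<omega> \<in> \<Union>(ap \<omega>) \<inter> \<Union>(ap \<omega>')" using vtx(1)[OF assms(1), of n m] vtx(1)[OF assms(2), of n m] eq by simp
  from imageI[OF this, of zc] show "(n, m) \<in> zc ` (\<Union>(ap \<omega>) \<inter> \<Union>(ap \<omega>'))"
    unfolding vtx(2)[OF assms(1)] .
next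
  assume "(n, m) \<in> zc ` (\<Union>(ap \<omega>) \<inter> \<Union>(ap \<omega>'))"
  then obtain v where v: "(n, m) = zc v" "v \<in> \<Union>(ap \<omega>) \<inter> \<Union>(ap \<omega>')" by (rule imageE)
  then show "vtx n m \<omega> = vtx n m \<omega>'"
    using vtx_unique[OF assms(1) IntD1[OF v(2)] v(1)[symmetric]]
      vtx_unique[OF assms(2) IntD2[OF v(2)] v(1)[symmetric]] by (simp only:)
qed

lemma vtx_neq: "\<omega> \<in> \<Omega> \<Longrightarrow> \<omega>' \<in> \<Omega> \<Longrightarrow> (n, m) \<noteq> (i, j) \<Longrightarrow> vtx n m \<omega> \<noteq> vtx i j \<omega>'"
  using vtx(2)[of \<omega> n m] vtx(2)[of \<omega>' i j] by auto

text \<open>\<open>\<psi>\<close> maps \<open>S0\<close> to the negative of the base sector, so a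
  subsector of \<open>S0\<close> contains all vertices with both coordinates below some bound. Those
  in the apartment of \<open>\<omega>\<close> are fixed by \<open>\<rho>0\<close>, so both charts
  agree there.\<close>

lemma ap_tail:
  assumes w: "\<omega> \<in> \<Omega>"
  obtains k where "\<And>i j. i \<le> k \<Longrightarrow> j \<le> k \<Longrightarrow> \<exists>v\<in>\<Union>(ap \<omega>) \<inter> \<Union>A0. coord (\<psi> v) = (i, j) \<and> zc v = (i, j)"
proof -
  let ?z0 = "coord \<circ> \<psi>"
  have z0: "zchart A0 ?z0" by (rule chart_zchart[OF \<psi>(1)])
  have hp: "hex_pair (-1, 0) (0, -1)" by (simp add: hex_pair_def hex_def)
  have mem: "z \<in> zsector p (-1, 0) (0, -1) \<longleftrightarrow> fst z < fst p \<and> snd z < snd p" for z p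
    unfolding zsector_iff[OF hp] by (auto simp: pair_coords_def)
  obtain U where U: "U \<in> sectors t Apts" "U \<subseteq> S0" "U \<subseteq> realization (ap \<omega>)" using ap_subsector[OF w] .
  have neg: "?z0 v \<in> zsector (0, 0) (-1, 0) (0, -1)" if v: "vpoint v \<in> U" for v
  proof -
    have "v \<in> \<Union>A0" using v U(2) A0(2) vpoint_zchart[OF z0, of v] by blast
    then have e: "\<psi> v = wt (coord (\<psi> v))" by (rule chart_wt[OF \<psi>(1)])
    have "extend_affine \<psi> (vpoint v) \<in> uminus ` base_sector" using \<psi>(2) v U(2) by blast
    then have "\<psi> v \<bullet> alpha1 < 0" "\<psi> v \<bullet> alpha2 < 0" by (auto simp: base_sector_def)
    then show ?thesis unfolding mem by (simp add: coord_def)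
  qed
  obtain p where p: "\<And>v. vpoint v \<in> U \<longleftrightarrow> v \<in> \<Union>A0 \<and> ?z0 v \<in> zsector p (-1, 0) (0, -1)"
    using subsector_direction[OF A0(1) z0 U(1) _ neg hp] U(2) A0(2) by blast
  show thesis
  proof (rule that[of "min (fst p) (snd p) - 1"])
    fix i j assume ij: "i \<le> min (fst p) (snd p) - 1" "j \<le> min (fst p) (snd p) - 1"
    define v where "v = inv_into (\<Union>A0) ?z0 (i, j)"
    have v: "v \<in> \<Union>A0" "?z0 v = (i, j)" unfolding v_def using zchart_inv_mem[OF z0] zchart_inv[OF z0] by auto
    then have "vpoint v \<in> U" unfolding p mem using ij by simp
    then have va: "v \<in> \<Union>(ap \<omega>)" using U(3) vpoint_zchart[OF ap_zchart[OF w], of v] by blast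
    then have "\<rho>0 v = v" using ap_retraction(2)[OF w] v by blast
    with v va show "\<exists>v\<in>\<Union>(ap \<omega>) \<inter> \<Union>A0. coord (\<psi> v) = (i, j) \<and> zc v = (i, j)" by (intro bexI[of _ v]) auto
  qed
qed

lemma common_tail:
  assumes w: "\<omega> \<in> \<Omega>" "\<omega>' \<in> \<Omega>"
  obtains k where "\<And>i j. i \<le> k \<Longrightarrow> j \<le> k \<Longrightarrow> (i, j) \<in> zc ` (\<Union>(ap \<omega>) \<inter> \<Union>(ap \<omega>'))"
proof -
  obtain k where k: "\<And>i j. i \<le> k \<Longrightarrow> j \<le> k \<Longrightarrow> \<exists>v\<in>\<Union>(ap \<omega>) \<inter> \<Union>A0. coord (\<psi> v) = (i, j) \<and> zc v = (i, j)"
    using ap_tail[OF w(1)] by metis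
  obtain k' where k': "\<And>i j. i \<le> k' \<Longrightarrow> j \<le> k' \<Longrightarrow> \<exists>v\<in>\<Union>(ap \<omega>') \<inter> \<Union>A0. coord (\<psi> v) = (i, j) \<and> zc v = (i, j)"
    using ap_tail[OF w(2)] by metis
  show thesis
  proof (rule that[of "min k k'"])
    fix i j assume ij: "i \<le> min k k'" "j \<le> min k k'"
    then obtain v where v: "v \<in> \<Union>(ap \<omega>)" "v \<in> \<Union>A0" "coord (\<psi> v) = (i, j)" "zc v = (i, j)" using k[of i j] by auto
    obtain v' where v': "v' \<in> \<Union>(ap \<omega>')" "v' \<in> \<Union>A0" "coord (\<psi> v') = (i, j)" using ij k'[of i j] by auto
    have "v = v'" using inj_onD[OF zchart_inj[OF chart_zchart[OF \<psi>(1)]], of v v'] v v' by simp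
    then have "v \<in> \<Union>(ap \<omega>) \<inter> \<Union>(ap \<omega>')" using v(1) v'(1) by blast
    then show "(i, j) \<in> zc ` (\<Union>(ap \<omega>) \<inter> \<Union>(ap \<omega>'))" using imageI[of v _ zc] unfolding v(4) by blast
  qed
qed

lemma vtx_tail: "\<omega> \<in> \<Omega> \<Longrightarrow> \<omega>' \<in> \<Omega> \<Longrightarrow> \<exists>k. vtx k k \<omega> = vtx k k \<omega>'"
  using common_tail[of \<omega> \<omega>'] vtx_eq_iff by (metis order_refl)

lemma vtx_mono:
  assumes w: "\<omega> \<in> \<Omega>" "\<omega>' \<in> \<Omega>" and eq: "vtx n m \<omega> = vtx n m \<omega>'"
  shows "vtx (n - 1) m \<omega> = vtx (n - 1) m \<omega>'" "vtx n (m - 1) \<omega> = vtx n (m - 1) \<omega>'"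
proof -
  obtain k where k: "\<And>i j. i \<le> k \<Longrightarrow> j \<le> k \<Longrightarrow> (i, j) \<in> zc ` (\<Union>(ap \<omega>) \<inter> \<Union>(ap \<omega>'))"
    using common_tail[OF w] by metis
  have nm: "(n, m) \<in> zc ` (\<Union>(ap \<omega>) \<inter> \<Union>(ap \<omega>'))" using eq vtx_eq_iff[OF w] by simp
  show "vtx (n - 1) m \<omega> = vtx (n - 1) m \<omega>'" "vtx n (m - 1) \<omega> = vtx n (m - 1) \<omega>'"
    unfolding vtx_eq_iff[OF w]
    using apartments_share_cone[OF ap(1)[OF w(1)] ap_zchart[OF w(1)] ap(1)[OF w(2)] ap_zchart[OF w(2)] refl nm k]
    by simp_all
qed

lemma vtx_mono1: "\<omega> \<in> \<Omega> \<Longrightarrow> \<omega>' \<in> \<Omega> \<Longrightarrow> vtx (n + 1) m \<omega> = vtx (n + 1) m \<omega>' \<Longrightarrow> vtx n m \<omega> = vtx n m \<omega>'"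
  and vtx_mono2: "\<omega> \<in> \<Omega> \<Longrightarrow> \<omega>' \<in> \<Omega> \<Longrightarrow> vtx n (m + 1) \<omega> = vtx n (m + 1) \<omega>' \<Longrightarrow> vtx n m \<omega> = vtx n m \<omega>'"
  using vtx_mono(1)[of \<omega> \<omega>' "n + 1" m] vtx_mono(2)[of \<omega> \<omega>' n "m + 1"] by simp_all

section \<open>The links of the vertices \<open>vtx n m\<close>\<close>

lemma vtx_triangle:
  assumes w: "\<omega> \<in> \<Omega>"
  shows "{vtx n m \<omega>, vtx (n + 1) m \<omega>, vtx n (m + 1) \<omega>} \<in> X"
    "{vtx (n + 1) m \<omega>, vtx n (m + 1) \<omega>, vtx (n + 1) (m + 1) \<omega>} \<in> X"
proof -
  have "inv_into (\<Union>(ap \<omega>)) zc ` T \<in> X" if "T \<in> triangles" for T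
    using zchart_inv_simplex[OF ap_zchart[OF w] triangle_in_complex[OF that]] apartment_subcomplex[OF ap(1)[OF w]] by blast
  from this[OF up_triangle[of n m]] this[OF down_triangle[of n m]]
  show "{vtx n m \<omega>, vtx (n + 1) m \<omega>, vtx n (m + 1) \<omega>} \<in> X"
    "{vtx (n + 1) m \<omega>, vtx n (m + 1) \<omega>, vtx (n + 1) (m + 1) \<omega>} \<in> X"
    by (simp_all add: up_def down_def vtx_def)
qed

text \<open>In the uses below \<open>a\<close> is the vertex on the side of
  \<open>\<omega>0\<close>, which lies over another weight than the vertices counted in
  \<open>F\<close>.\<close>

lemma third_vertices_but_one:
  assumes a: "{u, v, a} \<in> X" "a \<notin> {u, v}" "u \<noteq> v"
    and F: "\<And>w. w \<in> F \<Longrightarrow> {u, v, w} \<in> X \<and> w \<notin> {u, v} \<and> w \<noteq> a"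
  shows "finite F \<and> card F \<le> q"
proof -
  have e: "{u, v} \<in> X" by (rule face[OF a(1)]) auto
  note t = third_vertices[OF e a(3)]
  have sub: "insert a F \<subseteq> {w. {u, v, w} \<in> X \<and> w \<notin> {u, v}}" using a F by blast
  then have fin: "finite F" using finite_subset[OF _ t(1)] by simp
  have "card (insert a F) \<le> q + 1" using card_mono[OF t(1) sub] t(2) by linarith
  moreover have "a \<notin> F" using F by blast
  ultimately show ?thesis using fin by simp
qed

lemma vtx_fiber:
  assumes w: "\<omega> \<in> \<Omega>"
  shows "finite (vtx (n + 1) (m + 1) ` {\<omega>' \<in> \<Omega>. vtx (n + 1) m \<omega>' = vtx (n + 1) m \<omega> \<and> vtx n (m + 1) \<omega>' = vtx n (m + 1) \<omega>}) \<and>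
      card (vtx (n + 1) (m + 1) ` {\<omega>' \<in> \<Omega>. vtx (n + 1) m \<omega>' = vtx (n + 1) m \<omega> \<and> vtx n (m + 1) \<omega>' = vtx n (m + 1) \<omega>}) \<le> q"
proof (rule third_vertices_but_one)
  show "{vtx (n + 1) m \<omega>, vtx n (m + 1) \<omega>, vtx n m \<omega>} \<in> X"
    using vtx_triangle(1)[OF w, of n m] by (simp add: insert_commute)
  show "vtx n m \<omega> \<notin> {vtx (n + 1) m \<omega>, vtx n (m + 1) \<omega>}" "vtx (n + 1) m \<omega> \<noteq> vtx n (m + 1) \<omega>"
    using vtx_neq[OF w w] by simp_all
  fix v assume "v \<in> vtx (n + 1) (m + 1) ` {\<omega>' \<in> \<Omega>. vtx (n + 1) m \<omega>' = vtx (n + 1) m \<omega> \<and> vtx n (m + 1) \<omega>' = vtx n (m + 1) \<omega>}"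
  then obtain \<omega>' where w': "\<omega>' \<in> \<Omega>" "vtx (n + 1) m \<omega>' = vtx (n + 1) m \<omega>" "vtx n (m + 1) \<omega>' = vtx n (m + 1) \<omega>"
    "v = vtx (n + 1) (m + 1) \<omega>'" by blast
  show "{vtx (n + 1) m \<omega>, vtx n (m + 1) \<omega>, v} \<in> X \<and> v \<notin> {vtx (n + 1) m \<omega>, vtx n (m + 1) \<omega>} \<and> v \<noteq> vtx n m \<omega>"
    using vtx_triangle(2)[OF w'(1), of n m] vtx_neq[OF w'(1) w] w' by simp
qed

text \<open>The vertex over \<open>(n + 1, m)\<close> determines the one over \<open>(n, m)\<close>,
  hence the edge across which the candidates are counted.\<close>

lemma vtx_fiber1:
  assumes w: "\<omega> \<in> \<Omega>"
  shows "finite (vtx n (m + 1) ` {\<omega>' \<in> \<Omega>. vtx (n + 1) m \<omega>' = vtx (n + 1) m \<omega>}) \<and>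
    card (vtx n (m + 1) ` {\<omega>' \<in> \<Omega>. vtx (n + 1) m \<omega>' = vtx (n + 1) m \<omega>}) \<le> q"
proof (rule third_vertices_but_one)
  show "{vtx n m \<omega>, vtx (n + 1) m \<omega>, vtx (n + 1) (m - 1) \<omega>} \<in> X"
    using vtx_triangle(2)[OF w, of n "m - 1"] by (simp add: insert_commute)
  show "vtx (n + 1) (m - 1) \<omega> \<notin> {vtx n m \<omega>, vtx (n + 1) m \<omega>}" "vtx n m \<omega> \<noteq> vtx (n + 1) m \<omega>"
    using vtx_neq[OF w w] by simp_all
  fix v assume "v \<in> vtx n (m + 1) ` {\<omega>' \<in> \<Omega>. vtx (n + 1) m \<omega>' = vtx (n + 1) m \<omega>}"
  then obtain \<omega>' where w': "\<omega>' \<in> \<Omega>" "vtx (n + 1) m \<omega>' = vtx (n + 1) m \<omega>" "v = vtx n (m + 1) \<omega>'" by blast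
  have "vtx n m \<omega>' = vtx n m \<omega>" by (rule vtx_mono1[OF w'(1) w w'(2)])
  then show "{vtx n m \<omega>, vtx (n + 1) m \<omega>, v} \<in> X \<and> v \<notin> {vtx n m \<omega>, vtx (n + 1) m \<omega>} \<and> v \<noteq> vtx (n + 1) (m - 1) \<omega>"
    using vtx_triangle(1)[OF w'(1), of n m] vtx_neq[OF w'(1) w] w' by simp
qed

lemma vtx_fiber2:
  assumes w: "\<omega> \<in> \<Omega>"
  shows "finite (vtx (n + 1) m ` {\<omega>' \<in> \<Omega>. vtx n (m + 1) \<omega>' = vtx n (m + 1) \<omega>}) \<and>
    card (vtx (n + 1) m ` {\<omega>' \<in> \<Omega>. vtx n (m + 1) \<omega>' = vtx n (m + 1) \<omega>}) \<le> q"
proof (rule third_vertices_but_one)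
  show "{vtx n m \<omega>, vtx n (m + 1) \<omega>, vtx (n - 1) (m + 1) \<omega>} \<in> X"
    using vtx_triangle(2)[OF w, of "n - 1" m] by (simp add: insert_commute)
  show "vtx (n - 1) (m + 1) \<omega> \<notin> {vtx n m \<omega>, vtx n (m + 1) \<omega>}" "vtx n m \<omega> \<noteq> vtx n (m + 1) \<omega>"
    using vtx_neq[OF w w] by simp_all
  fix v assume "v \<in> vtx (n + 1) m ` {\<omega>' \<in> \<Omega>. vtx n (m + 1) \<omega>' = vtx n (m + 1) \<omega>}"
  then obtain \<omega>' where w': "\<omega>' \<in> \<Omega>" "vtx n (m + 1) \<omega>' = vtx n (m + 1) \<omega>" "v = vtx (n + 1) m \<omega>'" by blast
  have "vtx n m \<omega>' = vtx n m \<omega>" by (rule vtx_mono2[OF w'(1) w w'(2)])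
  then show "{vtx n m \<omega>, vtx n (m + 1) \<omega>, v} \<in> X \<and> v \<notin> {vtx n m \<omega>, vtx n (m + 1) \<omega>} \<and> v \<noteq> vtx (n - 1) (m + 1) \<omega>"
    using vtx_triangle(1)[OF w'(1), of n m] vtx_neq[OF w'(1) w] w' by (simp add: insert_commute)
qed

text \<open>By monotonicity all four apartments have the same vertex over \<open>(n, m)\<close>, and
  the labels form a 4-cycle in its link.\<close>

lemma vtx_girth:
  assumes w: "\<omega>1 \<in> \<Omega>" "\<omega>2 \<in> \<Omega>" "\<omega>3 \<in> \<Omega>" "\<omega>4 \<in> \<Omega>"
    and e: "vtx n (m + 1) \<omega>1 = vtx n (m + 1) \<omega>2" "vtx n (m + 1) \<omega>3 = vtx n (m + 1) \<omega>4"
      "vtx (n + 1) m \<omega>1 = vtx (n + 1) m \<omega>3" "vtx (n + 1) m \<omega>2 = vtx (n + 1) m \<omega>4"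
  shows "vtx n (m + 1) \<omega>1 = vtx n (m + 1) \<omega>3 \<or> vtx (n + 1) m \<omega>1 = vtx (n + 1) m \<omega>2"
proof (rule link_girth)
  have x: "vtx n m \<omega>2 = vtx n m \<omega>1" "vtx n m \<omega>3 = vtx n m \<omega>1" "vtx n m \<omega>4 = vtx n m \<omega>1"
    using vtx_mono2[OF w(1,2) e(1)] vtx_mono2[OF w(3,4) e(2)] vtx_mono1[OF w(1,3) e(3)] by simp_all
  show "{vtx n m \<omega>1, vtx n (m + 1) \<omega>1, vtx (n + 1) m \<omega>1} \<in> X"
    "{vtx n m \<omega>1, vtx n (m + 1) \<omega>3, vtx (n + 1) m \<omega>1} \<in> X"
    "{vtx n m \<omega>1, vtx n (m + 1) \<omega>1, vtx (n + 1) m \<omega>2} \<in> X"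
    "{vtx n m \<omega>1, vtx n (m + 1) \<omega>3, vtx (n + 1) m \<omega>2} \<in> X"
    using vtx_triangle(1)[OF w(1), of n m] vtx_triangle(1)[OF w(2), of n m]
      vtx_triangle(1)[OF w(3), of n m] vtx_triangle(1)[OF w(4), of n m]
    by (simp_all add: x e insert_commute)
  show "vtx n m \<omega>1 \<notin> {vtx n (m + 1) \<omega>1, vtx n (m + 1) \<omega>3, vtx (n + 1) m \<omega>1, vtx (n + 1) m \<omega>2}"
    "vtx n (m + 1) \<omega>1 \<notin> {vtx (n + 1) m \<omega>1, vtx (n + 1) m \<omega>2}"
    "vtx n (m + 1) \<omega>3 \<notin> {vtx (n + 1) m \<omega>1, vtx (n + 1) m \<omega>2}"
    using vtx_neq w by simp_all
qed

text \<open>In the link of the vertex over \<open>(n + 1, m)\<close>, any candidate is adjacent to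
  the vertices over \<open>(n, m + 1)\<close> and \<open>(n + 2, m)\<close>, so two candidates would
  form a 4-cycle.\<close>

lemma vtx_rigid1:
  assumes w: "\<omega> \<in> \<Omega>" "\<omega>' \<in> \<Omega>" and e: "vtx n (m + 1) \<omega> = vtx n (m + 1) \<omega>'" "vtx (n + 2) m \<omega> = vtx (n + 2) m \<omega>'"
  shows "vtx (n + 1) (m + 1) \<omega> = vtx (n + 1) (m + 1) \<omega>'"
proof -
  have two: "n + 1 + 1 = n + 2" by simp
  have x: "vtx (n + 1) m \<omega> = vtx (n + 1) m \<omega>'" using vtx_mono1[OF w, of "n + 1" m] e(2) by (simp add: add.commute)
  have "vtx (n + 1) (m + 1) \<omega> = vtx (n + 1) (m + 1) \<omega>' \<or> vtx n (m + 1) \<omega> = vtx (n + 2) m \<omega>"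
  proof (rule link_girth)
    show "{vtx (n + 1) m \<omega>, vtx (n + 1) (m + 1) \<omega>, vtx n (m + 1) \<omega>} \<in> X"
      using vtx_triangle(2)[OF w(1), of n m] by (simp add: insert_commute)
    show "{vtx (n + 1) m \<omega>, vtx (n + 1) (m + 1) \<omega>', vtx n (m + 1) \<omega>} \<in> X"
      using vtx_triangle(2)[OF w(2), of n m] by (simp add: insert_commute x e)
    show "{vtx (n + 1) m \<omega>, vtx (n + 1) (m + 1) \<omega>, vtx (n + 2) m \<omega>} \<in> X"
      using vtx_triangle(1)[OF w(1), of "n + 1" m] unfolding two by (simp only: insert_commute)
    show "{vtx (n + 1) m \<omega>, vtx (n + 1) (m + 1) \<omega>', vtx (n + 2) m \<omega>} \<in> X"
      using vtx_triangle(1)[OF w(2), of "n + 1" m] unfolding two x[symmetric] e(2)[symmetric]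
      by (simp only: insert_commute)
    show "vtx (n + 1) m \<omega> \<notin> {vtx (n + 1) (m + 1) \<omega>, vtx (n + 1) (m + 1) \<omega>', vtx n (m + 1) \<omega>, vtx (n + 2) m \<omega>}"
      "vtx (n + 1) (m + 1) \<omega> \<notin> {vtx n (m + 1) \<omega>, vtx (n + 2) m \<omega>}"
      "vtx (n + 1) (m + 1) \<omega>' \<notin> {vtx n (m + 1) \<omega>, vtx (n + 2) m \<omega>}"
      using vtx_neq w by simp_all
  qed
  then show ?thesis using vtx_neq[OF w(1,1), of n "m + 1" "n + 2" m] by simp
qed

lemma vtx_rigid2:
  assumes w: "\<omega> \<in> \<Omega>" "\<omega>' \<in> \<Omega>" and e: "vtx (n + 1) m \<omega> = vtx (n + 1) m \<omega>'" "vtx n (m + 2) \<omega> = vtx n (m + 2) \<omega>'"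
  shows "vtx (n + 1) (m + 1) \<omega> = vtx (n + 1) (m + 1) \<omega>'"
proof -
  have two: "m + 1 + 1 = m + 2" by simp
  have x: "vtx n (m + 1) \<omega> = vtx n (m + 1) \<omega>'" using vtx_mono2[OF w, of n "m + 1"] e(2) by (simp add: add.commute)
  have "vtx (n + 1) (m + 1) \<omega> = vtx (n + 1) (m + 1) \<omega>' \<or> vtx (n + 1) m \<omega> = vtx n (m + 2) \<omega>"
  proof (rule link_girth)
    show "{vtx n (m + 1) \<omega>, vtx (n + 1) (m + 1) \<omega>, vtx (n + 1) m \<omega>} \<in> X"
      using vtx_triangle(2)[OF w(1), of n m] by (simp add: insert_commute)
    show "{vtx n (m + 1) \<omega>, vtx (n + 1) (m + 1) \<omega>', vtx (n + 1) m \<omega>} \<in> X"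
      using vtx_triangle(2)[OF w(2), of n m] by (simp add: insert_commute x e)
    show "{vtx n (m + 1) \<omega>, vtx (n + 1) (m + 1) \<omega>, vtx n (m + 2) \<omega>} \<in> X"
      using vtx_triangle(1)[OF w(1), of n "m + 1"] unfolding two by (simp only: insert_commute)
    show "{vtx n (m + 1) \<omega>, vtx (n + 1) (m + 1) \<omega>', vtx n (m + 2) \<omega>} \<in> X"
      using vtx_triangle(1)[OF w(2), of n "m + 1"] unfolding two x[symmetric] e(2)[symmetric]
      by (simp only: insert_commute)
    show "vtx n (m + 1) \<omega> \<notin> {vtx (n + 1) (m + 1) \<omega>, vtx (n + 1) (m + 1) \<omega>', vtx (n + 1) m \<omega>, vtx n (m + 2) \<omega>}"
      "vtx (n + 1) (m + 1) \<omega> \<notin> {vtx (n + 1) m \<omega>, vtx n (m + 2) \<omega>}"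
      "vtx (n + 1) (m + 1) \<omega>' \<notin> {vtx (n + 1) m \<omega>, vtx n (m + 2) \<omega>}"
      using vtx_neq w by simp_all
  qed
  then show ?thesis using vtx_neq[OF w(1,1), of "n + 1" m n "m + 2"] by simp
qed

lemma \<pi>_space: "space \<pi> = \<Omega>"
  using \<pi> by (simp add: boundary_measure_def)

lemma atom_vtx:
  assumes "\<omega> \<in> \<Omega>"
  shows "atom t Apts \<omega>0 (vtx n m \<omega>) = {\<omega>' \<in> \<Omega>. vtx n m \<omega>' = vtx n m \<omega>}"
proof -
  have "vtx n m \<omega> \<in> \<Union>(ap \<omega>') \<longleftrightarrow> vtx n m \<omega>' = vtx n m \<omega>" if "\<omega>' \<in> \<Omega>" for \<omega>'
    using vtx(1)[OF that, of n m] vtx_unique[OF that _ vtx(2)[OF assms], of n m] by metis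
  then show ?thesis by (auto simp: atom_def)
qed

lemma vtx_in_X: "\<omega> \<in> \<Omega> \<Longrightarrow> vtx n m \<omega> \<in> \<Union>X"
  using vtx_triangle(1)[of \<omega> n m] by blast

lemma \<rho>_vtx:
  assumes w: "\<omega> \<in> \<Omega>"
  shows "(\<psi> \<circ> \<rho>0) (vtx n m \<omega>) = weight n m"
  using chart_wt[OF ap_chart[OF w] vtx(1)[OF w], of n m] vtx(2)[OF w, of n m] by (simp add: wt_def)

lemma atom_in_atoms: "\<omega> \<in> \<Omega> \<Longrightarrow> {\<omega>' \<in> \<Omega>. vtx n m \<omega>' = vtx n m \<omega>} \<in> atoms X t Apts \<omega>0 (\<psi> \<circ> \<rho>0) (weight n m)"
  unfolding atoms_def atom_vtx[symmetric] using vtx_in_X \<rho>_vtx by blast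

lemma atom_sets:
  assumes w: "\<omega> \<in> \<Omega>"
  shows "{\<omega>' \<in> \<Omega>. vtx n m \<omega>' = vtx n m \<omega>} \<in> sets \<pi>"
proof -
  have "weight n m \<in> weight_lattice" by (auto simp: weight_lattice_def)
  then show ?thesis
    using atom_in_atoms[OF w, of n m] \<pi> unfolding boundary_measure_def
    by (auto intro!: sigma_sets.Basic)
qed

lemma atom_emeasure:
  assumes w: "\<omega> \<in> \<Omega>"
  shows "emeasure \<pi> {\<omega>' \<in> \<Omega>. vtx n m \<omega>' = vtx n m \<omega>} = ennreal (real q powi (- 2 * (n + m)))"
proof -
  have "emeasure \<pi> (atom t Apts \<omega>0 (vtx n m \<omega>)) = ennreal (real q powr (- 2 * ((\<psi> \<circ> \<rho>0) (vtx n m \<omega>) \<bullet> alpha0)))"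
    using \<pi> vtx_in_X[OF w] unfolding boundary_measure_def by blast
  also have "- 2 * ((\<psi> \<circ> \<rho>0) (vtx n m \<omega>) \<bullet> alpha0) = of_int (- 2 * (n + m))"
    unfolding \<rho>_vtx[OF w] by simp
  also have "real q powr of_int (- 2 * (n + m)) = real q powi (- 2 * (n + m))"
    using thickness by (intro powr_real_of_int') auto
  finally show ?thesis unfolding atom_vtx[OF w] .
qed

sublocale tp: two_parameter "completion \<pi>" vtx q
proof
  show "2 \<le> q" by (rule thickness)
next
  fix \<omega> n m assume "\<omega> \<in> space (completion \<pi>)"
  then have w: "\<omega> \<in> \<Omega>" by (simp add: \<pi>_space)
  show "{\<omega>' \<in> space (completion \<pi>). vtx n m \<omega>' = vtx n m \<omega>} \<in> sets (completion \<pi>)"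
    using atom_sets[OF w] by (simp add: \<pi>_space)
  show "emeasure (completion \<pi>) {\<omega>' \<in> space (completion \<pi>). vtx n m \<omega>' = vtx n m \<omega>} = ennreal (real q powi (- 2 * (n + m)))"
    unfolding atom_emeasure[OF w, symmetric] space_completion \<pi>_space using atom_sets[OF w, of n m]
    by simp
  show "finite (vtx (n + 1) (m + 1) ` {\<omega>' \<in> space (completion \<pi>). vtx (n + 1) m \<omega>' = vtx (n + 1) m \<omega> \<and> vtx n (m + 1) \<omega>' = vtx n (m + 1) \<omega>}) \<and>
      card (vtx (n + 1) (m + 1) ` {\<omega>' \<in> space (completion \<pi>). vtx (n + 1) m \<omega>' = vtx (n + 1) m \<omega> \<and> vtx n (m + 1) \<omega>' = vtx n (m + 1) \<omega>}) \<le> q"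
    unfolding space_completion \<pi>_space by (rule vtx_fiber[OF w])
  show "finite (vtx n (m + 1) ` {\<omega>' \<in> space (completion \<pi>). vtx (n + 1) m \<omega>' = vtx (n + 1) m \<omega>}) \<and>
      card (vtx n (m + 1) ` {\<omega>' \<in> space (completion \<pi>). vtx (n + 1) m \<omega>' = vtx (n + 1) m \<omega>}) \<le> q"
    unfolding space_completion \<pi>_space by (rule vtx_fiber1[OF w])
  show "finite (vtx (n + 1) m ` {\<omega>' \<in> space (completion \<pi>). vtx n (m + 1) \<omega>' = vtx n (m + 1) \<omega>}) \<and>
      card (vtx (n + 1) m ` {\<omega>' \<in> space (completion \<pi>). vtx n (m + 1) \<omega>' = vtx n (m + 1) \<omega>}) \<le> q"
    unfolding space_completion \<pi>_space by (rule vtx_fiber2[OF w])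
qed (unfold space_completion \<pi>_space,
    (erule (2) vtx_mono1 vtx_mono2 | erule (1) vtx_tail | erule (7) vtx_girth | erule (3) vtx_rigid1 vtx_rigid2)+)

end

section \<open>Conditional expectations\<close>

lemma ennreal_abs_diff_le:
  assumes "a \<le> c" "b \<le> c"
  shows "ennreal \<bar>enn2real a - enn2real b\<bar> \<le> c"
proof -
  \<comment> \<open>\<open>enn2real\<close> sends infinity to 0, which only lowers the
    value.\<close>
  have "ennreal (enn2real x) \<le> x" for x by (cases x) simp_all
  then have "ennreal (enn2real a) \<le> c" "ennreal (enn2real b) \<le> c"
    using assms order_trans by blast+
  moreover have "\<bar>enn2real a - enn2real b\<bar> \<le> enn2real a \<or> \<bar>enn2real a - enn2real b\<bar> \<le> enn2real b"
    using enn2real_nonneg[of a] enn2real_nonneg[of b] by linarith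
  ultimately show ?thesis by (meson ennreal_leI order_trans)
qed

context pointed_building
begin

abbreviation F :: "int \<Rightarrow> int \<Rightarrow> 'v boundary_point measure" where
  "F n m \<equiv> boundary_filtration X t Apts \<omega>0 (\<psi> \<circ> \<rho>0) \<pi> (weight n m)"

abbreviation P :: "'v boundary_point measure" where
  "P \<equiv> completion \<pi>"

lemma P_space: "space P = \<Omega>"
  by (simp add: \<pi>_space)

text \<open>The prescribed mass of an atom is positive, so the atom of a vertex \<open>x\<close> is
  not empty and \<open>x\<close> occurs as some \<open>vtx n m \<omega>\<close>.\<close>

lemma atoms_eq:
  "atoms X t Apts \<omega>0 (\<psi> \<circ> \<rho>0) (weight n m) = (\<lambda>\<omega>. {\<omega>' \<in> \<Omega>. vtx n m \<omega>' = vtx n m \<omega>}) ` \<Omega>"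
proof (intro equalityI subsetI)
  fix a assume "a \<in> atoms X t Apts \<omega>0 (\<psi> \<circ> \<rho>0) (weight n m)"
  then obtain x where x: "a = atom t Apts \<omega>0 x" "x \<in> \<Union>X" "(\<psi> \<circ> \<rho>0) x = weight n m"
    unfolding atoms_def by blast
  have "emeasure \<pi> a = ennreal (real q powr (- 2 * ((\<psi> \<circ> \<rho>0) x \<bullet> alpha0)))"
    using \<pi> x(2) unfolding x(1) boundary_measure_def by blast
  also have "\<dots> \<noteq> 0" using thickness by simp
  finally have "a \<noteq> {}" by auto
  then obtain \<omega> where w: "\<omega> \<in> \<Omega>" "x \<in> \<Union>(ap \<omega>)" unfolding x(1) atom_def by blast
  have "zc x = (n, m)" using x(3) by simp
  then have "a = {\<omega>' \<in> \<Omega>. vtx n m \<omega>' = vtx n m \<omega>}"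
    using atom_vtx[OF w(1), of n m] vtx_unique[OF w] x(1) by simp
  with w show "a \<in> (\<lambda>\<omega>. {\<omega>' \<in> \<Omega>. vtx n m \<omega>' = vtx n m \<omega>}) ` \<Omega>" by blast
qed (use atom_in_atoms in blast)

lemma generator_subset:
  "atoms X t Apts \<omega>0 (\<psi> \<circ> \<rho>0) (weight n m) \<union> null_sets P \<subseteq> Pow \<Omega>"
  using sets.sets_into_space[of _ P] unfolding atoms_eq P_space by (auto dest: null_setsD2)

lemma F_space: "space (F n m) = \<Omega>"
  unfolding boundary_filtration_def by (rule space_measure_of[OF generator_subset])

lemma F_sets: "sets (F n m) = sigma_sets \<Omega> (atoms X t Apts \<omega>0 (\<psi> \<circ> \<rho>0) (weight n m) \<union> null_sets P)"
  unfolding boundary_filtration_def by (rule sets_measure_of[OF generator_subset])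

lemma F_subalgebra: "subalgebra P (F n m)"
  unfolding subalgebra_def F_space P_space
proof
  have "atoms X t Apts \<omega>0 (\<psi> \<circ> \<rho>0) (weight n m) \<union> null_sets P \<subseteq> sets P"
    unfolding atoms_eq using atom_sets by auto
  then show "sets (F n m) \<subseteq> sets P"
    unfolding F_sets using sets.sigma_sets_subset[of _ P] P_space by simp
qed simp

lemma block_in_F:
  assumes "\<omega> \<in> \<Omega>"
  shows "{\<omega>' \<in> \<Omega>. vtx n m \<omega>' = vtx n m \<omega>} \<in> sets (F n m)"
  unfolding F_sets using assms by (intro sigma_sets.Basic) (auto simp: atoms_eq)

text \<open>Its purpose is sigma-finiteness of the subalgebra: countably many blocks of finite mass
  cover the space, although the total mass may be infinite.\<close>

lemma F_partition: "uniform_partition (restr_to_subalg P (F n m)) (vtx n m) (tp.s n m)"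
proof (rule uniform_partition.intro)
  have sp: "space (restr_to_subalg P (F n m)) = \<Omega>" by (simp only: space_restr_to_subalg P_space)
  show "0 < tp.s n m" by simp
  show "countable (vtx n m ` space (restr_to_subalg P (F n m)))"
    using tp.countable_labels[of n m] unfolding sp P_space .
  fix \<omega> assume "\<omega> \<in> space (restr_to_subalg P (F n m))"
  then have w: "\<omega> \<in> \<Omega>" unfolding sp .
  show "{\<omega>' \<in> space (restr_to_subalg P (F n m)). vtx n m \<omega>' = vtx n m \<omega>} \<in> sets (restr_to_subalg P (F n m))"
    unfolding sp sets_restr_to_subalg[OF F_subalgebra] by (rule block_in_F[OF w])
  show "emeasure (restr_to_subalg P (F n m)) {\<omega>' \<in> space (restr_to_subalg P (F n m)). vtx n m \<omega>' = vtx n m \<omega>} = ennreal (tp.s n m)"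
    unfolding sp emeasure_restr_to_subalg[OF F_subalgebra block_in_F[OF w]]
    using tp.B_emeasure[of \<omega> n m] w unfolding tp.B_def P_space by simp
qed

lemma F_sigma_finite: "sigma_finite_subalgebra P (F n m)"
  using F_subalgebra uniform_partition.sigma_finite[OF F_partition] by (rule sigma_finite_subalgebra.intro)

text \<open>Up to null sets the events are unions of blocks; complements and countable unions
  preserve this, and it takes care of the null sets adjoined to the field.\<close>

lemma F_set_label:
  assumes "E \<in> sets (F n m)"
  shows "\<exists>L. AE \<omega> in P. \<omega> \<in> E \<longleftrightarrow> vtx n m \<omega> \<in> L"
  using assms unfolding F_sets
proof (induction rule: sigma_sets.induct)
  case (Basic a)
  show ?case
  proof (cases "a \<in> null_sets P")
    case True
    then have "AE \<omega> in P. \<omega> \<in> a \<longleftrightarrow> vtx n m \<omega> \<in> {}" using AE_not_in[OF True] by simp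
    then show ?thesis by blast
  next
    case False
    then obtain \<omega> where a: "a = {\<omega>' \<in> \<Omega>. vtx n m \<omega>' = vtx n m \<omega>}" using Basic unfolding atoms_eq by blast
    have "AE \<eta> in P. \<eta> \<in> a \<longleftrightarrow> vtx n m \<eta> \<in> {vtx n m \<omega>}" by (rule AE_I2) (simp add: a P_space \<pi>_space)
    then show ?thesis by blast
  qed
next
  case Empty
  have "AE \<omega> in P. \<omega> \<in> {} \<longleftrightarrow> vtx n m \<omega> \<in> {}" by simp
  then show ?case by blast
next
  case (Compl a)
  then obtain L where L: "AE \<omega> in P. \<omega> \<in> a \<longleftrightarrow> vtx n m \<omega> \<in> L" by blast
  have "AE \<omega> in P. \<omega> \<in> \<Omega> - a \<longleftrightarrow> vtx n m \<omega> \<in> - L" using L AE_space by eventually_elim (simp add: \<pi>_space)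
  then show ?case by blast
next
  case (Union a)
  then have "\<forall>i. \<exists>L. AE \<omega> in P. \<omega> \<in> a i \<longleftrightarrow> vtx n m \<omega> \<in> L" by blast
  then obtain L where "\<forall>i. AE \<omega> in P. \<omega> \<in> a i \<longleftrightarrow> vtx n m \<omega> \<in> L i" by metis
  then have "AE \<omega> in P. \<forall>i::nat. \<omega> \<in> a i \<longleftrightarrow> vtx n m \<omega> \<in> L i" by (simp add: AE_all_countable)
  then have "AE \<omega> in P. \<omega> \<in> (\<Union>i. a i) \<longleftrightarrow> vtx n m \<omega> \<in> (\<Union>i. L i)" by eventually_elim simp
  then show ?case by blast
qed

text \<open>On an event that depends only on the label, averaging moves to its indicator and leaves
  it unchanged; the average itself is a function of the label.\<close>

lemma nn_cond_exp_avg: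
  assumes [measurable]: "f \<in> borel_measurable P"
  shows "AE \<omega> in P. tp.A n m f \<omega> = nn_cond_exp P (F n m) f \<omega>"
proof -
  interpret sigma_finite_subalgebra P "F n m" by (rule F_sigma_finite)
  show ?thesis
  proof (rule nn_cond_exp_charact)
    fix E assume E: "E \<in> sets (F n m)"
    obtain L where L: "AE \<omega> in P. \<omega> \<in> E \<longleftrightarrow> vtx n m \<omega> \<in> L" using F_set_label[OF E] by blast
    define g :: "'v boundary_point \<Rightarrow> ennreal" where "g \<omega> = indicator L (vtx n m \<omega>)" for \<omega>
    have [measurable]: "g \<in> borel_measurable P"
      unfolding g_def by (rule uniform_partition.label_function_measurable[OF tp.uniform_partition])
    have "(\<integral>\<^sup>+\<omega>. f \<omega> * indicator E \<omega> \<partial>P) = (\<integral>\<^sup>+\<omega>. g \<omega> * f \<omega> \<partial>P)"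
    proof (rule nn_integral_cong_AE)
      show "AE \<omega> in P. f \<omega> * indicator E \<omega> = g \<omega> * f \<omega>"
        using L by eventually_elim (simp add: g_def indicator_def)
    qed
    also have "\<dots> = (\<integral>\<^sup>+\<omega>. tp.A n m g \<omega> * f \<omega> \<partial>P)"
      by (intro nn_integral_cong arg_cong2[of _ _ _ _ "(*)"] tp.A_saturated[symmetric]) (simp_all add: g_def)
    also have "\<dots> = (\<integral>\<^sup>+\<omega>. g \<omega> * tp.A n m f \<omega> \<partial>P)" by (rule tp.A_adjoint[symmetric]) measurable
    also have "\<dots> = (\<integral>\<^sup>+\<omega>. tp.A n m f \<omega> * indicator E \<omega> \<partial>P)"
    proof (rule nn_integral_cong_AE)
      show "AE \<omega> in P. g \<omega> * tp.A n m f \<omega> = tp.A n m f \<omega> * indicator E \<omega>"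
        using L by eventually_elim (simp add: g_def indicator_def)
    qed
    finally show "(\<integral>\<^sup>+\<omega>. f \<omega> * indicator E \<omega> \<partial>P) = (\<integral>\<^sup>+\<omega>. tp.A n m f \<omega> * indicator E \<omega> \<partial>P)" .
  next
    have "tp.A n m f \<in> borel_measurable (restr_to_subalg P (F n m))"
      unfolding tp.A_eq[abs_def] tp.B_def
      by (rule uniform_partition.label_function_measurable[OF F_partition,
            of "\<lambda>v. (\<integral>\<^sup>+\<omega>'. f \<omega>' * indicator {\<omega>' \<in> space P. vtx n m \<omega>' = v} \<omega>' \<partial>P) / ennreal (tp.s n m)"])
    then show "tp.A n m f \<in> borel_measurable (F n m)"
      by (simp add: measurable_def sets_restr_to_subalg[OF F_subalgebra] space_restr_to_subalg F_space \<pi>_space)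
  qed measurable
qed

text \<open>The positive and negative parts of \<open>g\<close> both have averages between 0 and
  that of \<open>h\<close>, and a difference of two such numbers is bounded by the larger
  one.\<close>

lemma real_cond_exp_le:
  assumes [measurable]: "g \<in> borel_measurable P" "h \<in> borel_measurable P"
    and le: "\<And>\<omega>. ennreal \<bar>g \<omega>\<bar> \<le> h \<omega>"
  shows "AE \<omega> in P. ennreal \<bar>real_cond_exp P (F n m) g \<omega>\<bar> \<le> tp.A n m h \<omega>"
proof -
  have 1: "tp.A n m (\<lambda>\<omega>. ennreal (g \<omega>)) \<omega> \<le> tp.A n m h \<omega>" "tp.A n m (\<lambda>\<omega>. ennreal (- g \<omega>)) \<omega> \<le> tp.A n m h \<omega>" for \<omega>
    by (rule tp.A_mono, rule order_trans[OF ennreal_leI le], simp)+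
  show ?thesis
    using nn_cond_exp_avg[of "\<lambda>\<omega>. ennreal (g \<omega>)" n m, simplified] nn_cond_exp_avg[of "\<lambda>\<omega>. ennreal (- g \<omega>)" n m, simplified]
  proof eventually_elim
    case (elim \<omega>)
    show ?case
      unfolding real_cond_exp_def elim[symmetric] by (rule ennreal_abs_diff_le[OF 1])
  qed
qed

lemma maximal_function_le:
  assumes f: "f \<in> borel_measurable P"
  shows "AE \<omega> in P. maximal_function P (boundary_filtration X t Apts \<omega>0 (\<psi> \<circ> \<rho>0) \<pi>) f \<omega> \<le>
    2 * (SUP (n, m)\<in>UNIV. tp.A n m (\<lambda>\<omega>. ennreal (cmod (f \<omega>))) \<omega>)"
proof -
  note [measurable] = f
  let ?h = "\<lambda>\<omega>. ennreal (cmod (f \<omega>))"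
  \<comment> \<open>The factor 2 is the price of treating real and imaginary part
    separately.\<close>
  have "AE \<omega> in P. ennreal (cmod (complex_cond_exp P (F n m) f \<omega>)) \<le> 2 * tp.A n m ?h \<omega>" for n m
  proof -
    have "AE \<omega> in P. ennreal \<bar>real_cond_exp P (F n m) (\<lambda>y. Re (f y)) \<omega>\<bar> \<le> tp.A n m ?h \<omega>"
    proof (rule real_cond_exp_le)
      show "ennreal \<bar>Re (f \<omega>)\<bar> \<le> ennreal (cmod (f \<omega>))" for \<omega> by (intro ennreal_leI abs_Re_le_cmod)
    qed measurable
    moreover have "AE \<omega> in P. ennreal \<bar>real_cond_exp P (F n m) (\<lambda>y. Im (f y)) \<omega>\<bar> \<le> tp.A n m ?h \<omega>"
    proof (rule real_cond_exp_le)
      show "ennreal \<bar>Im (f \<omega>)\<bar> \<le> ennreal (cmod (f \<omega>))" for \<omega> by (intro ennreal_leI abs_Im_le_cmod)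
    qed measurable
    ultimately show ?thesis
    proof eventually_elim
      case (elim \<omega>)
      let ?z = "complex_cond_exp P (F n m) f \<omega>"
      have "ennreal (cmod ?z) \<le> ennreal (\<bar>Re ?z\<bar> + \<bar>Im ?z\<bar>)" by (intro ennreal_leI cmod_le)
      also have "\<dots> = ennreal \<bar>Re ?z\<bar> + ennreal \<bar>Im ?z\<bar>" by (rule ennreal_plus) simp_all
      also have "\<dots> \<le> tp.A n m ?h \<omega> + tp.A n m ?h \<omega>"
        using elim by (intro add_mono) (simp_all add: complex_cond_exp_def)
      finally show ?case by (simp add: mult_2)
    qed
  qed
  \<comment> \<open>The index set is countable, so one null set serves for all indices.\<close>
  then have "AE \<omega> in P. \<forall>z. ennreal (cmod (complex_cond_exp P (F (fst z) (snd z)) f \<omega>)) \<le> 2 * tp.A (fst z) (snd z) ?h \<omega>"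
    unfolding AE_all_countable by blast
  then show ?thesis
  proof eventually_elim
    case (elim \<omega>)
    show ?case
      unfolding maximal_function_def
    proof (rule SUP_least, clarify)
      fix n m :: int
      have "ennreal (cmod (complex_cond_exp P (F n m) f \<omega>)) \<le> 2 * tp.A n m ?h \<omega>"
        using elim[rule_format, of "(n, m)"] by simp
      also have "\<dots> \<le> 2 * (SUP (n, m)\<in>UNIV. tp.A n m ?h \<omega>)"
        by (intro mult_left_mono SUP_upper2[of "(n, m)"]) auto
      finally show "ennreal (cmod (complex_cond_exp P (F n m) f \<omega>)) \<le> 2 * (SUP (n, m)\<in>UNIV. tp.A n m ?h \<omega>)" .
    qed
  qed
qed

lemma maximal_function_measurable:
  assumes "f \<in> borel_measurable P"
  shows "maximal_function P (boundary_filtration X t Apts \<omega>0 (\<psi> \<circ> \<rho>0) \<pi>) f \<in> borel_measurable P"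
proof -
  have *: "real_cond_exp P (F n m) g \<in> borel_measurable P" for n m g
    by (rule measurable_from_subalg[OF F_subalgebra borel_measurable_cond_exp])
  have "(\<lambda>\<omega>. ennreal (cmod (complex_cond_exp P (F n m) f \<omega>))) \<in> borel_measurable P" for n m
    unfolding complex_cond_exp_def cmod_def complex.sel using *[of n m] by measurable
  then show ?thesis
    unfolding maximal_function_def[abs_def] by (intro borel_measurable_SUP) auto
qed

text \<open>For infinite \<open>p\<close> no average exceeds the essential supremum, and 2 is a
  possible constant. For finite \<open>p\<close> the constant combines that of
  \<open>strong_maximal\<close> with this factor 2.\<close>

theorem maximal_bound:
  assumes p: "1 < p"
  shows "\<exists>C>0. \<forall>f\<in>Lp_space p P. Lp_norm p P (maximal_function P (boundary_filtration X t Apts \<omega>0 (\<psi> \<circ> \<rho>0) \<pi>) f)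
    \<le> ennreal C * Lp_norm p P (\<lambda>\<omega>. ennreal (cmod (f \<omega>)))"
proof (cases "p = \<infinity>")
  case True
  have "esssup P (maximal_function P (boundary_filtration X t Apts \<omega>0 (\<psi> \<circ> \<rho>0) \<pi>) f)
      \<le> ennreal 2 * esssup P (\<lambda>\<omega>. ennreal (cmod (f \<omega>)))" if "f \<in> Lp_space p P" for f
  proof (rule esssup_I)
    have f: "f \<in> borel_measurable P" using that by (simp add: Lp_space_def)
    then show "maximal_function P (boundary_filtration X t Apts \<omega>0 (\<psi> \<circ> \<rho>0) \<pi>) f \<in> borel_measurable P"
      by (rule maximal_function_measurable)
    have "(SUP (n, m)\<in>UNIV. tp.A n m (\<lambda>\<omega>. ennreal (cmod (f \<omega>))) \<omega>) \<le> esssup P (\<lambda>\<omega>. ennreal (cmod (f \<omega>)))"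
      if "\<omega> \<in> space P" for \<omega>
    proof (rule SUP_least)
      fix z :: "int \<times> int"
      have "tp.A (fst z) (snd z) (\<lambda>\<omega>. ennreal (cmod (f \<omega>))) \<omega> \<le> esssup P (\<lambda>\<omega>. ennreal (cmod (f \<omega>)))"
        by (rule uniform_partition.avg_le_bound[OF tp.uniform_partition esssup_AE[of "\<lambda>\<omega>. ennreal (cmod (f \<omega>))" P] that])
      then show "(case z of (n, m) \<Rightarrow> tp.A n m (\<lambda>\<omega>. ennreal (cmod (f \<omega>))) \<omega>) \<le> esssup P (\<lambda>\<omega>. ennreal (cmod (f \<omega>)))"
        by (simp add: case_prod_beta)
    qed
    then have "AE \<omega> in P. (SUP (n, m)\<in>UNIV. tp.A n m (\<lambda>\<omega>. ennreal (cmod (f \<omega>))) \<omega>) \<le> esssup P (\<lambda>\<omega>. ennreal (cmod (f \<omega>)))"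
      by (rule AE_I2)
    with maximal_function_le[OF f]
    show "AE \<omega> in P. maximal_function P (boundary_filtration X t Apts \<omega>0 (\<psi> \<circ> \<rho>0) \<pi>) f \<omega>
        \<le> ennreal 2 * esssup P (\<lambda>\<omega>. ennreal (cmod (f \<omega>)))"
    proof eventually_elim
      case (elim \<omega>)
      show ?case using order_trans[OF elim(1) mult_left_mono[OF elim(2)]] by simp
    qed
  qed
  then show ?thesis by (intro exI[of _ 2]) (simp add: Lp_norm_def True)
next
  case False
  define r where "r = enn2real p"
  have "p = ennreal r" using False by (simp add: r_def less_top)
  then have r: "1 < r" using p by simp
  obtain C where C: "0 < C" "\<And>f. f \<in> borel_measurable P \<Longrightarrow>
      (\<integral>\<^sup>+\<omega>. ennreal_powr (SUP (n, m)\<in>UNIV. tp.A n m f \<omega>) r \<partial>P) \<le> ennreal C * (\<integral>\<^sup>+\<omega>. ennreal_powr (f \<omega>) r \<partial>P)"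
    using tp.strong_maximal[OF r] by blast
  have "Lp_norm p P (maximal_function P (boundary_filtration X t Apts \<omega>0 (\<psi> \<circ> \<rho>0) \<pi>) f)
      \<le> ennreal ((2 powr r * C) powr (1 / r)) * Lp_norm p P (\<lambda>\<omega>. ennreal (cmod (f \<omega>)))" if "f \<in> Lp_space p P" for f
  proof -
    have f: "f \<in> borel_measurable P" using that by (simp add: Lp_space_def)
    note [measurable] = f
    let ?h = "\<lambda>\<omega>. ennreal (cmod (f \<omega>))"
    have "(\<integral>\<^sup>+\<omega>. ennreal_powr (maximal_function P (boundary_filtration X t Apts \<omega>0 (\<psi> \<circ> \<rho>0) \<pi>) f \<omega>) r \<partial>P)
        \<le> (\<integral>\<^sup>+\<omega>. ennreal (2 powr r) * ennreal_powr (SUP (n, m)\<in>UNIV. tp.A n m ?h \<omega>) r \<partial>P)"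
    proof (rule nn_integral_mono_AE)
      show "AE \<omega> in P. ennreal_powr (maximal_function P (boundary_filtration X t Apts \<omega>0 (\<psi> \<circ> \<rho>0) \<pi>) f \<omega>) r
          \<le> ennreal (2 powr r) * ennreal_powr (SUP (n, m)\<in>UNIV. tp.A n m ?h \<omega>) r"
        using maximal_function_le[OF f]
      proof eventually_elim
        case (elim \<omega>)
        from ennreal_powr_mono[OF elim, of r] show ?case
          using r ennreal_powr_mult[of 2 r "SUP (n, m)\<in>UNIV. tp.A n m ?h \<omega>"] by simp
      qed
    qed
    also have "\<dots> = ennreal (2 powr r) * (\<integral>\<^sup>+\<omega>. ennreal_powr (SUP (n, m)\<in>UNIV. tp.A n m ?h \<omega>) r \<partial>P)"
      by (intro nn_integral_cmult ennreal_powr_measurable borel_measurable_SUP countableI_type)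
        (simp add: case_prod_beta tp.A_measurable)
    also have "\<dots> \<le> ennreal (2 powr r) * (ennreal C * (\<integral>\<^sup>+\<omega>. ennreal_powr (?h \<omega>) r \<partial>P))"
      by (intro mult_left_mono C(2)) auto
    also have "\<dots> = ennreal (2 powr r * C) * (\<integral>\<^sup>+\<omega>. ennreal_powr (?h \<omega>) r \<partial>P)"
      using C(1) by (simp add: ennreal_mult mult.assoc)
    finally have "ennreal_powr (\<integral>\<^sup>+\<omega>. ennreal_powr (maximal_function P (boundary_filtration X t Apts \<omega>0 (\<psi> \<circ> \<rho>0) \<pi>) f \<omega>) r \<partial>P) (1 / r)
        \<le> ennreal_powr (ennreal (2 powr r * C) * (\<integral>\<^sup>+\<omega>. ennreal_powr (?h \<omega>) r \<partial>P)) (1 / r)"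
      using r by (intro ennreal_powr_mono) simp_all
    also have "\<dots> = ennreal ((2 powr r * C) powr (1 / r)) * ennreal_powr (\<integral>\<^sup>+\<omega>. ennreal_powr (?h \<omega>) r \<partial>P) (1 / r)"
      using r C(1) by (intro ennreal_powr_mult) simp_all
    finally show ?thesis using False by (simp add: Lp_norm_def r_def)
  qed
  then show ?thesis using C(1) by (intro exI[of _ "(2 powr r * C) powr (1 / r)"]) simp
qed

end

theorem theorem1:
  fixes X :: "'v set set" and t :: "'v \<Rightarrow> (real^3) set" and Apts :: "'v set set set" and q :: nat
    and O\<^sub>X :: 'v and \<omega>0 :: "'v boundary_point" and S0 :: "'v point set" and A0 :: "'v set set"
    and \<psi> :: "'v \<Rightarrow> real^3" and \<rho>0 :: "'v \<Rightarrow> 'v" and \<pi> :: "'v boundary_point measure"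
    and p :: ennreal
  assumes building: "triangle_building X t Apts q"
    and O: "O\<^sub>X \<in> \<Union>X" "t O\<^sub>X = cox_type 0"
    and \<omega>0: "\<omega>0 \<in> boundary t Apts"
    and S0: "S0 \<in> \<omega>0" "\<exists>A\<in>Apts. sector_in t A O\<^sub>X S0"
    and A0: "A0 \<in> Apts" "S0 \<subseteq> realization A0"
    and \<psi>: "chart t A0 \<psi>" "extend_affine \<psi> ` S0 = uminus ` base_sector"
    and \<rho>0: "retraction_from_sector t Apts S0 A0 \<rho>0"
    and \<pi>: "boundary_measure X t Apts q \<omega>0 (\<psi> \<circ> \<rho>0) \<pi>"
    and p: "1 < p"
  shows "\<exists>C>0. \<forall>f\<in>Lp_space p (completion \<pi>).
    Lp_norm p (completion \<pi>)
      (maximal_function (completion \<pi>) (boundary_filtration X t Apts \<omega>0 (\<psi> \<circ> \<rho>0) \<pi>) f)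
      \<le> ennreal C * Lp_norm p (completion \<pi>) (\<lambda>x. ennreal (cmod (f x)))"
proof -
  interpret triangle_building X t Apts q by (rule building)
  interpret pointed_building X t Apts q \<omega>0 S0 A0 \<psi> \<rho>0 \<pi>
    by standard (rule \<omega>0 S0(1) A0 \<psi> \<rho>0 \<pi>)+
  show ?thesis by (rule maximal_bound[OF p])
qed

end
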